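(* Consider the algorithm $$X_{n+1}=X_n+a_n b_n(X_n,\xi_n)+a_n h(X_n,\zeta_n)+a_n h_0(\tilde\zeta_n)+a_n\beta_n,\qquad n\ge 0,$$ with values in $\mathbb R^d$. Assume that $\{X_n\}$ is bounded w.p.1 and that the following hold. (A-i) $h(\cdot,\zeta)$ is continuous in $x$, uniformly in $\zeta$, on bounded sets of $x$. (A-ii) Either $h$ is a bounded measurable function, or there are non-negative measurable functions $g_1$ (of $x$) and $g_2,g_3$ (of $\zeta$) such that $g_1$ is bounded on bounded sets, $|h(x,\zeta)|\le g_1(x)g_2(\zeta)+g_3(\zeta)$, and for each $\varepsilon>0$ $$\lim_{\Delta\to0}\lim_{n\to\infty}\mathbb P\Big\{\sup_{j\ge n}\max_{t\le\Delta}\sum_{i=m(j\Delta)}^{m(j\Delta+t)-1}a_i[g_2(\zeta_i)+g_3(\zeta_i)]\ge\varepsilon\Big\}=0.$$ (A-iii) There is a continuous function $\bar h:\mathbb R^d\to\mathbb R^d$ such that for some $T>0$, each $\varepsilon>0$ and each $x$, $$\lim_{n\to\infty}\mathbb P\Big\{\sup_{j\ge n}\max_{t\le T}\Big|\sum_{i=m(jT)}^{m(jT+t)-1}a_i\big(h(x,\zeta_i)-\bar h(x)\big)\Big|\ge\varepsilon\Big\}=0.$$ (A-iv) $\{\xi_n\},\{\zeta_n\},\{\tilde\zeta_n\}$ are independent of each other and are exogenous noises, and $h_0$ is measurable such that for some $T>0$ and each $\varepsilon>0$, $$\lim_{n\to\infty}\mathbb P\Big\{\sup_{j\ge n}\max_{t\le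 T}\Big|\sum_{i=m(jT)}^{m(jT+t)-1}a_ih_0(\tilde\zeta_i)\Big|\ge\varepsilon\Big\}=0.$$ (A-v) $\{\beta_n\}$ is a sequence of bounded random variables with $|\beta_n|\to0$ w.p.1. (G) There is a set-valued mapping $G:\mathbb R^d\to2^{\mathbb R^d}$ such that: (i) $G$ has non-empty, compact, convex values, all contained in one finite common ball; (ii) the graph $\{(x,y):y\in G(x)\}$ is closed in $\mathbb R^d\times\mathbb R^d$; (iii) there is a sequence of positive real-valued functions $m_n(x,\xi)$, continuous in $x$ uniformly in $\xi$, such that for all $n,x,\xi$, $b_n(x,\xi)\in G(x)+m_n(x,\xi)\bar B$, and for some $T>0$, each $\varepsilon>0$ and each $x$, $$\lim_{n\to\infty}\mathbb P\Big\{\sup_{j\ge n}\max_{t\le T}\Big|\sum_{i=m(jT)}^{m(jT+t)-1}a_im_i(x,\xi_i)\Big|\ge\varepsilon\Big\}=0.$$ (GS) There is a unique $x^*\in\mathbb R^d$ with $0\in\bar h(x^* )+G(x^* )$; and, with $G^*(x):=\bar h(x+x^* )+G(x+x^* )$, there exist a collection $\mathcal U$ and a $\mathcal U$-generalized Lyapunov function $V:\mathbb R^d\to\mathbb R_+$ (with respect to $G^*$) such that the sublevel sets $\{x:V(x)\le l\}$ are compact for every $l>0$ and the $\mathcal U$-generalized derivative satisfies $\dot{\bar V}^{G^*}_{\mathcal U}(x)\le-\hat V_0(x)$ for all $x\neq0$, for some positive definite function $\hat V_0$. Then there is a null set $\Omega_0$ such that for every $\omega\notin\Omega_0$, $X_n$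 converges to $x^*$.
   Context: All random variables live on a complete probability space $(\Omega,\mathcal F,\mathbb P)$; $|\cdot|$ is the Euclidean norm on $\mathbb R^d$; $\bar B$ is the closed unit ball of $\mathbb R^d$; $\overline{\mathrm{co}}$ is closed convex hull. For sets, $S+S_1=\{x+y:x\in S,y\in S_1\}$, $kS=\{kx:x\in S\}$. Step sizes: $a_n>0$, $a_n\to0$, $\sum_n a_n=\infty$. The noises $\xi_n,\zeta_n,\tilde\zeta_n$ take values in measurable spaces; $b_n(x,\xi)$, $h(x,\zeta)$, $h_0(\tilde\zeta)$ and $\beta_n$ are $\mathbb R^d$-valued. Exogenous means: the distribution of $\{\xi_i,i>n\}$ conditioned on $\{\xi_i,X_n:i\le n\}$ equals that conditioned on $\{\xi_i:i\le n\}$, and similarly for $\zeta_n$ and $\tilde\zeta_n$. $t_0=0$, $t_n=\sum_{i=0}^{n-1}a_i$; $m(t)=\max\{n:t_n\le t\}$ for $t\ge0$ and $m(t)=0$ for $t<0$. Non-smooth analysis. A locally Lipschitz $V:\mathbb R^d\to\mathbb R$ is regular if for all $x,v$ the right directional derivative $V'_+(x,v)=\lim_{t\downarrow0}\frac{V(x+tv)-V(x)}{t}$ exists and equals $V^\circ(x,v)=\limsup_{y\to x,\,t\downarrow0}\frac{V(y+tv)-V(y)}{t}$. The Clarke gradient is $\partial V(x)=\overline{\mathrm{co}}\{\lim\nabla V(x_i):x_i\to x,\ x_i\notin\Omega_V\}$, where $\Omega_V$ is the null set where $\nabla V$ is not defined. Let $\mathcal U=\{U_i\}$ be a countable (possibly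 finite or empty) collection of real-valued Lipschitz regular functions on $\mathbb R^d$. For a set-valued $F:\mathbb R^d\to2^{\mathbb R^d}$ put $M^F_{U_i}(x)=\{q\in F(x):\exists a\in\mathbb R\text{ such that }p^\top q=a\ \forall p\in\partial U_i(x)\}$ and $\tilde F_{\mathcal U}(x)=\bigcap_iM^F_{U_i}(x)$ ($=F(x)$ if $\mathcal U$ is empty). The $\mathcal U$-generalized derivative of a locally Lipschitz $V$ in direction $F$ is $$\dot{\bar V}^F_{\mathcal U}(x)=\begin{cases}\min_{p\in\partial V(x)}\max_{q\in\tilde F_{\mathcal U}(x)}p^\top q&\text{if }V\text{ is regular},\\ \max_{p\in\partial V(x)}\max_{q\in\tilde F_{\mathcal U}(x)}p^\top q&\text{if }V\text{ is not regular},\end{cases}$$ understood as $-\infty$ if $\tilde F_{\mathcal U}(x)=\emptyset$. A function $V:\mathbb R^d\to\mathbb R$ is positive definite if it is continuous, $V(0)=0$, and there are continuous strictly increasing $\alpha_1,\alpha_2:\mathbb R_+\to\mathbb R$ with $\alpha_1(0)=\alpha_2(0)=0$ and $\alpha_1(|x|)\le V(x)\le\alpha_2(|x|)$ for all $x$. A $\mathcal U$-generalized Lyapunov function (with respect to $F$) is a locally Lipschitz, positive definite $V$ with $\dot{\bar V}^F_{\mathcal U}(x)\le0$ for all $x$.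
   Formalization: The functions m_n(x,ξ) are assumed continuous in x uniformly in both ξ and n (a common modulus of continuity for the whole sequence); with uniformity in ξ only, the statement is false. *)

theory Defs
  imports "HOL-Probability.Probability"
begin

section \<open>Non-smooth analysis\<close>

definition locally_lipschitz :: "('a::euclidean_space \<Rightarrow> real) \<Rightarrow> bool" where
  "locally_lipschitz V \<longleftrightarrow> (\<forall>x. \<exists>r>0. \<exists>L. L-lipschitz_on (ball x r) V)"

text \<open>
  Clarke's generalized directional derivative. The point \<open>y\<close> tends to \<open>x\<close> unrestrictedly
  (\<open>y = x\<close> is allowed). It is taken in the extended reals so that the upper limit
  always exists; it is finite for locally Lipschitz \<open>V\<close>.
\<close>

definition clarke_dderiv :: "('a::euclidean_space \<Rightarrow> real) \<Rightarrow> 'a \<Rightarrow> 'a \<Rightarrow> ereal" where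
  "clarke_dderiv V x v =
     Limsup (nhds x \<times>\<^sub>F at_right 0) (\<lambda>(y, t). ereal ((V (y + t *\<^sub>R v) - V y) / t))"

definition regular_fun :: "('a::euclidean_space \<Rightarrow> real) \<Rightarrow> bool" where
  "regular_fun V \<longleftrightarrow> locally_lipschitz V \<and>
     (\<forall>x v. ((\<lambda>t. ereal ((V (x + t *\<^sub>R v) - V x) / t)) \<longlongrightarrow> clarke_dderiv V x v) (at_right 0))"

definition clarke_gradient :: "('a::euclidean_space \<Rightarrow> real) \<Rightarrow> 'a \<Rightarrow> 'a set" where
  "clarke_gradient V x = closure (convex hull
     {p. \<exists>y g. y \<longlonglongrightarrow> x \<and> (\<forall>i::nat. GDERIV V (y i) :> g i) \<and> g \<longlonglongrightarrow> p})"

definition admissible_collection :: "('a::euclidean_space \<Rightarrow> real) set \<Rightarrow> bool" where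
  "admissible_collection \<U> \<longleftrightarrow> countable \<U> \<and>
     (\<forall>U\<in>\<U>. (\<exists>L. L-lipschitz_on UNIV U) \<and> regular_fun U)"

definition constancy_set ::
    "('a::euclidean_space \<Rightarrow> real) \<Rightarrow> ('a \<Rightarrow> 'a set) \<Rightarrow> 'a \<Rightarrow> 'a set" where
  "constancy_set U F x = {q \<in> F x. \<exists>a::real. \<forall>p\<in>clarke_gradient U x. p \<bullet> q = a}"

text \<open>The intersection with \<open>F x\<close> only matters for empty \<open>\<U>\<close>, where the result is \<open>F x\<close>.\<close>

definition reduced_map ::
    "('a::euclidean_space \<Rightarrow> real) set \<Rightarrow> ('a \<Rightarrow> 'a set) \<Rightarrow> 'a \<Rightarrow> 'a set" where
  "reduced_map \<U> F x = F x \<inter> (\<Inter>U\<in>\<U>. constancy_set U F x)"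

text \<open>
  The minima and maxima are written as infima and suprema of extended reals. They are
  attained when \<open>F x\<close> is compact, since then \<open>reduced_map \<U> F x\<close> and, for locally Lipschitz
  \<open>V\<close>, \<open>clarke_gradient V x\<close> are compact.
\<close>

definition gen_derivative ::
    "('a::euclidean_space \<Rightarrow> real) set \<Rightarrow> ('a \<Rightarrow> 'a set) \<Rightarrow> ('a \<Rightarrow> real) \<Rightarrow> 'a \<Rightarrow> ereal" where
  "gen_derivative \<U> F V x =
     (if reduced_map \<U> F x = {} then - \<infinity>
      else if regular_fun V
      then (INF p\<in>clarke_gradient V x. SUP q\<in>reduced_map \<U> F x. ereal (p \<bullet> q))
      else (SUP p\<in>clarke_gradient V x. SUP q\<in>reduced_map \<U> F x. ereal (p \<bullet> q)))"

definition pos_definite :: "('a::euclidean_space \<Rightarrow> real) \<Rightarrow> bool" where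
  "pos_definite V \<longleftrightarrow> continuous_on UNIV V \<and> V 0 = 0 \<and>
     (\<exists>\<alpha>\<^sub>1 \<alpha>\<^sub>2 :: real \<Rightarrow> real.
        continuous_on {0..} \<alpha>\<^sub>1 \<and> strict_mono_on {0..} \<alpha>\<^sub>1 \<and> \<alpha>\<^sub>1 0 = 0 \<and>
        continuous_on {0..} \<alpha>\<^sub>2 \<and> strict_mono_on {0..} \<alpha>\<^sub>2 \<and> \<alpha>\<^sub>2 0 = 0 \<and>
        (\<forall>x. \<alpha>\<^sub>1 (norm x) \<le> V x \<and> V x \<le> \<alpha>\<^sub>2 (norm x)))"

definition gen_lyapunov ::
    "('a::euclidean_space \<Rightarrow> real) set \<Rightarrow> ('a \<Rightarrow> 'a set) \<Rightarrow> ('a \<Rightarrow> real) \<Rightarrow> bool" where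
  "gen_lyapunov \<U> F V \<longleftrightarrow> locally_lipschitz V \<and> pos_definite V \<and>
     (\<forall>x. gen_derivative \<U> F V x \<le> 0)"


section \<open>Time scale and asymptotic rate of change\<close>

definition step_time :: "(nat \<Rightarrow> real) \<Rightarrow> nat \<Rightarrow> real" where
  "step_time a n = (\<Sum>i<n. a i)"

definition step_index :: "(nat \<Rightarrow> real) \<Rightarrow> real \<Rightarrow> nat" where
  "step_index a t = (if t < 0 then 0 else Max {n. step_time a n \<le> t})"

definition window_sum ::
    "(nat \<Rightarrow> real) \<Rightarrow> real \<Rightarrow> nat \<Rightarrow> real \<Rightarrow> (nat \<Rightarrow> 'v::real_normed_vector) \<Rightarrow> 'v" where
  "window_sum a T j t f =
     (\<Sum>i\<in>{step_index a (real j * T)..<step_index a (real j * T + t)}. a i *\<^sub>R f i)"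

text \<open>
  The supremum over the infinitely many windows may be infinite, hence the extended reals.
\<close>

definition asymptotically_negligible ::
    "'w measure \<Rightarrow> (nat \<Rightarrow> real) \<Rightarrow> real \<Rightarrow> (nat \<Rightarrow> 'w \<Rightarrow> 'v::real_normed_vector) \<Rightarrow> bool" where
  "asymptotically_negligible M a T f \<longleftrightarrow> (\<forall>\<epsilon>>0.
     (\<lambda>n. measure M {\<omega> \<in> space M.
        ereal \<epsilon> \<le> (SUP j\<in>{n..}. SUP t\<in>{0..T}. ereal (norm (window_sum a T j t (\<lambda>i. f i \<omega>))))})
     \<longlonglongrightarrow> 0)"


section \<open>Noise processes\<close>

text \<open>The sigma-algebra generated by the variables \<open>\<xi> i\<close> with \<open>i \<in> I\<close>.\<close>

definition process_algebra ::
    "'w measure \<Rightarrow> 's measure \<Rightarrow> (nat \<Rightarrow> 'w \<Rightarrow> 's) \<Rightarrow> nat set \<Rightarrow> 'w measure" where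
  "process_algebra M S \<xi> I =
     vimage_algebra (space M) (\<lambda>\<omega>. \<lambda>i\<in>I. \<xi> i \<omega>) (PiM I (\<lambda>_. S))"

text \<open>The sigma-algebra generated by \<open>\<xi> i\<close> for \<open>i \<le> n\<close> together with \<open>X n\<close>.\<close>

definition process_state_algebra ::
    "'w measure \<Rightarrow> 's measure \<Rightarrow> (nat \<Rightarrow> 'w \<Rightarrow> 's) \<Rightarrow> (nat \<Rightarrow> 'w \<Rightarrow> 'a::topological_space)
      \<Rightarrow> nat \<Rightarrow> 'w measure" where
  "process_state_algebra M S \<xi> X n =
     vimage_algebra (space M) (\<lambda>\<omega>. (\<lambda>i\<in>{..n}. \<xi> i \<omega>, X n \<omega>)) (PiM {..n} (\<lambda>_. S) \<Otimes>\<^sub>M borel)"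

text \<open>
  Regular conditional distributions need not exist for an arbitrary state space \<open>S\<close>, so
  equality of the conditional distributions is expressed through the conditional
  probabilities of all events of the future.
\<close>

definition exogenous ::
    "'w measure \<Rightarrow> 's measure \<Rightarrow> (nat \<Rightarrow> 'w \<Rightarrow> 's) \<Rightarrow> (nat \<Rightarrow> 'w \<Rightarrow> 'a::topological_space)
      \<Rightarrow> bool" where
  "exogenous M S \<xi> X \<longleftrightarrow> (\<forall>n. \<forall>A\<in>sets (process_algebra M S \<xi> {n<..}).
     AE \<omega> in M. real_cond_exp M (process_state_algebra M S \<xi> X n) (indicator A) \<omega>
              = real_cond_exp M (process_algebra M S \<xi> {..n}) (indicator A) \<omega>)"

text \<open>
  Mutual independence of three processes, as that of the sigma-algebras they generate;
  the processes may have state spaces of different types.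
\<close>

definition independent_processes ::
    "'w measure \<Rightarrow> 's measure \<Rightarrow> (nat \<Rightarrow> 'w \<Rightarrow> 's) \<Rightarrow> 'z measure \<Rightarrow> (nat \<Rightarrow> 'w \<Rightarrow> 'z)
      \<Rightarrow> 'y measure \<Rightarrow> (nat \<Rightarrow> 'w \<Rightarrow> 'y) \<Rightarrow> bool" where
  "independent_processes M S \<xi> Z \<zeta> Y \<eta> \<longleftrightarrow>
     prob_space.indep_sets M
       (\<lambda>k. [sets (process_algebra M S \<xi> UNIV), sets (process_algebra M Z \<zeta> UNIV),
             sets (process_algebra M Y \<eta> UNIV)] ! k) {..<3}"

end

theory Submission
  imports Defs
begin

text \<open>
  Everything happens along one trajectory. Write \<open>F x = hbar (x + xstar) + G (x + xstar)\<close>. Outside a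
  null set the shifted iterates \<open>x n = X n - xstar\<close> stay bounded and satisfy
  \<open>x (n + 1) = x n + a n (y n + e n)\<close> with \<open>y n \<in> F (x n)\<close>, where the error \<open>e\<close> is negligible in the
  sense that its weighted sums over time windows of bounded length tend to zero (\<open>vanishing\<close>). The
  error collects \<open>h0\<close>, \<open>\<beta>\<close>, the part of \<open>b\<close> outside \<open>G\<close>, and the difference between
  \<open>h (X n) (\<zeta> n)\<close> and \<open>hbar (X n)\<close>. For the last one the assumption controls only sums with a frozen
  first argument; that is enough because the iterates move little over a short window
  (\<open>vanishing_averaging_error\<close>). Only countably many frozen arguments are ever used, so that the
  exceptional sets add up to a null set.

  Let \<open>p\<close> be a limit point of \<open>x\<close>. Reading the iterates on the time scale of the step sizes, with the
  times at which \<open>x\<close> is close to \<open>p\<close> moved to the origin, and passing to a limit gives a bounded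
  Lipschitz curve \<open>\<phi>\<close> on the whole real line with \<open>\<phi> 0 = p\<close> and \<open>\<phi>' t \<in> F (\<phi> t)\<close> wherever \<open>\<phi>\<close> is
  differentiable (\<open>limit_trajectory\<close>). Along \<open>\<phi>\<close> the Lyapunov function decreases at rate at least
  \<open>V0hat (\<phi> t)\<close>. If \<open>p\<close> were not zero, \<open>\<phi>\<close> would stay away from zero at all negative times, and \<open>V\<close>
  would grow without bound when time runs backwards, although \<open>\<phi>\<close> is bounded
  (\<open>complete_bounded_trajectory_at_equilibrium\<close>). So zero is the only limit point.

  The decrease of \<open>V\<close> along \<open>\<phi>\<close> is the non-smooth part of the argument. A Lipschitz function of a real
  variable is differentiable almost everywhere, so at almost every \<open>t\<close> the curve \<open>\<phi>\<close>, the function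
  \<open>V \<circ> \<phi>\<close> and all \<open>U \<circ> \<phi>\<close> with \<open>U \<in> \<U>\<close> have derivatives. At such a \<open>t\<close> a regular \<open>U\<close> satisfies
  \<open>p \<bullet> \<phi>' t = (U \<circ> \<phi>)' t\<close> for all Clarke gradients \<open>p\<close>, which puts \<open>\<phi>' t\<close> into the reduced map; if
  \<open>V\<close> is regular, the same identity bounds \<open>(V \<circ> \<phi>)' t\<close> by the generalized derivative
  (\<open>deriv_along_curve_le_gen_derivative\<close>). If \<open>V\<close> is not regular, one has to know that
  \<open>(V \<circ> \<phi>)' t \<le> p \<bullet> \<phi>' t\<close> up to any positive error for some \<open>p\<close> in the Clarke gradient. As that set is
  generated by limits of gradients at points of differentiability, this rests on a mean value
  inequality which only looks at such points, and hence on Rademacher's theorem.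
\<close>

section \<open>Lipschitz functions of a real variable\<close>

text \<open>
  Vitali's covering theorem selects, inside an open set that is barely larger than \<open>E\<close>, disjoint
  intervals of small slope that exhaust \<open>E\<close> up to a null set. Each of them is stretched by at most
  the factor \<open>r\<close>, and the null set left over has a null image because \<open>H\<close> is Lipschitz.
\<close>

lemma emeasure_image_le_slope:
  fixes H :: "real \<Rightarrow> real"
  assumes mono: "strict_mono H" and lip: "K-lipschitz_on UNIV H"
    and E: "E \<in> sets lebesgue" and HE: "H ` E \<in> sets lebesgue"
    and fin: "emeasure lebesgue E < \<infinity>" and r: "0 \<le> r"
    and slope: "\<And>x \<delta>. x \<in> E \<Longrightarrow> \<delta> > 0 \<Longrightarrow>
      \<exists>u v. u \<le> x \<and> x \<le> v \<and> u < v \<and> v - u < \<delta> \<and> H v - H u \<le> r * (v - u)"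
  shows "emeasure lebesgue (H ` E) \<le> ennreal r * emeasure lebesgue E"
proof -
  have bound: "emeasure lebesgue (H ` E) \<le> ennreal r * (emeasure lebesgue E + ennreal e)" if e: "e > 0" for e
  proof -
    obtain W where W: "open W" "E \<subseteq> W" "W - E \<in> lmeasurable" "emeasure lebesgue (W - E) < ennreal e"
      using sets_lebesgue_outer_open[OF E e] by metis
    \<comment> \<open>intervals are indexed by their endpoints; \<open>c\<close> and \<open>q\<close> present them as balls\<close>
    define I where "I = {p::real \<times> real. fst p < snd p \<and> {fst p..snd p} \<subseteq> W \<and> H (snd p) - H (fst p) \<le> r * (snd p - fst p)}"
    define c where "c p = (fst p + snd p) / 2" for p :: "real \<times> real"
    define q where "q p = (snd p - fst p) / 2" for p :: "real \<times> real"
    have cball_eq: "cball (c p) (q p) = {fst p..snd p}" for p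
      by (auto simp: c_def q_def cball_eq_atLeastAtMost field_simps)
    have vit: "\<exists>i. i \<in> I \<and> x \<in> cball (c i) (q i) \<and> q i < d" if x: "x \<in> E" and d: "0 < d" for x d
    proof -
      obtain \<rho> where \<rho>: "\<rho> > 0" "ball x \<rho> \<subseteq> W"
        using W x by (meson open_contains_ball subsetD)
      obtain u v where uv: "u \<le> x" "x \<le> v" "u < v" "v - u < min \<rho> d" "H v - H u \<le> r * (v - u)"
        using slope[OF x, of "min \<rho> d"] d \<rho> by auto
      have "{u..v} \<subseteq> ball x \<rho>"
        using uv by (auto simp: dist_real_def)
      then have "(u, v) \<in> I"
        using uv \<rho> by (auto simp: I_def)
      moreover have "x \<in> cball (c (u,v)) (q (u,v))" "q (u, v) < d"
        using uv d unfolding cball_eq by (auto simp: q_def)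
      ultimately show ?thesis by blast
    qed
    have qpos: "0 < q i" if "i \<in> I" for i
      using that by (auto simp: I_def q_def)
    obtain C where C: "countable C" "C \<subseteq> I"
      "pairwise (\<lambda>i j. disjnt (cball (c i) (q i)) (cball (c j) (q j))) C"
      "negligible (E - (\<Union>i\<in>C. cball (c i) (q i)))"
      using Vitali_covering_theorem_cballs[of I q E c] qpos vit by blast
    let ?J = "\<lambda>p. {fst p..snd p} :: real set"
    have disj: "disjoint_family_on ?J C"
      using C(3) unfolding cball_eq disjoint_family_on_def pairwise_def disjnt_def by blast
    have HJ: "H ` ?J p = {H (fst p)..H (snd p)}" if "p \<in> C" for p
    proof -
      have *: "fst p \<le> snd p" using that C(2) by (auto simp: I_def)
      have cont: "continuous_on {fst p..snd p} H"
        using lip by (meson lipschitz_on_continuous_on lipschitz_on_subset subset_UNIV)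
      have "{H (fst p)..H (snd p)} \<subseteq> H ` ?J p"
      proof
        fix y assume y: "y \<in> {H (fst p)..H (snd p)}"
        obtain x where "fst p \<le> x" "x \<le> snd p" "H x = y"
          using IVT'[of H "fst p" y "snd p"] y * cont by auto
        then show "y \<in> H ` ?J p" by auto
      qed
      moreover have "H ` ?J p \<subseteq> {H (fst p)..H (snd p)}"
        by (auto simp: strict_mono_less_eq[OF mono])
      ultimately show ?thesis by blast
    qed
    have disjH: "disjoint_family_on (\<lambda>p. H ` ?J p) C"
      using disj strict_mono_imp_inj_on[OF mono] unfolding disjoint_family_on_def
      by (metis image_Int image_empty)
    have negl: "negligible (H ` (E - (\<Union>i\<in>C. ?J i)))"
    proof (rule negligible_locally_Lipschitz_image)
      show "negligible (E - (\<Union>i\<in>C. ?J i))" using C(4) unfolding cball_eq .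
      show "\<exists>T B. open T \<and> x \<in> T \<and> (\<forall>y\<in>(E - (\<Union>i\<in>C. ?J i)) \<inter> T. norm (H y - H x) \<le> B * norm (y - x))" for x
        using lip by (intro exI[of _ UNIV] exI[of _ K]) (auto simp: lipschitz_on_def dist_norm)
    qed simp
    have m1: "H ` (E - (\<Union>i\<in>C. ?J i)) \<in> sets lebesgue"
      using negl by (rule negligible_imp_sets)
    have m2: "(\<Union>i\<in>C. H ` ?J i) \<in> sets lebesgue"
      using C(1) HJ by (intro sets.countable_UN') auto
    have "emeasure lebesgue (H ` E) \<le> emeasure lebesgue (H ` (E - (\<Union>i\<in>C. ?J i)) \<union> (\<Union>i\<in>C. H ` ?J i))"
      using m1 m2 by (intro emeasure_mono sets.Un) blast
    also have "\<dots> \<le> emeasure lebesgue (H ` (E - (\<Union>i\<in>C. ?J i))) + emeasure lebesgue (\<Union>i\<in>C. H ` ?J i)"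
      using m1 m2 by (rule emeasure_subadditive)
    also have "emeasure lebesgue (H ` (E - (\<Union>i\<in>C. ?J i))) = 0"
      using negl negligible_iff_emeasure0[OF m1] by blast
    also have "emeasure lebesgue (\<Union>i\<in>C. H ` ?J i) = (\<integral>\<^sup>+p. emeasure lebesgue (H ` ?J p) \<partial>count_space C)"
      using C(1) disjH HJ by (intro emeasure_UN_countable) auto
    also have "\<dots> \<le> (\<integral>\<^sup>+p. ennreal r * emeasure lebesgue (?J p) \<partial>count_space C)"
    proof (rule nn_integral_mono)
      fix p assume "p \<in> space (count_space C)"
      then have p: "p \<in> C" by simp
      then have "fst p < snd p" "H (snd p) - H (fst p) \<le> r * (snd p - fst p)" using C(2) by (auto simp: I_def)
      moreover from this have "H (fst p) < H (snd p)" by (simp add: strict_mono_less[OF mono])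
      ultimately show "emeasure lebesgue (H ` ?J p) \<le> ennreal r * emeasure lebesgue (?J p)"
        using p r by (simp add: HJ ennreal_mult[symmetric] ennreal_leI)
    qed
    also have "\<dots> = ennreal r * (\<integral>\<^sup>+p. emeasure lebesgue (?J p) \<partial>count_space C)"
      by (rule nn_integral_cmult) auto
    also have "(\<integral>\<^sup>+p. emeasure lebesgue (?J p) \<partial>count_space C) = emeasure lebesgue (\<Union>p\<in>C. ?J p)"
      using C(1) disj by (intro emeasure_UN_countable[symmetric]) auto
    also have "emeasure lebesgue (\<Union>p\<in>C. ?J p) \<le> emeasure lebesgue W"
      using C(2) W(1) by (intro emeasure_mono) (auto simp: I_def)
    also have "emeasure lebesgue W \<le> emeasure lebesgue E + emeasure lebesgue (W - E)"
    proof -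
      have "W = E \<union> (W - E)" using W(2) by blast
      then show ?thesis using E W(3) by (metis emeasure_subadditive fmeasurableD)
    qed
    also have "\<dots> \<le> emeasure lebesgue E + ennreal e"
      using W(4) by (intro add_left_mono) simp
    finally show ?thesis using mult_left_mono by (fastforce simp: add_left_mono)
  qed
  obtain M where M: "emeasure lebesgue E = ennreal M" "M \<ge> 0"
    using fin by (cases "emeasure lebesgue E") auto
  have b2: "emeasure lebesgue (H ` E) \<le> ennreal (r * (M + e))" if "e > 0" for e
    using bound[OF that] that r M by (simp add: ennreal_mult ennreal_plus)
  have "((\<lambda>e. ennreal (r * (M + e))) \<longlongrightarrow> ennreal (r * (M + 0))) (at_right 0)"
    by (intro tendsto_intros)
  then have "emeasure lebesgue (H ` E) \<le> ennreal (r * (M + 0))"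
    by (rule tendsto_lowerbound) (auto simp: eventually_at_right_field b2 intro!: exI[of _ 1])
  then show ?thesis using M r by (simp add: ennreal_mult)
qed


text \<open>
  Adding a steep linear function makes a Lipschitz function strictly increasing without changing
  where it is differentiable; the lower slope bound \<open>1\<close> makes the inverse Lipschitz as well, so that
  \<open>emeasure_image_le_slope\<close> applies in both directions.
\<close>

lemma lipschitz_plus_linear:
  fixes f :: "real \<Rightarrow> real"
  assumes f: "L-lipschitz_on UNIV f"
  defines "H \<equiv> \<lambda>x. f x + (L + 1) * x"
  shows "\<And>x y. x \<le> y \<Longrightarrow> y - x \<le> H y - H x"
    and "\<And>x y. x \<le> y \<Longrightarrow> H y - H x \<le> (2 * L + 1) * (y - x)"
    and "strict_mono H" and "(2 * L + 1)-lipschitz_on UNIV H"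
proof -
  have b: "\<bar>f y - f x\<bar> \<le> L * (y - x)" if "x \<le> y" for x y
    using lipschitz_onD[OF f, of x y] that by (simp add: dist_real_def abs_minus_commute)
  show 1: "y - x \<le> H y - H x" if "x \<le> y" for x y
    using b[OF that] unfolding H_def by (simp add: algebra_simps)
  show 2: "H y - H x \<le> (2 * L + 1) * (y - x)" if "x \<le> y" for x y
    using b[OF that] unfolding H_def by (simp add: algebra_simps)
  show "strict_mono H"
  proof (rule strict_monoI)
    fix x y :: real assume "x < y" then show "H x < H y" using 1[of x y] by simp
  qed
  have L: "0 \<le> L" using f by (rule lipschitz_on_nonneg)
  show "(2 * L + 1)-lipschitz_on UNIV H"
  proof (rule lipschitz_onI)
    fix x y :: real
    show "dist (H x) (H y) \<le> (2 * L + 1) * dist x y"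
      using 1[of x y] 2[of x y] 1[of y x] 2[of y x] by (cases "x \<le> y") (auto simp: dist_real_def)
  qed (use L in simp)
qed

text \<open>
  Slopes over intervals that contain \<open>x\<close> in their interior determine the derivative: by continuity
  an endpoint may be moved to \<open>x\<close>. Such intervals are preferred below because the points that they
  surround form open sets, so that the exceptional sets are visibly Borel.
\<close>

lemma deriv_from_straddling_slopes:
  fixes H :: "real \<Rightarrow> real"
  assumes cont: "continuous_on UNIV H"
    and sl: "\<And>e. e > 0 \<Longrightarrow> \<exists>d>0. \<forall>u v. u < x \<longrightarrow> x < v \<longrightarrow> v - u < d \<longrightarrow> \<bar>H v - H u - D * (v - u)\<bar> \<le> e * (v - u)"
  shows "(H has_real_derivative D) (at x)"
  unfolding has_field_derivative_iff
proof (rule LIM_I)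
  fix r :: real assume r: "0 < r"
  obtain d where d: "d > 0"
    and dd: "\<And>u v. u < x \<Longrightarrow> x < v \<Longrightarrow> v - u < d \<Longrightarrow> \<bar>H v - H u - D * (v - u)\<bar> \<le> r/2 * (v - u)"
    using sl[of "r/2"] r by auto
  have cl: "\<bar>H v - H u - D * (v - u)\<bar> \<le> r/2 * (v - u)" if uv: "u \<le> x" "x \<le> v" "v - u < d" for u v
  proof -
    let ?u = "\<lambda>t. u - t" and ?v = "\<lambda>t. v + t"
    have "\<forall>\<^sub>F t in at_right 0. \<bar>H (?v t) - H (?u t) - D * (?v t - ?u t)\<bar> \<le> r/2 * (?v t - ?u t)"
      unfolding eventually_at_right_field
    proof (intro exI[of _ "(d - (v - u))/2"] conjI allI impI)
      fix t assume "0 < t" "t < (d - (v - u))/2"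
      then show "\<bar>H (?v t) - H (?u t) - D * (?v t - ?u t)\<bar> \<le> r/2 * (?v t - ?u t)"
        using uv by (intro dd) auto
    qed (use uv in simp)
    moreover have "((\<lambda>t. H (?v t)) \<longlongrightarrow> H (v + 0)) (at_right 0)" "((\<lambda>t. H (?u t)) \<longlongrightarrow> H (u - 0)) (at_right 0)"
      by (rule continuous_on_tendsto_compose[OF cont]; auto intro!: tendsto_eq_intros)+
    then have "((\<lambda>t. \<bar>H (?v t) - H (?u t) - D * (?v t - ?u t)\<bar>) \<longlongrightarrow> \<bar>H (v + 0) - H (u - 0) - D * ((v + 0) - (u - 0))\<bar>) (at_right 0)"
      by (intro tendsto_intros)
    moreover have "((\<lambda>t. r/2 * (?v t - ?u t)) \<longlongrightarrow> r/2 * ((v + 0) - (u - 0))) (at_right 0)"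
      by (intro tendsto_intros)
    ultimately show ?thesis
      using tendsto_le[of "at_right (0::real)"] by fastforce
  qed
  show "\<exists>s>0. \<forall>y. y \<noteq> x \<and> norm (y - x) < s \<longrightarrow> norm ((H y - H x) / (y - x) - D) < r"
  proof (intro exI[of _ d] conjI allI impI d, elim conjE)
    fix y assume y: "y \<noteq> x" "norm (y - x) < d"
    have "\<bar>H y - H x - D * (y - x)\<bar> \<le> r/2 * \<bar>y - x\<bar>"
      using cl[of x y] cl[of y x] y by (cases "x \<le> y") (auto simp: abs_if algebra_simps split: if_splits)
    also have "\<dots> < r * \<bar>y - x\<bar>" using r y by simp
    finally have "\<bar>H y - H x - D * (y - x)\<bar> / \<bar>y - x\<bar> < r"
      using y by (simp add: field_simps)
    moreover have "(H y - H x) / (y - x) - D = (H y - H x - D * (y - x)) / (y - x)"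
      using y by (simp add: field_simps)
    ultimately show "norm ((H y - H x) / (y - x) - D) < r" by simp
  qed
qed

text \<open>
  Let \<open>H\<close> be the sum of \<open>f\<close> and a steep linear function. If \<open>H\<close> has slopes below \<open>r\<close> and slopes
  above \<open>s\<close> near every point of a bounded set \<open>E\<close>, with \<open>r < s\<close>, then the image of \<open>E\<close> has measure at most \<open>r\<close> times that of \<open>E\<close>; applied to the inverse function, the same
  estimate bounds the measure of \<open>E\<close> by \<open>1 / s\<close> times that of the image. Hence \<open>E\<close> is a null set.
  Rational \<open>r\<close> and \<open>s\<close> suffice to detect every point without a derivative.
\<close>

lemma lipschitz_real_differentiable_AE:
  fixes f :: "real \<Rightarrow> real"
  assumes f: "L-lipschitz_on UNIV f"
  shows "negligible {x. \<not> (\<exists>D. (f has_real_derivative D) (at x))}"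
proof -
  define H where "H x = f x + (L + 1) * x" for x
  note Hp = lipschitz_plus_linear[OF f, folded H_def]
  have L: "0 \<le> L" using f by (rule lipschitz_on_nonneg)
  have cont: "continuous_on UNIV H" using Hp(4) by (rule lipschitz_on_continuous_on)
  have inj: "inj H" using Hp(3) by (rule strict_mono_imp_inj_on)
  have surj: "surj H"
    unfolding surj_def
  proof
    fix y
    have "H (- \<bar>y - H 0\<bar>) \<le> y" "y \<le> H \<bar>y - H 0\<bar>"
      using Hp(1)[of "- \<bar>y - H 0\<bar>" 0] Hp(1)[of 0 "\<bar>y - H 0\<bar>"] by auto
    then obtain x where "H x = y"
      using IVT'[of H "- \<bar>y - H 0\<bar>" y "\<bar>y - H 0\<bar>"] continuous_on_subset[OF cont subset_UNIV] by auto
    then show "\<exists>x. y = H x" by auto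
  qed
  define G where "G = inv H"
  have GH [simp]: "G (H x) = x" and HG [simp]: "H (G x) = x" for x
    using inj surj by (auto simp: G_def surj_f_inv_f)
  have Gmono: "strict_mono G"
    by (rule strict_monoI) (metis HG strict_mono_less[OF Hp(3)])
  have Glip: "1-lipschitz_on UNIV G"
  proof (rule lipschitz_onI)
    fix x y
    show "dist (G x) (G y) \<le> 1 * dist x y"
      using Hp(1)[of "G x" "G y"] Hp(1)[of "G y" "G x"] by (cases "G x \<le> G y") (auto simp: dist_real_def)
  qed simp
  have Gmeas: "G \<in> borel_measurable borel"
    using Glip by (intro borel_measurable_continuous_onI lipschitz_on_continuous_on)
  \<comment> \<open>points at which the lower limit of the slopes is at most \<open>r\<close>, respectively the upper limit at
    least \<open>s\<close>, up to equality; both sets are countable intersections of open sets\<close>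
  define low where "low r = (\<Inter>n::nat. \<Union>p\<in>{p. snd p - fst p < 1 / Suc n \<and> H (snd p) - H (fst p) < r * (snd p - fst p)}. {fst p<..<snd p})" for r
  define high where "high s = (\<Inter>n::nat. \<Union>p\<in>{p. snd p - fst p < 1 / Suc n \<and> s * (snd p - fst p) < H (snd p) - H (fst p)}. {fst p<..<snd p})" for s
  have lowD: "\<exists>u v. u < x \<and> x < v \<and> v - u < \<delta> \<and> H v - H u < r * (v - u)" if x: "x \<in> low r" and \<delta>: "\<delta> > 0" for x r \<delta>
  proof -
    obtain n where "1 / Suc n < \<delta>" using \<delta> nat_approx_posE by blast
    moreover obtain p where "snd p - fst p < 1 / Suc n" "H (snd p) - H (fst p) < r * (snd p - fst p)" "x \<in> {fst p<..<snd p}"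
      using x unfolding low_def by blast
    ultimately show ?thesis by (intro exI[of _ "fst p"] exI[of _ "snd p"]) auto
  qed
  have highD: "\<exists>u v. u < x \<and> x < v \<and> v - u < \<delta> \<and> s * (v - u) < H v - H u" if x: "x \<in> high s" and \<delta>: "\<delta> > 0" for x s \<delta>
  proof -
    obtain n where "1 / Suc n < \<delta>" using \<delta> nat_approx_posE by blast
    moreover obtain p where "snd p - fst p < 1 / Suc n" "s * (snd p - fst p) < H (snd p) - H (fst p)" "x \<in> {fst p<..<snd p}"
      using x unfolding high_def by blast
    ultimately show ?thesis by (intro exI[of _ "fst p"] exI[of _ "snd p"]) auto
  qed
  have lowI: "\<exists>d>0. \<forall>u v. u < x \<longrightarrow> x < v \<longrightarrow> v - u < d \<longrightarrow> r * (v - u) \<le> H v - H u" if x: "x \<notin> low r" for x r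
  proof -
    obtain n where "\<forall>p\<in>{p. snd p - fst p < 1 / Suc n \<and> H (snd p) - H (fst p) < r * (snd p - fst p)}. x \<notin> {fst p<..<snd p}"
      using x unfolding low_def by blast
    then show ?thesis by (intro exI[of _ "1 / Suc n"]) fastforce
  qed
  have highI: "\<exists>d>0. \<forall>u v. u < x \<longrightarrow> x < v \<longrightarrow> v - u < d \<longrightarrow> H v - H u \<le> s * (v - u)" if x: "x \<notin> high s" for x s
  proof -
    obtain n where "\<forall>p\<in>{p. snd p - fst p < 1 / Suc n \<and> s * (snd p - fst p) < H (snd p) - H (fst p)}. x \<notin> {fst p<..<snd p}"
      using x unfolding high_def by blast
    then show ?thesis by (intro exI[of _ "1 / Suc n"]) fastforce
  qed
  have neg: "negligible (low r \<inter> high s \<inter> {-real N<..<real N})" if rs: "0 < r" "r < s" for r s N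
  proof -
    define E where "E = low r \<inter> high s \<inter> {-real N<..<real N}"
    have [measurable]: "low r \<in> sets borel" "high s \<in> sets borel"
      unfolding low_def high_def by (intro sets.countable_INT' borel_open open_UN; auto)+
    have Eb: "E \<in> sets borel" unfolding E_def by measurable
    have "H ` E = G -` E" by (force simp: image_iff)
    then have HEb: "H ` E \<in> sets borel" using measurable_sets[OF Gmeas Eb] by simp
    have "emeasure lebesgue E \<le> emeasure lebesgue {-real N<..<real N}"
      by (intro emeasure_mono) (auto simp: E_def)
    also have "\<dots> < \<infinity>" by simp
    finally have Efin: "emeasure lebesgue E < \<infinity>" .
    have 1: "emeasure lebesgue (H ` E) \<le> ennreal r * emeasure lebesgue E"
    proof (rule emeasure_image_le_slope[OF Hp(3,4)])
      fix x \<delta> :: real assume "x \<in> E" "\<delta> > 0"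
      then obtain u v where "u < x" "x < v" "v - u < \<delta>" "H v - H u < r * (v - u)"
        using lowD[of x r \<delta>] unfolding E_def by blast
      then show "\<exists>u v. u \<le> x \<and> x \<le> v \<and> u < v \<and> v - u < \<delta> \<and> H v - H u \<le> r * (v - u)"
        by (intro exI[of _ u] exI[of _ v]) auto
    qed (use Eb HEb Efin rs in auto)
    have HEfin: "emeasure lebesgue (H ` E) < \<infinity>"
      using 1 Efin by (simp add: ennreal_mult_less_top order.strict_trans1)
    have 2: "emeasure lebesgue (G ` (H ` E)) \<le> ennreal (1/s) * emeasure lebesgue (H ` E)"
    proof (rule emeasure_image_le_slope[OF Gmono Glip])
      fix y \<delta> :: real assume "y \<in> H ` E" and \<delta>: "\<delta> > 0"
      then obtain x where x: "x \<in> E" "y = H x" by blast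
      have "\<delta> / (2 * L + 1) > 0" using L \<delta> by simp
      then obtain u v where uv: "u < x" "x < v" "v - u < \<delta> / (2 * L + 1)" "s * (v - u) < H v - H u"
        using highD[of x s "\<delta> / (2 * L + 1)"] x unfolding E_def by blast
      have "H u < H x" "H x < H v" using uv Hp(3) by (simp_all add: strict_mono_less)
      moreover have "H v - H u < \<delta>"
        using Hp(2)[of u v] uv L by (simp add: field_simps)
      moreover have "G (H v) - G (H u) \<le> 1/s * (H v - H u)"
        using uv rs by (simp add: field_simps)
      ultimately show "\<exists>u v. u \<le> y \<and> y \<le> v \<and> u < v \<and> v - u < \<delta> \<and> G v - G u \<le> 1/s * (v - u)"
        unfolding x by (intro exI[of _ "H u"] exI[of _ "H v"]) auto
    qed (use Eb HEb HEfin rs in \<open>auto simp: image_image\<close>)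
    have GHE: "G ` (H ` E) = E" by (simp add: image_image)
    obtain M where M: "emeasure lebesgue E = ennreal M" "M \<ge> 0"
      using Efin by (cases "emeasure lebesgue E") auto
    have "ennreal M \<le> ennreal (1/s) * (ennreal r * ennreal M)"
      using 2 order_trans[OF _ mult_left_mono[OF 1, of "ennreal (1/s)"]] unfolding GHE M by auto
    also have "\<dots> = ennreal (r / s * M)"
      using rs M by (simp add: ennreal_mult[symmetric])
    finally have "M \<le> r / s * M" using rs M by simp
    then have "s * M \<le> r * M" using rs by (simp add: field_simps)
    then have "(s - r) * M \<le> 0" by (simp add: algebra_simps)
    then have "M = 0" using rs M(2) by (simp add: mult_le_0_iff)
    then have "emeasure lebesgue E = 0" using M by simp
    then show ?thesis
      unfolding E_def[symmetric] using Eb by (simp add: negligible_iff_emeasure0)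
  qed
  define P where "P = {p \<in> \<rat> \<times> \<rat>. (0::real) < fst p \<and> fst p < snd p} \<times> (UNIV :: nat set)"
  have cP: "countable P" unfolding P_def
    by (intro countable_SIGMA countableI_type) (auto intro: countable_subset[OF _ countable_SIGMA[OF countable_rat countable_rat]])
  have "negligible (\<Union>p\<in>P. low (fst (fst p)) \<inter> high (snd (fst p)) \<inter> {-real (snd p)<..<real (snd p)})"
    using cP neg unfolding P_def by (intro negligible_countable_Union countable_image) auto
  moreover have "{x. \<not> (\<exists>D. (f has_real_derivative D) (at x))} \<subseteq> (\<Union>p\<in>P. low (fst (fst p)) \<inter> high (snd (fst p)) \<inter> {-real (snd p)<..<real (snd p)})"
  proof (rule subsetI, rule ccontr)
    fix x assume nd: "x \<in> {x. \<not> (\<exists>D. (f has_real_derivative D) (at x))}"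
      and nP: "x \<notin> (\<Union>p\<in>P. low (fst (fst p)) \<inter> high (snd (fst p)) \<inter> {-real (snd p)<..<real (snd p)})"
    have not_both: "x \<notin> low r \<or> x \<notin> high s" if "r \<in> \<rat>" "s \<in> \<rat>" "0 < r" "r < s" for r s
    proof -
      obtain N :: nat where "\<bar>x\<bar> < real N" using reals_Archimedean2 by blast
      then have "x \<in> {- real N<..<real N}" by auto
      moreover have "((r, s), N) \<in> P" using that unfolding P_def by auto
      ultimately show ?thesis using nP by force
    qed
    have high_mono: "x \<in> high s'" if hs: "x \<in> high s" and ss: "s' \<le> s" for s s'
    proof (rule ccontr)
      assume "x \<notin> high s'"
      then obtain d where "d > 0" and d: "\<And>u v. u < x \<Longrightarrow> x < v \<Longrightarrow> v - u < d \<Longrightarrow> H v - H u \<le> s' * (v - u)"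
        using highI by blast
      then obtain u v where uv: "u < x" "x < v" "v - u < d" "s * (v - u) < H v - H u"
        using highD[OF hs] by blast
      have "s' * (v - u) \<le> s * (v - u)" using uv ss by (intro mult_right_mono) auto
      then show False using d[OF uv(1-3)] uv(4) by linarith
    qed
    have bdd: "s \<le> 2 * L + 1" if hs: "x \<in> high s" for s
    proof -
      obtain u v where uv: "u < x" "x < v" "s * (v - u) < H v - H u" using highD[OF hs, of 1] by auto
      then have "s * (v - u) \<le> (2 * L + 1) * (v - u)" using Hp(2)[of u v] by linarith
      then show ?thesis using uv by (simp add: mult_le_cancel_right)
    qed
    have half: "x \<in> high (1/2)"
    proof (rule ccontr)
      assume "x \<notin> high (1/2)"
      then obtain d where "d > 0" and d: "\<And>u v. u < x \<Longrightarrow> x < v \<Longrightarrow> v - u < d \<Longrightarrow> H v - H u \<le> 1/2 * (v - u)"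
        using highI by blast
      then show False using d[of "x - d/3" "x + d/3"] Hp(1)[of "x - d/3" "x + d/3"] by auto
    qed
    \<comment> \<open>the upper derivative at \<open>x\<close>, which equals the lower one because no rational pair separates them\<close>
    define D where "D = Sup {s. x \<in> high s}"
    have bA: "bdd_above {s. x \<in> high s}" using bdd by (auto simp: bdd_above_def)
    have Dhalf: "1/2 \<le> D" unfolding D_def using half bA by (intro cSup_upper) auto
    have up: "x \<notin> high s" if "D < s" for s
      using that bA cSup_upper[of s "{s. x \<in> high s}"] unfolding D_def by auto
    have lo: "\<exists>r'\<ge>r. x \<notin> low r'" if r: "0 < r" "r < D" for r
    proof -
      obtain s where s: "x \<in> high s" "r < s"
        using less_cSupD[of "{s. x \<in> high s}" r] half r unfolding D_def by auto
      obtain r' where r': "r' \<in> \<rat>" "r < r'" "r' < s" using Rats_dense_in_real[OF s(2)] by blast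
      obtain s' where s': "s' \<in> \<rat>" "r' < s'" "s' < s" using Rats_dense_in_real[OF r'(3)] by blast
      show ?thesis
        using not_both[of r' s'] high_mono[OF s(1), of s'] r' s' r
        by (intro exI[of _ r']) auto
    qed
    have "(H has_real_derivative D) (at x)"
    proof (rule deriv_from_straddling_slopes[OF cont])
      fix e :: real assume e: "e > 0"
      obtain d1 where d1: "d1 > 0" "\<And>u v. u < x \<Longrightarrow> x < v \<Longrightarrow> v - u < d1 \<Longrightarrow> H v - H u \<le> (D + e) * (v - u)"
        using highI[OF up[of "D + e"]] e by auto
      \<comment> \<open>slopes are at least 1, so that the maximum with \<open>1/4\<close> only ensures positivity\<close>
      have "0 < max (D - e) (1/4)" "max (D - e) (1/4) < D" using Dhalf e by auto
      from lo[OF this] obtain r where r: "max (D - e) (1/4) \<le> r" "x \<notin> low r"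
        by blast
      obtain d2 where d2: "d2 > 0" "\<And>u v. u < x \<Longrightarrow> x < v \<Longrightarrow> v - u < d2 \<Longrightarrow> r * (v - u) \<le> H v - H u"
        using lowI[OF r(2)] by auto
      show "\<exists>d>0. \<forall>u v. u < x \<longrightarrow> x < v \<longrightarrow> v - u < d \<longrightarrow> \<bar>H v - H u - D * (v - u)\<bar> \<le> e * (v - u)"
      proof (intro exI[of _ "min d1 d2"] conjI allI impI)
        fix u v assume uv: "u < x" "x < v" "v - u < min d1 d2"
        have "(D - e) * (v - u) \<le> r * (v - u)" using r uv by (intro mult_right_mono) auto
        then show "\<bar>H v - H u - D * (v - u)\<bar> \<le> e * (v - u)"
          using d1(2)[of u v] d2(2)[of u v] uv by (auto simp: algebra_simps abs_le_iff)
      qed (use d1 d2 in auto)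
    qed
    then have "((\<lambda>x. H x - (L + 1) * x) has_real_derivative D - (L + 1)) (at x)"
      by (auto intro!: derivative_eq_intros)
    then show False using nd unfolding H_def by auto
  qed
  ultimately show ?thesis by (rule negligible_subset)
qed

text \<open>
  Almost every point of the interval has short neighbouring intervals on which \<open>f x + (L + 1) x\<close> has
  slope at most \<open>L + 1 + e\<close>. By \<open>emeasure_image_le_slope\<close> this increasing function stretches the interval
  by a factor of at most \<open>L + 1 + e\<close>, which leaves nothing for \<open>f\<close> to gain as \<open>e\<close> tends to zero.
\<close>

lemma lipschitz_nonincreasing_if_AE_deriv_nonpos:
  fixes f :: "real \<Rightarrow> real"
  assumes f: "L-lipschitz_on UNIV f" and N: "negligible N"
    and der: "\<And>x. a < x \<Longrightarrow> x < b \<Longrightarrow> x \<notin> N \<Longrightarrow> \<exists>D\<le>0. (f has_real_derivative D) (at x)"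
    and ab: "a < b"
  shows "f b \<le> f a"
proof -
  define H where "H x = f x + (L + 1) * x" for x
  note Hp = lipschitz_plus_linear[OF f, folded H_def]
  have L: "0 \<le> L" using f by (rule lipschitz_on_nonneg)
  have cont: "continuous_on UNIV H" using Hp(4) by (rule lipschitz_on_continuous_on)
  have inj: "inj H" using Hp(3) by (rule strict_mono_imp_inj_on)
  have Him: "H ` {a<..<b} = {H a<..<H b}"
  proof
    show "H ` {a<..<b} \<subseteq> {H a<..<H b}" by (auto simp: strict_mono_less[OF Hp(3)])
    show "{H a<..<H b} \<subseteq> H ` {a<..<b}"
    proof
      fix y assume y: "y \<in> {H a<..<H b}"
      then obtain x where "a \<le> x" "x \<le> b" "H x = y"
        using IVT'[of H a y b] ab continuous_on_subset[OF cont, of "{a..b}"] by auto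
      moreover from this y have "x \<noteq> a" "x \<noteq> b" by auto
      ultimately show "y \<in> H ` {a<..<b}" by force
    qed
  qed
  have negHN: "negligible (H ` N)"
  proof (rule negligible_locally_Lipschitz_image[OF _ N])
    show "\<exists>T B. open T \<and> x \<in> T \<and> (\<forall>y\<in>N \<inter> T. norm (H y - H x) \<le> B * norm (y - x))" for x
      using Hp(4) by (intro exI[of _ UNIV] exI[of _ "2 * L + 1"]) (auto simp: lipschitz_on_def dist_norm)
  qed simp
  define E where "E = {a<..<b} - N"
  have Em: "E \<in> sets lebesgue" using N by (auto simp: E_def negligible_imp_sets)
  have HE: "H ` E = {H a<..<H b} - H ` N" unfolding E_def image_set_diff[OF inj] Him ..
  have HEm: "H ` E \<in> sets lebesgue" unfolding HE using negHN by (auto simp: negligible_imp_sets)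
  have Ele: "emeasure lebesgue E \<le> emeasure lebesgue {a<..<b}"
    by (intro emeasure_mono) (auto simp: E_def)
  have key: "f b - f a \<le> e * (b - a)" if e: "e > 0" for e
  proof -
    have "emeasure lebesgue {H a<..<H b} = emeasure lebesgue (H ` E)"
      unfolding HE using negHN
      by (metis emeasure_Diff_null_set greaterThanLessThan_borel negligible_iff_null_sets sets_completionI_sets sets_lborel)
    also have "\<dots> \<le> ennreal (L + 1 + e) * emeasure lebesgue E"
    proof (rule emeasure_image_le_slope[OF Hp(3,4) Em HEm])
      show "emeasure lebesgue E < \<infinity>" using Ele ab by (auto simp: order.strict_trans1)
      show "0 \<le> L + 1 + e" using L e by simp
      fix x \<delta> :: real assume x: "x \<in> E" and \<delta>: "\<delta> > 0"
      then obtain D where D: "D \<le> 0" "(f has_real_derivative D) (at x)" using der[of x] by (auto simp: E_def)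
      have "((\<lambda>h. (f (x + h) - f x) / h) \<longlongrightarrow> D) (at 0)" using D(2) by (simp add: DERIV_def)
      from LIM_D[OF this e] obtain d where "d > 0" and d': "\<forall>h. h \<noteq> 0 \<and> norm (h - 0) < d \<longrightarrow> norm ((f (x + h) - f x) / h - D) < e"
        by blast
      then have d: "d > 0" "\<And>h. h \<noteq> 0 \<Longrightarrow> \<bar>h\<bar> < d \<Longrightarrow> \<bar>(f (x + h) - f x) / h - D\<bar> < e"
        by simp_all
      define h where "h = min d \<delta> / 2"
      have h: "0 < h" "h < d" "h < \<delta>" using d \<delta> by (auto simp: h_def)
      have "(f (x + h) - f x) / h < e" using d(2)[of h] h D by auto
      then have "f (x + h) - f x \<le> e * h" using h by (simp add: field_simps)
      then have "H (x + h) - H x \<le> (L + 1 + e) * (x + h - x)"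
        unfolding H_def by (simp add: algebra_simps)
      then show "\<exists>u v. u \<le> x \<and> x \<le> v \<and> u < v \<and> v - u < \<delta> \<and> H v - H u \<le> (L + 1 + e) * (v - u)"
        using h by (intro exI[of _ x] exI[of _ "x + h"]) auto
    qed
    also have "\<dots> \<le> ennreal (L + 1 + e) * emeasure lebesgue {a<..<b}"
      using Ele by (rule mult_left_mono) simp
    also have "\<dots> = ennreal ((L + 1 + e) * (b - a))"
      using ab L e by (simp add: ennreal_mult)
    finally have "ennreal (H b - H a) \<le> ennreal ((L + 1 + e) * (b - a))"
      using ab by (simp add: strict_mono_less_eq[OF Hp(3)])
    then have "H b - H a \<le> (L + 1 + e) * (b - a)"
      using ab L e by (subst (asm) ennreal_le_iff) auto
    then show ?thesis unfolding H_def by (simp add: algebra_simps)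
  qed
  have "f b - f a \<le> 0 + e" if "e > 0" for e
    using key[of "e / (b - a)"] that ab by simp
  then have "f b - f a \<le> 0" by (rule field_le_epsilon)
  then show ?thesis by simp
qed

section \<open>Rademacher's theorem\<close>

text \<open>
  Fubini's theorem in the direction \<open>v\<close>. Translation invariance replaces a change of coordinates:
  the integral over \<open>x\<close> of the indicator of \<open>N\<close> at \<open>x + s v\<close> is the measure of \<open>N\<close> for every \<open>s\<close>.
\<close>

lemma AE_lines_iff_AE:
  fixes v :: "'a::euclidean_space"
  assumes N [measurable]: "N \<in> sets borel"
  shows "(AE x in lborel. AE s in lborel. x + s *\<^sub>R v \<notin> N) \<longleftrightarrow> (AE x in lborel. x \<notin> N)"
proof -
  have slice: "(\<integral>\<^sup>+x. indicator N (x + s *\<^sub>R v) \<partial>lborel) = emeasure lborel N" for s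
  proof -
    have "emeasure lborel N = (\<integral>\<^sup>+x. indicator N x \<partial>distr lborel borel ((+) (s *\<^sub>R v)))"
      by (simp add: lborel_distr_plus)
    also have "\<dots> = (\<integral>\<^sup>+x. indicator N (s *\<^sub>R v + x) \<partial>lborel)"
      by (rule nn_integral_distr) auto
    finally show ?thesis by (simp add: add.commute)
  qed
  have meas: "case_prod (\<lambda>s x. indicator N (x + s *\<^sub>R v) :: ennreal) \<in> borel_measurable (lborel \<Otimes>\<^sub>M lborel)"
    by measurable
  have meas2 [measurable]: "(\<lambda>x. emeasure lborel {s. x + s *\<^sub>R v \<in> N}) \<in> borel_measurable lborel"
    by measurable
  have ind: "(\<integral>\<^sup>+s. indicator N (x + s *\<^sub>R v) \<partial>lborel) = emeasure lborel {s. x + s *\<^sub>R v \<in> N}" for x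
  proof -
    have "(\<integral>\<^sup>+s. indicator N (x + s *\<^sub>R v) \<partial>lborel) = (\<integral>\<^sup>+s. indicator {s. x + s *\<^sub>R v \<in> N} s \<partial>lborel)"
      by (auto intro!: nn_integral_cong simp: indicator_def)
    then show ?thesis by simp
  qed
  have "(\<integral>\<^sup>+x. emeasure lborel {s. x + s *\<^sub>R v \<in> N} \<partial>lborel) = (\<integral>\<^sup>+s. emeasure lborel N \<partial>(lborel :: real measure))"
    using lborel_pair.Fubini'[OF meas] by (simp add: slice ind)
  also have "\<dots> = emeasure lborel N * \<infinity>" by simp
  finally have eq: "(\<integral>\<^sup>+x. emeasure lborel {s. x + s *\<^sub>R v \<in> N} \<partial>lborel) = emeasure lborel N * \<infinity>" .
  have "(AE x in lborel. x \<notin> N) \<longleftrightarrow> emeasure lborel N = 0"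
    using N by (subst AE_iff_measurable[of N]) auto
  also have "\<dots> \<longleftrightarrow> (\<integral>\<^sup>+x. emeasure lborel {s. x + s *\<^sub>R v \<in> N} \<partial>lborel) = 0"
    unfolding eq by simp
  also have "\<dots> \<longleftrightarrow> (AE x in lborel. emeasure lborel {s. x + s *\<^sub>R v \<in> N} = 0)"
    by (rule nn_integral_0_iff_AE) simp
  also have "\<dots> \<longleftrightarrow> (AE x in lborel. AE s in lborel. x + s *\<^sub>R v \<notin> N)"
    by (intro AE_cong, subst AE_iff_measurable) auto
  finally show ?thesis by simp
qed

definition has_dir_deriv :: "('a::real_vector \<Rightarrow> real) \<Rightarrow> 'a \<Rightarrow> 'a \<Rightarrow> real \<Rightarrow> bool" where
  "has_dir_deriv f v x D \<longleftrightarrow> ((\<lambda>s. f (x + s *\<^sub>R v)) has_real_derivative D) (at 0)"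

lemma has_dir_deriv_iff: "has_dir_deriv f v x D \<longleftrightarrow> ((\<lambda>s. (f (x + s *\<^sub>R v) - f x) / s) \<longlongrightarrow> D) (at 0)"
  by (simp add: has_dir_deriv_def DERIV_def)

lemma has_dir_deriv_scaleR: "has_dir_deriv f v x D \<Longrightarrow> has_dir_deriv f (c *\<^sub>R v) x (c * D)"
proof -
  assume "has_dir_deriv f v x D"
  then have "((\<lambda>s. f (x + s *\<^sub>R v)) has_real_derivative D) (at (c * 0))"
    by (simp add: has_dir_deriv_def)
  moreover have "((\<lambda>s. c * s) has_real_derivative c) (at 0)"
    by (auto intro!: derivative_eq_intros)
  ultimately have "(((\<lambda>s. f (x + s *\<^sub>R v)) \<circ> (\<lambda>s. c * s)) has_real_derivative D * c) (at 0)"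
    by (rule DERIV_chain)
  then show ?thesis by (simp add: has_dir_deriv_def o_def mult.commute)
qed

text \<open>
  Existence of the derivative is a Cauchy condition on difference quotients. For continuous \<open>f\<close> each
  instance of it is closed, and arbitrary intersections of closed sets are closed, so only the
  quantifiers over the tolerance and the radius need to be countable.
\<close>

lemma has_dir_deriv_exists_borel:
  fixes f :: "'a::euclidean_space \<Rightarrow> real"
  assumes cont: "continuous_on UNIV f"
  shows "{x. \<exists>D. has_dir_deriv f v x D} \<in> sets borel"
proof -
  define q where "q s x = (f (x + s *\<^sub>R v) - f x) / s" for s x
  have cq: "continuous_on UNIV (q s)" for s
    unfolding q_def by (cases "s = 0") (auto intro!: continuous_intros continuous_on_compose2[OF cont])
  let ?S = "\<lambda>m::nat. {s::real. s \<noteq> 0 \<and> \<bar>s\<bar> < 1 / Suc m}"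
  have "{x. \<exists>D. has_dir_deriv f v x D} =
    (\<Inter>n::nat. \<Union>m::nat. \<Inter>s\<in>?S m. \<Inter>t\<in>?S m. {x. \<bar>q s x - q t x\<bar> \<le> 1 / Suc n})"
    (is "_ = ?R")
  proof (intro equalityI subsetI)
    fix x assume "x \<in> {x. \<exists>D. has_dir_deriv f v x D}"
    then obtain D where D: "((\<lambda>s. q s x) \<longlongrightarrow> D) (at 0)" by (auto simp: has_dir_deriv_iff q_def)
    show "x \<in> ?R"
    proof
      fix n :: nat
      define e where "e = 1 / real (Suc n)"
      have "0 < e / 2" by (simp add: e_def)
      from LIM_D[OF D this] obtain d where d: "d > 0" and dd: "\<And>s. s \<noteq> 0 \<and> norm (s - 0) < d \<Longrightarrow> norm (q s x - D) < e / 2"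
        by blast
      obtain m :: nat where m: "1 / Suc m < d" using d nat_approx_posE by blast
      have "\<bar>q s x - q t x\<bar> \<le> 1 / Suc n" if "s \<noteq> 0" "t \<noteq> 0" "\<bar>s\<bar> < 1 / Suc m" "\<bar>t\<bar> < 1 / Suc m" for s t
      proof -
        have "\<bar>q s x - D\<bar> < e / 2" "\<bar>q t x - D\<bar> < e / 2"
          using dd[of s] dd[of t] that m by auto
        then show ?thesis unfolding e_def[symmetric] by linarith
      qed
      then show "x \<in> (\<Union>m::nat. \<Inter>s\<in>?S m. \<Inter>t\<in>?S m. {x. \<bar>q s x - q t x\<bar> \<le> 1 / Suc n})"
        by (intro UN_I[of m]) auto
    qed
  next
    fix x assume x: "x \<in> ?R"
    have ex: "\<exists>d>0. \<forall>s t. s \<noteq> 0 \<longrightarrow> t \<noteq> 0 \<longrightarrow> \<bar>s\<bar> < d \<longrightarrow> \<bar>t\<bar> < d \<longrightarrow> \<bar>q s x - q t x\<bar> < e" if e: "e > 0" for e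
    proof -
      obtain n :: nat where n: "1 / Suc n < e" using e nat_approx_posE by blast
      from INT_D[OF x UNIV_I, of n] obtain m :: nat where m: "\<And>s t. s \<noteq> 0 \<Longrightarrow> t \<noteq> 0 \<Longrightarrow> \<bar>s\<bar> < 1 / Suc m \<Longrightarrow> \<bar>t\<bar> < 1 / Suc m \<Longrightarrow> \<bar>q s x - q t x\<bar> \<le> 1 / Suc n"
        by blast
      show ?thesis
      proof (intro exI[of _ "1 / Suc m"] conjI allI impI)
        fix s t assume "s \<noteq> 0" "t \<noteq> 0" "\<bar>s\<bar> < 1 / Suc m" "\<bar>t\<bar> < 1 / Suc m"
        then show "\<bar>q s x - q t x\<bar> < e" using m[of s t] n by linarith
      qed simp
    qed
    let ?t = "\<lambda>k. 1 / real (Suc k)"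
    have t0: "?t \<longlonglongrightarrow> 0" using LIMSEQ_inverse_real_of_nat by (simp add: inverse_eq_divide)
    have "Cauchy (\<lambda>k. q (?t k) x)"
    proof (rule metric_CauchyI)
      fix e :: real assume "e > 0"
      then obtain d where d: "d > 0" "\<And>s t. s \<noteq> 0 \<Longrightarrow> t \<noteq> 0 \<Longrightarrow> \<bar>s\<bar> < d \<Longrightarrow> \<bar>t\<bar> < d \<Longrightarrow> \<bar>q s x - q t x\<bar> < e"
        using ex by blast
      obtain M where M: "\<And>k. k \<ge> M \<Longrightarrow> \<bar>?t k\<bar> < d"
        using t0 d(1) unfolding lim_sequentially dist_real_def by (metis diff_zero)
      show "\<exists>M. \<forall>m\<ge>M. \<forall>n\<ge>M. dist (q (?t m) x) (q (?t n) x) < e"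
        unfolding dist_real_def by (intro exI[of _ M] allI impI d(2) M) auto
    qed
    then obtain D where D: "(\<lambda>k. q (?t k) x) \<longlonglongrightarrow> D" by (auto simp: Cauchy_convergent_iff convergent_def)
    have "((\<lambda>s. q s x) \<longlongrightarrow> D) (at 0)"
    proof (rule LIM_I)
      fix r :: real assume r: "0 < r"
      then obtain d where d: "d > 0" "\<And>s t. s \<noteq> 0 \<Longrightarrow> t \<noteq> 0 \<Longrightarrow> \<bar>s\<bar> < d \<Longrightarrow> \<bar>t\<bar> < d \<Longrightarrow> \<bar>q s x - q t x\<bar> < r/2"
        using ex[of "r/2"] by auto
      show "\<exists>s>0. \<forall>t. t \<noteq> 0 \<and> norm (t - 0) < s \<longrightarrow> norm (q t x - D) < r"
      proof (intro exI[of _ d] conjI allI impI d(1), elim conjE)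
        fix t :: real assume t: "t \<noteq> 0" "norm (t - 0) < d"
        have "\<forall>\<^sub>F k in sequentially. \<bar>q t x - q (?t k) x\<bar> \<le> r/2"
          using order_tendstoD(2)[OF t0 d(1)]
        proof eventually_elim
          case (elim k)
          then show ?case using d(2)[of t "?t k"] t by auto
        qed
        moreover have "(\<lambda>k. \<bar>q t x - q (?t k) x\<bar>) \<longlonglongrightarrow> \<bar>q t x - D\<bar>"
          by (intro tendsto_intros D)
        ultimately have "\<bar>q t x - D\<bar> \<le> r/2"
          by (intro tendsto_upperbound) auto
        then show "norm (q t x - D) < r" using r by simp
      qed
    qed
    then show "x \<in> {x. \<exists>D. has_dir_deriv f v x D}" by (auto simp: has_dir_deriv_iff q_def)
  qed
  also have "\<dots> \<in> sets borel"
  proof -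
    have "closed (\<Inter>s\<in>?S m. \<Inter>t\<in>?S m. {x. \<bar>q s x - q t x\<bar> \<le> 1 / Suc n})" for n m
      by (intro closed_INT ballI closed_Collect_le continuous_intros cq)
    then show ?thesis
      by (intro sets.countable_INT sets.countable_UN image_subsetI borel_closed) auto
  qed
  finally show ?thesis .
qed

text \<open>
  On each line in the direction \<open>v\<close> this is differentiability of a Lipschitz function of a real
  variable.
\<close>

lemma lipschitz_AE_dir_deriv:
  fixes f :: "'a::euclidean_space \<Rightarrow> real"
  assumes f: "L-lipschitz_on UNIV f"
  shows "AE x in lborel. \<exists>D. has_dir_deriv f v x D"
proof -
  let ?N = "- {x. \<exists>D. has_dir_deriv f v x D}"
  have N: "?N \<in> sets borel"
    using has_dir_deriv_exists_borel[of f v] f by (auto simp: lipschitz_on_continuous_on)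
  have "AE s in lborel. x + s *\<^sub>R v \<notin> ?N" for x
  proof -
    let ?g = "\<lambda>s. f (x + s *\<^sub>R v)"
    have "(L * norm v)-lipschitz_on UNIV ?g"
    proof (rule lipschitz_onI)
      fix s t :: real
      show "dist (?g s) (?g t) \<le> L * norm v * dist s t"
        using lipschitz_onD[OF f, of "x + s *\<^sub>R v" "x + t *\<^sub>R v"]
        by (simp add: dist_norm scaleR_diff_left[symmetric] mult_ac)
    qed (use lipschitz_on_nonneg[OF f] in simp)
    then have "negligible {s. \<not> (\<exists>D. (?g has_real_derivative D) (at s))}"
      by (rule lipschitz_real_differentiable_AE)
    moreover have "{s. x + s *\<^sub>R v \<in> ?N} \<subseteq> {s. \<not> (\<exists>D. (?g has_real_derivative D) (at s))}"
    proof (rule subsetI, rule CollectI, rule notI)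
      fix s assume "s \<in> {s. x + s *\<^sub>R v \<in> ?N}" and "\<exists>D. (?g has_real_derivative D) (at s)"
      then obtain D where nd: "x + s *\<^sub>R v \<in> ?N" and D: "(?g has_real_derivative D) (at s)" by blast
      have "((\<lambda>h. ?g (s + h)) has_real_derivative D) (at 0)"
        using D DERIV_shift[of ?g D 0 s] by (simp add: add.commute)
      then have "has_dir_deriv f v (x + s *\<^sub>R v) D"
        by (simp add: has_dir_deriv_def scaleR_add_left add.assoc)
      then show False using nd by auto
    qed
    ultimately have "negligible {s. x + s *\<^sub>R v \<in> ?N}" by (rule negligible_subset)
    moreover have "{s. x + s *\<^sub>R v \<in> ?N} \<in> sets borel" using N by measurable
    ultimately have "emeasure lborel {s. x + s *\<^sub>R v \<in> ?N} = 0"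
      by (simp add: negligible_iff_emeasure0)
    then show ?thesis
      using \<open>{s. x + s *\<^sub>R v \<in> ?N} \<in> sets borel\<close> by (subst AE_iff_measurable[OF _ refl]) auto
  qed
  then have "AE x in lborel. x \<notin> ?N"
    using AE_lines_iff_AE[OF N, of v] by blast
  then show ?thesis by simp
qed


text \<open>
  The limit along one fixed sequence agrees with the derivative wherever the latter exists, and for
  continuous \<open>f\<close> it is a measurable function of \<open>x\<close>.
\<close>

definition dir_deriv :: "('a::real_vector \<Rightarrow> real) \<Rightarrow> 'a \<Rightarrow> 'a \<Rightarrow> real" where
  "dir_deriv f v x = lim (\<lambda>k. (f (x + (1 / real (Suc k)) *\<^sub>R v) - f x) / (1 / real (Suc k)))"

lemma filterlim_inverse_Suc_at_0: "filterlim (\<lambda>k. 1 / real (Suc k)) (at 0) sequentially"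
proof -
  have "(\<lambda>k. 1 / real (Suc k)) \<longlonglongrightarrow> 0" using LIMSEQ_inverse_real_of_nat by (simp add: inverse_eq_divide)
  then show ?thesis by (simp add: filterlim_at)
qed

lemma has_dir_deriv_LIMSEQ:
  assumes "has_dir_deriv f v x D"
  shows "(\<lambda>k. (f (x + (1 / real (Suc k)) *\<^sub>R v) - f x) / (1 / real (Suc k))) \<longlonglongrightarrow> D"
  using filterlim_compose[OF assms[unfolded has_dir_deriv_iff] filterlim_inverse_Suc_at_0] .

lemma dir_deriv_eqI: "has_dir_deriv f v x D \<Longrightarrow> dir_deriv f v x = D"
  unfolding dir_deriv_def by (rule limI, rule has_dir_deriv_LIMSEQ)

text \<open>
  Shifted by the bound \<open>C\<close>, both functions are densities of measures that agree on boxes, an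
  intersection-stable generator of the Borel sets.
\<close>

lemma AE_eq_if_integrals_over_boxes_eq:
  fixes f g :: "'a::euclidean_space \<Rightarrow> real"
  assumes [measurable]: "f \<in> borel_measurable lborel" "g \<in> borel_measurable lborel"
    and bd: "\<And>x. \<bar>f x\<bar> \<le> C" "\<And>x. \<bar>g x\<bar> \<le> C"
    and eq: "\<And>a b. (\<integral>x. indicator (box a b) x * f x \<partial>lborel) = (\<integral>x. indicator (box a b) x * g x \<partial>lborel)"
  shows "AE x in lborel. f x = g x"
proof -
  let ?f = "\<lambda>x. ennreal (f x + C)" and ?g = "\<lambda>x. ennreal (g x + C)"
  have em: "emeasure (density lborel (\<lambda>x. ennreal (u x + C))) (box a b)
      = ennreal ((\<integral>x. indicator (box a b) x * u x \<partial>lborel) + (\<integral>x. indicator (box a b) x * C \<partial>lborel))"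
    if [measurable]: "u \<in> borel_measurable lborel" and u: "\<And>x. \<bar>u x\<bar> \<le> C" for u and a b :: 'a
  proof -
    have fin: "emeasure lborel (box a b) < \<infinity>" by (simp add: emeasure_lborel_box_eq)
    have i1: "integrable lborel (\<lambda>x. indicator (box a b) x * u x)"
    proof (rule Bochner_Integration.integrable_bound)
      show "integrable lborel (\<lambda>x. indicator (box a b) x * C)" using fin by simp
      show "AE x in lborel. norm (indicator (box a b) x * u x) \<le> norm (indicator (box a b) x * C)"
        using u abs_ge_self order_trans by (intro AE_I2) (fastforce simp: indicator_def)
    qed simp
    have i2: "integrable lborel (\<lambda>x. indicator (box a b) x * C)" using fin by simp
    have nn: "0 \<le> u x + C" for x using u[of x] by (simp add: abs_le_iff)
    have "emeasure (density lborel (\<lambda>x. ennreal (u x + C))) (box a b) = (\<integral>\<^sup>+x. ennreal (u x + C) * indicator (box a b) x \<partial>lborel)"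
      by (rule emeasure_density) auto
    also have "\<dots> = (\<integral>\<^sup>+x. ennreal (indicator (box a b) x * u x + indicator (box a b) x * C) \<partial>lborel)"
      by (intro nn_integral_cong) (auto simp: indicator_def)
    also have "\<dots> = ennreal (\<integral>x. indicator (box a b) x * u x + indicator (box a b) x * C \<partial>lborel)"
      using i1 i2 nn by (intro nn_integral_eq_integral) (auto simp: indicator_def)
    finally show ?thesis using i1 i2 by simp
  qed
  have "density lborel ?f = density lborel ?g"
  proof (rule measure_eqI_generator_eq[where E = "range (\<lambda>(a, b). box a b :: 'a set)" and \<Omega> = UNIV
        and A = "\<lambda>n. box (- real n *\<^sub>R One) (real n *\<^sub>R One)"])
    show "Int_stable (range (\<lambda>(a, b). box a b :: 'a set))"
      by (auto simp: Int_stable_def box_Int_box)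
    show "emeasure (density lborel ?f) X = emeasure (density lborel ?g) X"
      if "X \<in> range (\<lambda>(a, b). box a b :: 'a set)" for X
      using that bd eq by (auto simp: em)
    show "emeasure (density lborel ?f) (box (- real n *\<^sub>R One) (real n *\<^sub>R One)) \<noteq> \<infinity>" for n
      using bd by (simp add: em)
    show "(\<Union>n. box (- real n *\<^sub>R One) (real n *\<^sub>R One)) = (UNIV :: 'a set)"
      using UN_box_eq_UNIV by simp
  qed (auto simp: borel_eq_box)
  then have "AE x in lborel. ?f x = ?g x"
    by (subst (asm) sigma_finite_measure.density_unique_iff[OF sigma_finite_lborel]) auto
  then show ?thesis
  proof eventually_elim
    case (elim x)
    then show ?case using bd[of x] by (simp add: abs_le_iff)
  qed
qed

lemma lipschitz_quotient_bound:
  fixes f :: "'a::real_normed_vector \<Rightarrow> real"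
  assumes f: "L-lipschitz_on UNIV f"
  shows "\<bar>(f (x + s *\<^sub>R v) - f x) / s\<bar> \<le> L * norm v"
proof (cases "s = 0")
  case False
  have "\<bar>f (x + s *\<^sub>R v) - f x\<bar> \<le> L * norm v * \<bar>s\<bar>"
    using lipschitz_onD[OF f, of "x + s *\<^sub>R v" x] by (simp add: dist_norm dist_real_def mult_ac)
  then show ?thesis using False by (simp add: field_simps)
qed (use lipschitz_on_nonneg[OF f] in simp)

text \<open>
  The quotient for \<open>v + w\<close> at \<open>x\<close> minus that for \<open>v\<close> at \<open>x\<close> is the quotient for \<open>w\<close> at the displaced
  point \<open>x + t v\<close>. Integrated over a box, the displacement can be moved from the quotient to the
  indicator of the box, whose translates converge almost everywhere. So the two sides of the
  claimed identity have the same integral over every box.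
\<close>

lemma lipschitz_AE_dir_deriv_add:
  fixes f :: "'a::euclidean_space \<Rightarrow> real"
  assumes f: "L-lipschitz_on UNIV f"
  shows "AE x in lborel. has_dir_deriv f (v + w) x (dir_deriv f v x + dir_deriv f w x)"
proof -
  have L: "0 \<le> L" using f by (rule lipschitz_on_nonneg)
  have cont: "continuous_on UNIV f" using f by (rule lipschitz_on_continuous_on)
  have [measurable]: "f \<in> borel_measurable borel" using cont by (rule borel_measurable_continuous_onI)
  have [measurable]: "dir_deriv f u \<in> borel_measurable borel" for u
    unfolding dir_deriv_def by measurable
  define t where "t k = 1 / real (Suc k)" for k
  have t: "0 < t k" "t k \<le> 1" for k by (auto simp: t_def)
  have "t = (\<lambda>k. 1 / real (Suc k))" by (simp add: t_def fun_eq_iff)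
  then have t0: "t \<longlonglongrightarrow> 0" using filterlim_inverse_Suc_at_0 by (simp only: filterlim_at)
  have ex: "AE x in lborel. has_dir_deriv f u x (dir_deriv f u x)" for u
    using lipschitz_AE_dir_deriv[OF f, of u] by eventually_elim (auto simp: dir_deriv_eqI)
  define q where "q k x = (f (x + t k *\<^sub>R w) - f x) / t k" for k x
  have [measurable]: "q k \<in> borel_measurable borel" for k unfolding q_def by measurable
  have qb: "\<bar>q k x\<bar> \<le> L * norm w" for k x unfolding q_def by (rule lipschitz_quotient_bound[OF f])
  define C where "C = L * norm w"
  have C: "0 \<le> C" using L by (simp add: C_def)
  \<comment> \<open>truncation only serves to have bounds everywhere instead of almost everywhere\<close>
  define cl where "cl y = max (-C) (min C y)" for y :: real
  have cl: "\<bar>cl y\<bar> \<le> C" "\<bar>y\<bar> \<le> C \<Longrightarrow> cl y = y" for y using C by (auto simp: cl_def)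
  have [measurable]: "cl \<in> borel_measurable borel" unfolding cl_def by measurable
  let ?R = "\<lambda>x. cl (dir_deriv f (v + w) x - dir_deriv f v x)" and ?W = "\<lambda>x. cl (dir_deriv f w x)"
  have bb: "\<bar>y\<bar> \<le> C" if "(\<lambda>k. y' k) \<longlonglongrightarrow> y" "\<And>k. \<bar>y' k\<bar> \<le> C" for y and y' :: "nat \<Rightarrow> real"
    using that by (intro tendsto_upperbound[OF tendsto_rabs[OF that(1)]]) auto
  have limR: "AE x in lborel. (\<lambda>k. q k (x + t k *\<^sub>R v)) \<longlonglongrightarrow> ?R x \<and> \<bar>dir_deriv f (v + w) x - dir_deriv f v x\<bar> \<le> C"
    using ex[of "v + w"] ex[of v]
  proof eventually_elim
    case (elim x)
    have "(\<lambda>k. (f (x + t k *\<^sub>R (v + w)) - f x) / t k - (f (x + t k *\<^sub>R v) - f x) / t k)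
        \<longlonglongrightarrow> dir_deriv f (v + w) x - dir_deriv f v x"
      using has_dir_deriv_LIMSEQ[OF elim(1)] has_dir_deriv_LIMSEQ[OF elim(2)] unfolding t_def by (rule tendsto_diff)
    moreover have "(f (x + t k *\<^sub>R (v + w)) - f x) / t k - (f (x + t k *\<^sub>R v) - f x) / t k = q k (x + t k *\<^sub>R v)" for k
      by (simp add: q_def diff_divide_distrib[symmetric] scaleR_add_right add.assoc)
    ultimately have lim: "(\<lambda>k. q k (x + t k *\<^sub>R v)) \<longlonglongrightarrow> dir_deriv f (v + w) x - dir_deriv f v x"
      by simp
    have "\<bar>dir_deriv f (v + w) x - dir_deriv f v x\<bar> \<le> C" using qb by (intro bb[OF lim]) (simp add: C_def)
    then show ?case using lim cl(2) by simp
  qed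
  have limW: "AE x in lborel. (\<lambda>k. q k x) \<longlonglongrightarrow> ?W x \<and> \<bar>dir_deriv f w x\<bar> \<le> C"
    using ex[of w]
  proof eventually_elim
    case (elim x)
    have lim: "(\<lambda>k. q k x) \<longlonglongrightarrow> dir_deriv f w x"
      using has_dir_deriv_LIMSEQ[OF elim] unfolding q_def t_def .
    have "\<bar>dir_deriv f w x\<bar> \<le> C" using qb by (intro bb[OF lim]) (simp add: C_def)
    then show ?case using lim cl(2) by simp
  qed
  have "AE x in lborel. ?R x = ?W x"
  proof (rule AE_eq_if_integrals_over_boxes_eq[where C = C])
    fix a b :: 'a
    let ?A = "box a b"
    obtain \<rho> where \<rho>: "?A \<subseteq> cball 0 \<rho>"
      using bounded_box[of a b] unfolding bounded_iff by (auto simp: subset_iff)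
    \<comment> \<open>all translates of the box by \<open>t k v\<close> lie in one ball, so one integrable function dominates\<close>
    let ?w = "\<lambda>x::'a. indicator (cball 0 (\<rho> + norm v)) x * C"
    have wint: "integrable lborel ?w"
      by (intro integrable_mult_left integrable_real_indicator emeasure_bounded_finite) auto
    have inb: "x \<in> cball 0 (\<rho> + norm v)" if "x - s *\<^sub>R v \<in> ?A" "0 \<le> s" "s \<le> 1" for x s
    proof -
      have "norm x \<le> norm (x - s *\<^sub>R v) + norm (s *\<^sub>R v)" using norm_triangle_sub by (metis add.commute diff_add_cancel norm_triangle_ineq)
      also have "norm (x - s *\<^sub>R v) \<le> \<rho>" using that \<rho> by auto
      also have "norm (s *\<^sub>R v) \<le> norm v" using that by (simp add: mult_left_le_one_le)
      finally show ?thesis by simp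
    qed
    have I1: "(\<lambda>k. \<integral>x. indicator ?A x * q k (x + t k *\<^sub>R v) \<partial>lborel) \<longlonglongrightarrow> (\<integral>x. indicator ?A x * ?R x \<partial>lborel)"
    proof (rule integral_dominated_convergence[where w = ?w])
      show "AE x in lborel. (\<lambda>k. indicator ?A x * q k (x + t k *\<^sub>R v)) \<longlonglongrightarrow> indicator ?A x * ?R x"
        using limR by eventually_elim (auto intro!: tendsto_intros)
      show "AE x in lborel. norm (indicator ?A x * q k (x + t k *\<^sub>R v)) \<le> ?w x" for k
        using qb inb[of _ 0] C by (intro AE_I2) (auto simp: indicator_def C_def)
    qed (use wint in \<open>auto intro!: borel_measurable_times\<close>)
    have "AE x in lborel. x \<notin> frontier ?A"
      using negligible_convex_frontier[of ?A] by (intro AE_not_in) (auto simp: negligible_iff_null_sets null_sets_completion_iff)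
    with limW have I2: "(\<lambda>k. \<integral>x. indicator ?A (x - t k *\<^sub>R v) * q k x \<partial>lborel) \<longlonglongrightarrow> (\<integral>x. indicator ?A x * ?W x \<partial>lborel)"
    proof (intro integral_dominated_convergence[where w = ?w])
      show "AE x in lborel. (\<lambda>k. indicator ?A (x - t k *\<^sub>R v) * q k x) \<longlonglongrightarrow> indicator ?A x * ?W x"
        using limW \<open>AE x in lborel. x \<notin> frontier ?A\<close>
      proof eventually_elim
        case (elim x)
        have tx: "(\<lambda>k. x - t k *\<^sub>R v) \<longlonglongrightarrow> x" using t0 by (auto intro!: tendsto_eq_intros)
        have "(\<lambda>k. indicator ?A (x - t k *\<^sub>R v) :: real) \<longlonglongrightarrow> indicator ?A x"
        proof (cases "x \<in> ?A")
          case True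
          have "\<forall>\<^sub>F k in sequentially. x - t k *\<^sub>R v \<in> ?A"
            using topological_tendstoD[OF tx open_box True] .
          then show ?thesis using True by (intro tendsto_eventually) (auto elim!: eventually_mono)
        next
          case False
          then have "x \<in> - closure ?A" using elim(2) interior_subset[of ?A] by (auto simp: frontier_def)
          then have "\<forall>\<^sub>F k in sequentially. x - t k *\<^sub>R v \<in> - closure ?A"
            using topological_tendstoD[OF tx] by blast
          then show ?thesis using False closure_subset
            by (intro tendsto_eventually) (auto elim!: eventually_mono simp: indicator_def)
        qed
        then show ?case using elim(1) by (intro tendsto_intros) auto
      qed
      show "AE x in lborel. norm (indicator ?A (x - t k *\<^sub>R v) * q k x) \<le> ?w x" for k
        using qb inb[of _ "t k"] t[of k] C by (intro AE_I2) (auto simp: indicator_def C_def)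
    qed (use wint in \<open>auto intro!: borel_measurable_times\<close>)
    have "(\<integral>x. indicator ?A x * q k (x + t k *\<^sub>R v) \<partial>lborel) = (\<integral>x. indicator ?A (x - t k *\<^sub>R v) * q k x \<partial>lborel)" for k
    proof -
      have "(\<integral>x. indicator ?A (x - t k *\<^sub>R v) * q k x \<partial>lborel)
          = (\<integral>x. indicator ?A (x - t k *\<^sub>R v) * q k x \<partial>distr lborel borel ((+) (t k *\<^sub>R v)))"
        by (simp add: lborel_distr_plus)
      also have "\<dots> = (\<integral>x. indicator ?A (t k *\<^sub>R v + x - t k *\<^sub>R v) * q k (t k *\<^sub>R v + x) \<partial>lborel)"
        by (rule integral_distr) auto
      finally show ?thesis by (simp add: add.commute)
    qed
    then show "(\<integral>x. indicator ?A x * ?R x \<partial>lborel) = (\<integral>x. indicator ?A x * ?W x \<partial>lborel)"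
      using LIMSEQ_unique[OF I1] I2 by simp
  qed (use cl in auto)
  then show ?thesis
    using limR limW ex[of "v + w"]
  proof eventually_elim
    case (elim x)
    then have "dir_deriv f (v + w) x = dir_deriv f v x + dir_deriv f w x" using cl(2) by auto
    then show ?case using elim by simp
  qed
qed

text \<open>
  Additivity and homogeneity, applied to the expansion of \<open>v\<close> in the standard basis. The null set
  depends on \<open>v\<close>, which is why only countably many directions are used afterwards.
\<close>

lemma lipschitz_AE_dir_deriv_linear:
  fixes f :: "'a::euclidean_space \<Rightarrow> real"
  assumes f: "L-lipschitz_on UNIV f"
  shows "AE x in lborel. has_dir_deriv f v x (v \<bullet> (\<Sum>b\<in>Basis. dir_deriv f b x *\<^sub>R b))"
proof -
  have "AE x in lborel. has_dir_deriv f (\<Sum>b\<in>B. (v \<bullet> b) *\<^sub>R b) x (\<Sum>b\<in>B. (v \<bullet> b) * dir_deriv f b x)"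
    if "finite B" for B :: "'a set"
    using that
  proof (induction B)
    case empty
    show ?case by (simp add: has_dir_deriv_def)
  next
    case (insert b B)
    have "AE x in lborel. has_dir_deriv f b x (dir_deriv f b x)"
      using lipschitz_AE_dir_deriv[OF f, of b] by eventually_elim (auto simp: dir_deriv_eqI)
    then show ?case
      using lipschitz_AE_dir_deriv_add[OF f, of "(v \<bullet> b) *\<^sub>R b" "\<Sum>b\<in>B. (v \<bullet> b) *\<^sub>R b"] insert.IH
    proof eventually_elim
      case (elim x)
      have "dir_deriv f ((v \<bullet> b) *\<^sub>R b) x = (v \<bullet> b) * dir_deriv f b x"
        using has_dir_deriv_scaleR[OF elim(1)] by (rule dir_deriv_eqI)
      moreover have "dir_deriv f (\<Sum>b\<in>B. (v \<bullet> b) *\<^sub>R b) x = (\<Sum>b\<in>B. (v \<bullet> b) * dir_deriv f b x)"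
        using elim(3) by (rule dir_deriv_eqI)
      ultimately show ?case using elim(2) insert.hyps by simp
    qed
  qed
  from this[OF finite_Basis] show ?thesis
    by (simp add: euclidean_representation inner_sum_right mult.commute)
qed

text \<open>
  The unit sphere is covered by finitely many small balls around directions in \<open>Q\<close>, for which the
  difference quotients converge simultaneously; between a direction and the centre of its ball
  the Lipschitz property controls the difference.
\<close>

lemma gderiv_if_dir_deriv_dense:
  fixes f :: "'a::euclidean_space \<Rightarrow> real"
  assumes f: "L-lipschitz_on UNIV f" and Q: "closure Q = UNIV"
    and dd: "\<And>v. v \<in> Q \<Longrightarrow> has_dir_deriv f v x (v \<bullet> p)"
  shows "GDERIV f x :> p"
  unfolding gderiv_def has_derivative_at
proof (intro conjI bounded_linear_inner_left LIM_I)
  fix r :: real assume r: "0 < r"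
  have L: "0 \<le> L" using f by (rule lipschitz_on_nonneg)
  \<comment> \<open>mesh of the net: \<open>L \<eta>\<close> is lost in the values of \<open>f\<close>, \<open>norm p \<eta>\<close> in the linear part\<close>
  define \<eta> where "\<eta> = r / (2 * (L + norm p + 1))"
  have den: "0 < L + norm p + 1" using L by (simp add: add_nonneg_pos)
  have \<eta>: "0 < \<eta>" "(L + norm p) * \<eta> < r / 2"
    using r L den by (auto simp: \<eta>_def field_simps)
  have "sphere 0 1 \<subseteq> (\<Union>v\<in>Q. ball v \<eta>)"
  proof
    fix u :: 'a
    have "u \<in> closure Q" using Q by simp
    then show "u \<in> (\<Union>v\<in>Q. ball v \<eta>)" using \<eta>(1) by (auto simp: closure_approachable)
  qed
  then obtain Q' where Q': "Q' \<subseteq> Q" "finite Q'" "sphere 0 1 \<subseteq> (\<Union>v\<in>Q'. ball v \<eta>)"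
    using compactE_image[OF compact_sphere, of Q "\<lambda>v. ball v \<eta>" 0 1] by auto
  have "\<exists>d>0. \<forall>s. s \<noteq> 0 \<and> norm (s - 0) < d \<longrightarrow> norm ((f (x + s *\<^sub>R v) - f x) / s - v \<bullet> p) < r/2" if "v \<in> Q'" for v
    using LIM_D[OF dd[unfolded has_dir_deriv_iff], of v "r/2"] Q'(1) that r by auto
  then obtain d where d: "\<And>v. v \<in> Q' \<Longrightarrow> d v > 0"
    and dv: "\<And>v s. v \<in> Q' \<Longrightarrow> s \<noteq> 0 \<Longrightarrow> \<bar>s\<bar> < d v \<Longrightarrow> \<bar>(f (x + s *\<^sub>R v) - f x) / s - v \<bullet> p\<bar> < r/2"
    by (auto simp: Bex_def) metis
  define \<delta> where "\<delta> = Min (insert 1 (d ` Q'))"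
  have \<delta>: "0 < \<delta>" "\<And>v. v \<in> Q' \<Longrightarrow> \<delta> \<le> d v" using Q'(2) d by (auto simp: \<delta>_def)
  show "\<exists>s>0. \<forall>h. h \<noteq> 0 \<and> norm (h - 0) < s \<longrightarrow> norm (norm (f (x + h) - f x - h \<bullet> p) / norm h - 0) < r"
  proof (intro exI[of _ \<delta>] conjI allI impI \<delta>(1), elim conjE)
    fix h :: 'a assume h: "h \<noteq> 0" "norm (h - 0) < \<delta>"
    define s where "s = norm h"
    define u where "u = h /\<^sub>R s"
    have s: "0 < s" "s < \<delta>" and hu: "h = s *\<^sub>R u" and u: "norm u = 1" using h by (auto simp: s_def u_def)
    obtain v where v: "v \<in> Q'" "dist v u < \<eta>" using Q'(3) u by auto
    have "\<bar>f (x + s *\<^sub>R v) - f x - s * (v \<bullet> p)\<bar> \<le> s * (r/2)"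
    proof -
      have "\<bar>(f (x + s *\<^sub>R v) - f x) / s - v \<bullet> p\<bar> < r/2" using dv[OF v(1), of s] s \<delta>(2)[OF v(1)] by auto
      moreover have "(f (x + s *\<^sub>R v) - f x) / s - v \<bullet> p = (f (x + s *\<^sub>R v) - f x - s * (v \<bullet> p)) / s"
        using s by (simp add: field_simps)
      ultimately show ?thesis using s by (simp add: abs_divide field_simps)
    qed
    moreover have "\<bar>f (x + s *\<^sub>R u) - f (x + s *\<^sub>R v)\<bar> \<le> s * (L * \<eta>)"
    proof -
      have "\<bar>f (x + s *\<^sub>R u) - f (x + s *\<^sub>R v)\<bar> \<le> L * (s * dist v u)"
        using lipschitz_onD[OF f, of "x + s *\<^sub>R u" "x + s *\<^sub>R v"] s
        by (simp add: dist_real_def dist_norm scaleR_diff_right[symmetric] norm_minus_commute)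
      also have "\<dots> \<le> L * (s * \<eta>)" using v(2) s L by (intro mult_left_mono) auto
      finally show ?thesis by (simp add: mult_ac)
    qed
    moreover have "\<bar>s * (v \<bullet> p) - s * (u \<bullet> p)\<bar> \<le> s * (norm p * \<eta>)"
    proof -
      have "\<bar>s * (v \<bullet> p) - s * (u \<bullet> p)\<bar> = s * \<bar>(v - u) \<bullet> p\<bar>"
        using s by (simp add: inner_diff_left right_diff_distrib[symmetric] abs_mult)
      also have "\<dots> \<le> s * (norm (v - u) * norm p)"
        using s by (intro mult_left_mono Cauchy_Schwarz_ineq2) auto
      also have "\<dots> \<le> s * (\<eta> * norm p)"
        using s v(2) by (intro mult_left_mono mult_right_mono) (auto simp: dist_norm)
      finally show ?thesis by (simp add: mult_ac)
    qed
    ultimately have "\<bar>f (x + s *\<^sub>R u) - f x - s * (u \<bullet> p)\<bar> \<le> s * (r/2) + s * (L * \<eta>) + s * (norm p * \<eta>)"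
      by linarith
    also have "\<dots> = s * (r/2 + (L + norm p) * \<eta>)" by (simp add: algebra_simps)
    also have "\<dots> < s * r" using s \<eta>(2) by simp
    finally show "norm (norm (f (x + h) - f x - h \<bullet> p) / norm h - 0) < r"
      using s unfolding s_def[symmetric] by (simp add: hu field_simps)
  qed
qed

theorem rademacher:
  fixes f :: "'a::euclidean_space \<Rightarrow> real"
  assumes f: "L-lipschitz_on UNIV f"
  shows "AE x in lborel. \<exists>p. GDERIV f x :> p"
proof -
  obtain Q :: "'a set" where Q: "countable Q" "closure Q = UNIV"
    by (metis separable top.extremum_uniqueI)
  have "AE x in lborel. \<forall>v\<in>Q. has_dir_deriv f v x (v \<bullet> (\<Sum>b\<in>Basis. dir_deriv f b x *\<^sub>R b))"
    by (rule AE_ball_countable'[OF lipschitz_AE_dir_deriv_linear[OF f] Q(1)])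
  then show ?thesis
    by eventually_elim (blast intro: gderiv_if_dir_deriv_dense[OF f Q(2)])
qed

lemma has_dir_deriv_if_gderiv:
  assumes "GDERIV f x :> p"
  shows "has_dir_deriv f v x (v \<bullet> p)"
proof -
  have 1: "((\<lambda>s. x + s *\<^sub>R v) has_derivative (\<lambda>s. s *\<^sub>R v)) (at 0)"
    by (auto intro!: derivative_eq_intros)
  have "(f has_derivative (\<lambda>h. h \<bullet> p)) (at (x + 0 *\<^sub>R v))" using assms by (simp add: gderiv_def)
  from has_derivative_compose[OF 1 this]
  have "((\<lambda>s. f (x + s *\<^sub>R v)) has_derivative (\<lambda>s. (s *\<^sub>R v) \<bullet> p)) (at 0)" .
  then show ?thesis
    unfolding has_dir_deriv_def has_field_derivative_def by (simp add: mult_commute_abs)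
qed

text \<open>
  A mean value inequality that looks at the gradient only where it exists. Along almost every line
  parallel to \<open>v\<close>, the gradient exists almost everywhere by Rademacher's theorem, so the bound holds there by
  the monotonicity criterion on the line. Lines of this kind come arbitrarily close to \<open>y\<close>, and \<open>f\<close> is
  continuous.
\<close>

lemma lipschitz_increment_le_gradient_bound:
  fixes f :: "'a::euclidean_space \<Rightarrow> real"
  assumes f: "L-lipschitz_on UNIV f"
    and U: "open U" "closed_segment y (y + v) \<subseteq> U"
    and grad: "\<And>z p. z \<in> U \<Longrightarrow> GDERIV f z :> p \<Longrightarrow> p \<bullet> v \<le> c"
  shows "f (y + v) - f y \<le> c"
proof -
  have cont: "continuous_on UNIV f" using f by (rule lipschitz_on_continuous_on)
  obtain N where N: "{x. \<not> (\<exists>p. GDERIV f x :> p)} \<subseteq> N" "N \<in> null_sets lborel"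
    using rademacher[OF f] by (auto elim!: AE_E simp: null_sets_def)
  then have Nb: "N \<in> sets borel" by (auto simp: null_sets_def)
  have "AE x in lborel. x \<notin> N" using N(2) by (rule AE_not_in)
  then have "AE x in lborel. AE s in lborel. x + s *\<^sub>R v \<notin> N" using AE_lines_iff_AE[OF Nb] by blast
  then obtain N' where N': "{x. \<not> (AE s in lborel. x + s *\<^sub>R v \<notin> N)} \<subseteq> N'" "N' \<in> null_sets lborel"
    by (auto elim!: AE_E simp: null_sets_def)
  obtain \<epsilon> where \<epsilon>: "\<epsilon> > 0" and nb: "\<And>x. x \<in> closed_segment y (y + v) \<Longrightarrow> ball x \<epsilon> \<subseteq> U"
  proof -
    obtain \<epsilon> where "0 < \<epsilon>" "{x. infdist x (closed_segment y (y + v)) \<le> \<epsilon>} \<subseteq> U"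
      using compact_in_open_separated[of "closed_segment y (y + v)" U] U by auto
    moreover have "ball x \<epsilon> \<subseteq> {x. infdist x (closed_segment y (y + v)) \<le> \<epsilon>}" if "x \<in> closed_segment y (y + v)" for x
    proof
      fix w assume "w \<in> ball x \<epsilon>"
      then show "w \<in> {x. infdist x (closed_segment y (y + v)) \<le> \<epsilon>}"
        using infdist_le[OF that, of w] by (simp add: dist_commute)
    qed
    ultimately show ?thesis using that[of \<epsilon>] by blast
  qed
  have good: "f (z + v) - f z \<le> c" if z: "z \<notin> N'" "dist z y < \<epsilon>" for z
  proof -
    have AEs: "AE s in lborel. z + s *\<^sub>R v \<notin> N" using N'(1) z by blast
    have S: "{s. z + s *\<^sub>R v \<in> N} \<in> sets borel" using Nb by measurable
    have "negligible {s. z + s *\<^sub>R v \<in> N}"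
      using AEs S by (subst negligible_iff_emeasure0) (auto simp: AE_iff_measurable[OF _ refl])
    define g where "g s = f (z + s *\<^sub>R v) - c * s" for s
    have "(L * norm v + \<bar>c\<bar>)-lipschitz_on UNIV g"
    proof (rule lipschitz_onI)
      fix s t :: real
      have "\<bar>f (z + s *\<^sub>R v) - f (z + t *\<^sub>R v)\<bar> \<le> L * norm v * \<bar>s - t\<bar>"
        using lipschitz_onD[OF f, of "z + s *\<^sub>R v" "z + t *\<^sub>R v"]
        by (simp add: dist_norm scaleR_diff_left[symmetric] mult_ac)
      moreover have "\<bar>c * s - c * t\<bar> = \<bar>c\<bar> * \<bar>s - t\<bar>" by (simp add: right_diff_distrib[symmetric] abs_mult)
      ultimately show "dist (g s) (g t) \<le> (L * norm v + \<bar>c\<bar>) * dist s t"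
        unfolding g_def dist_real_def by (simp add: distrib_right)
    qed (use lipschitz_on_nonneg[OF f] in simp)
    then have "g 1 \<le> g 0"
    proof (rule lipschitz_nonincreasing_if_AE_deriv_nonpos[OF _ \<open>negligible {s. z + s *\<^sub>R v \<in> N}\<close>])
      fix s :: real assume s: "0 < s" "s < 1" "s \<notin> {s. z + s *\<^sub>R v \<in> N}"
      then obtain p where p: "GDERIV f (z + s *\<^sub>R v) :> p" using N(1) by auto
      have "y + s *\<^sub>R v \<in> closed_segment y (y + v)"
        using s by (auto simp: in_segment algebra_simps intro!: exI[of _ s])
      from nb[OF this] have "z + s *\<^sub>R v \<in> U" using z(2) by (auto simp: dist_norm norm_minus_commute subset_iff)
      from grad[OF this p] have pc: "v \<bullet> p - c \<le> 0" by (simp add: inner_commute)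
      have "((\<lambda>h. f (z + s *\<^sub>R v + h *\<^sub>R v)) has_real_derivative v \<bullet> p) (at 0)"
        using has_dir_deriv_if_gderiv[OF p] by (simp add: has_dir_deriv_def)
      then have "((\<lambda>s. f (z + s *\<^sub>R v)) has_real_derivative v \<bullet> p) (at s)"
        using DERIV_shift[of "\<lambda>s. f (z + s *\<^sub>R v)" "v \<bullet> p" 0 s] by (simp add: scaleR_add_left algebra_simps)
      then have "(g has_real_derivative v \<bullet> p - c) (at s)"
        unfolding g_def by (auto intro!: derivative_eq_intros)
      then show "\<exists>D\<le>0. (g has_real_derivative D) (at s)" using pc by blast
    qed simp
    then show ?thesis by (simp add: g_def)
  qed
  have "y \<in> closure (- N')"
  proof -
    have "negligible N'" using N'(2) by (simp add: negligible_iff_null_sets null_sets_completionI)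
    then have "interior N' = {}"
      by (meson interior_subset negligible_subset open_interior open_not_negligible)
    then show ?thesis by (simp add: closure_interior)
  qed
  then obtain z where z: "\<And>n. z n \<in> - N'" "z \<longlonglongrightarrow> y" by (auto simp: closure_sequential)
  have "(\<lambda>n. f (z n + v) - f (z n)) \<longlonglongrightarrow> f (y + v) - f y"
    by (intro tendsto_intros continuous_on_tendsto_compose[OF cont] z) auto
  moreover have "\<forall>\<^sub>F n in sequentially. f (z n + v) - f (z n) \<le> c"
    using tendstoD[OF z(2) \<epsilon>] by eventually_elim (use good z(1) in auto)
  ultimately show ?thesis by (intro tendsto_upperbound) auto
qed

section \<open>Clarke gradients and derivatives along curves\<close>

text \<open>
  At a point of differentiability near \<open>x\<close>, the product with the gradient is itself a limit of the
  quotients that enter the upper limit. The resulting bound passes to limits of gradients and, since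
  it describes a closed half-space, to their closed convex hull.
\<close>

lemma clarke_gradient_le_clarke_dderiv:
  assumes p: "p \<in> clarke_gradient V x"
  shows "ereal (p \<bullet> w) \<le> clarke_dderiv V x w"
proof (rule ccontr)
  assume "\<not> ereal (p \<bullet> w) \<le> clarke_dderiv V x w"
  then obtain c where c: "clarke_dderiv V x w < ereal c" "ereal c < ereal (p \<bullet> w)"
    using ereal_dense2[of "clarke_dderiv V x w" "ereal (p \<bullet> w)"] by (auto simp: not_le)
  have "\<forall>\<^sub>F z in nhds x \<times>\<^sub>F at_right 0. (case z of (y, t) \<Rightarrow> ereal ((V (y + t *\<^sub>R w) - V y) / t)) < ereal c"
    using c(1) unfolding clarke_dderiv_def by (rule Limsup_lessD)
  then obtain P Q where P: "eventually P (nhds x)" and Q: "eventually Q (at_right (0::real))"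
    and PQ: "\<And>y t. P y \<Longrightarrow> Q t \<Longrightarrow> (V (y + t *\<^sub>R w) - V y) / t < c"
    unfolding eventually_prod_filter by auto
  have "q \<bullet> w \<le> c" if q: "y \<longlonglongrightarrow> x" "\<And>i::nat. GDERIV V (y i) :> g i" "g \<longlonglongrightarrow> q" for q y g
  proof -
    have "\<forall>\<^sub>F i in sequentially. P (y i)"
      using q(1) P by (auto simp: filterlim_iff)
    then have "\<forall>\<^sub>F i in sequentially. g i \<bullet> w \<le> c"
    proof eventually_elim
      case (elim i)
      have "((\<lambda>t. (V (y i + t *\<^sub>R w) - V (y i)) / t) \<longlongrightarrow> w \<bullet> g i) (at_right 0)"
        using has_dir_deriv_if_gderiv[OF q(2)] unfolding has_dir_deriv_iff
        by (rule filterlim_mono) (auto intro: at_le)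
      moreover have "\<forall>\<^sub>F t in at_right 0. (V (y i + t *\<^sub>R w) - V (y i)) / t \<le> c"
        using Q by eventually_elim (use PQ[OF elim] in force)
      ultimately have "w \<bullet> g i \<le> c" by (intro tendsto_upperbound) auto
      then show ?case by (simp add: inner_commute)
    qed
    moreover have "(\<lambda>i. g i \<bullet> w) \<longlonglongrightarrow> q \<bullet> w" by (intro tendsto_intros q)
    ultimately show ?thesis by (intro tendsto_upperbound) auto
  qed
  then have "{p. \<exists>y g. y \<longlonglongrightarrow> x \<and> (\<forall>i::nat. GDERIV V (y i) :> g i) \<and> g \<longlonglongrightarrow> p} \<subseteq> {q. w \<bullet> q \<le> c}"
    by (auto simp: inner_commute)
  then have "clarke_gradient V x \<subseteq> {q. w \<bullet> q \<le> c}"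
    unfolding clarke_gradient_def
    by (intro closure_minimal hull_minimal convex_halfspace_le closed_halfspace_le)
  then show False using p c(2) by (auto simp: inner_commute)
qed

text \<open>
  For a regular function the one-sided derivatives in the directions \<open>v\<close> and \<open>- v\<close> bound \<open>p \<bullet> v\<close> from
  above and from below; when the two-sided derivative exists, the bounds coincide.
\<close>

lemma regular_clarke_gradient_inner:
  assumes V: "regular_fun V" and d: "has_dir_deriv V v x d" and p: "p \<in> clarke_gradient V x"
  shows "p \<bullet> v = d"
proof -
  have cd: "clarke_dderiv V x w = ereal e" if "has_dir_deriv V w x e" for w e
  proof -
    have "((\<lambda>t. (V (x + t *\<^sub>R w) - V x) / t) \<longlongrightarrow> e) (at_right 0)"
      using that unfolding has_dir_deriv_iff by (rule filterlim_mono) (auto intro: at_le)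
    then have "((\<lambda>t. ereal ((V (x + t *\<^sub>R w) - V x) / t)) \<longlongrightarrow> ereal e) (at_right 0)"
      by simp
    moreover have "((\<lambda>t. ereal ((V (x + t *\<^sub>R w) - V x) / t)) \<longlongrightarrow> clarke_dderiv V x w) (at_right 0)"
      using V unfolding regular_fun_def by blast
    ultimately show ?thesis by (intro tendsto_unique[OF trivial_limit_at_right_real])
  qed
  have "has_dir_deriv V (- v) x (- d)" using has_dir_deriv_scaleR[OF d, of "-1"] by simp
  then have "ereal (p \<bullet> (- v)) \<le> ereal (- d)"
    using clarke_gradient_le_clarke_dderiv[OF p, of "- v"] cd by simp
  moreover have "ereal (p \<bullet> v) \<le> ereal d"
    using clarke_gradient_le_clarke_dderiv[OF p, of v] cd[OF d] by simp
  ultimately show ?thesis by simp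
qed

text \<open>
  Take the derivative in the direction of the gradient itself.
\<close>

lemma gderiv_norm_le_lipschitz:
  assumes f: "L-lipschitz_on UNIV f" and g: "GDERIV f z :> g"
  shows "norm g \<le> L"
proof -
  have "\<bar>g \<bullet> g\<bar> \<le> L * norm g"
    using lipschitz_quotient_bound[OF f]
    by (intro tendsto_upperbound[OF tendsto_rabs[OF has_dir_deriv_if_gderiv[OF g, of g, unfolded has_dir_deriv_iff]]]) auto
  then have "norm g * norm g \<le> L * norm g" by (simp add: power2_norm_eq_inner[symmetric] power2_eq_square)
  then show ?thesis using lipschitz_on_nonneg[OF f] by (cases "g = 0") auto
qed

text \<open>
  If every element of the Clarke gradient had product with \<open>v\<close> below some \<open>c < d\<close>, then by
  compactness all gradients at points close to \<open>x\<close> would have product at most \<open>c\<close>, and the mean value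
  inequality would make \<open>V\<close> grow too slowly in the direction \<open>v\<close>.
\<close>

lemma has_dir_deriv_le_SUP_clarke_gradient:
  fixes V :: "'a::euclidean_space \<Rightarrow> real"
  assumes V: "locally_lipschitz V" and d: "has_dir_deriv V v x d"
  shows "ereal d \<le> (SUP p\<in>clarke_gradient V x. ereal (p \<bullet> v))"
proof (rule ccontr)
  assume "\<not> ereal d \<le> (SUP p\<in>clarke_gradient V x. ereal (p \<bullet> v))"
  then obtain c where c: "(SUP p\<in>clarke_gradient V x. ereal (p \<bullet> v)) < ereal c" "c < d"
    using ereal_dense2[of "SUP p\<in>clarke_gradient V x. ereal (p \<bullet> v)" "ereal d"] by (auto simp: not_le)
  have cg: "p \<bullet> v < c" if "p \<in> clarke_gradient V x" for p
    using that c(1) SUP_upper[of p "clarke_gradient V x" "\<lambda>p. ereal (p \<bullet> v)"]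
    by (metis ereal_less_eq(3) linorder_not_le order_trans)
  obtain r0 L where r0: "r0 > 0" and VL: "L-lipschitz_on (ball x r0) V"
    using V unfolding locally_lipschitz_def by blast
  define r1 where "r1 = r0 / 2"
  have r1: "0 < r1" "r1 < r0" using r0 by (auto simp: r1_def)
  \<comment> \<open>a globally Lipschitz function that agrees with \<open>V\<close> near \<open>x\<close>\<close>
  define f where "f y = V (closest_point (cball x r1) y)" for y
  have cp: "closest_point (cball x r1) y \<in> cball x r1" for y
    using r1 by (intro closest_point_in_set) auto
  have fV: "f y = V y" if "y \<in> cball x r1" for y
    using that by (simp add: f_def closest_point_self)
  have f: "L-lipschitz_on UNIV f"
  proof (rule lipschitz_onI)
    fix y z :: 'a
    have "closest_point (cball x r1) y \<in> ball x r0" for y using cp[of y] r1 by auto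
    then have "dist (f y) (f z) \<le> L * dist (closest_point (cball x r1) y) (closest_point (cball x r1) z)"
      unfolding f_def by (intro lipschitz_onD[OF VL])
    also have "\<dots> \<le> L * dist y z"
      using r1 lipschitz_on_nonneg[OF VL] by (intro mult_left_mono closest_point_lipschitz) auto
    finally show "dist (f y) (f z) \<le> L * dist y z" .
  qed (rule lipschitz_on_nonneg[OF VL])
  have gfV: "GDERIV f z :> g \<longleftrightarrow> GDERIV V z :> g" if "z \<in> ball x r1" for z g
    unfolding gderiv_def using that
    by (auto intro: has_derivative_transform_within_open[OF _ open_ball] simp: fV)
  have "\<exists>r>0. r \<le> r1 \<and> (\<forall>z g. z \<in> ball x r \<longrightarrow> GDERIV f z :> g \<longrightarrow> g \<bullet> v \<le> c)"
  proof (rule ccontr)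
    assume neg: "\<not> (\<exists>r>0. r \<le> r1 \<and> (\<forall>z g. z \<in> ball x r \<longrightarrow> GDERIV f z :> g \<longrightarrow> g \<bullet> v \<le> c))"
    have "\<exists>z g. z \<in> ball x (min r1 (1 / Suc n)) \<and> GDERIV f z :> g \<and> c < g \<bullet> v" for n
    proof -
      have "0 < min r1 (1 / real (Suc n))" "min r1 (1 / real (Suc n)) \<le> r1" using r1 by auto
      then show ?thesis using neg not_le by metis
    qed
    then obtain z g where zg: "\<And>n. z n \<in> ball x (min r1 (1 / Suc n))" "\<And>n. GDERIV f (z n) :> g n" "\<And>n. c < g n \<bullet> v"
      by metis
    have "bounded (range g)"
      using gderiv_norm_le_lipschitz[OF f zg(2)] by (auto simp: bounded_iff)
    then obtain p s where s: "strict_mono (s :: nat \<Rightarrow> nat)" "(g \<circ> s) \<longlonglongrightarrow> p"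
      using bounded_imp_convergent_subsequence by blast
    have "(\<lambda>n. 1 / real (Suc n)) \<longlonglongrightarrow> 0" using LIMSEQ_inverse_real_of_nat by (simp add: inverse_eq_divide)
    then have "z \<longlonglongrightarrow> x"
      by (rule metric_tendsto_imp_tendsto) (use zg(1) in \<open>auto intro!: always_eventually less_imp_le simp: dist_commute dist_real_def simp del: of_nat_Suc\<close>)
    then have "(z \<circ> s) \<longlonglongrightarrow> x" using s(1) by (rule LIMSEQ_subseq_LIMSEQ)
    moreover have "GDERIV V ((z \<circ> s) i) :> (g \<circ> s) i" for i
      using zg(1)[of "s i"] zg(2)[of "s i"] gfV by simp
    ultimately have "p \<in> {p. \<exists>y g. y \<longlonglongrightarrow> x \<and> (\<forall>i::nat. GDERIV V (y i) :> g i) \<and> g \<longlonglongrightarrow> p}"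
      using s(2) by blast
    then have "p \<in> clarke_gradient V x"
      unfolding clarke_gradient_def by (meson closure_subset hull_subset subsetD)
    then have "p \<bullet> v < c" by (rule cg)
    moreover have "(\<lambda>n. (g \<circ> s) n \<bullet> v) \<longlonglongrightarrow> p \<bullet> v" by (intro tendsto_intros s)
    then have "c \<le> p \<bullet> v" by (rule tendsto_lowerbound) (use zg(3) in \<open>auto intro!: always_eventually less_imp_le\<close>)
    ultimately show False by simp
  qed
  then obtain r where r: "0 < r" "r \<le> r1" and grad: "\<And>z g. z \<in> ball x r \<Longrightarrow> GDERIV f z :> g \<Longrightarrow> g \<bullet> v \<le> c"
    by blast
  have "((\<lambda>t. (V (x + t *\<^sub>R v) - V x) / t) \<longlongrightarrow> d) (at_right 0)"
    using d unfolding has_dir_deriv_iff by (rule filterlim_mono) (auto intro: at_le)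
  moreover have "\<forall>\<^sub>F t in at_right 0. (V (x + t *\<^sub>R v) - V x) / t \<le> c"
    unfolding eventually_at_right_field
  proof (intro exI[of _ "r / (norm v + 1)"] conjI allI impI)
    have nv: "0 < norm v + 1" by (simp add: add_nonneg_pos)
    show "0 < r / (norm v + 1)" using r nv by simp
    fix t assume t: "0 < t" "t < r / (norm v + 1)"
    have "t * norm v \<le> t * (norm v + 1)" using t by simp
    also have "\<dots> < r" using t nv by (simp add: field_simps)
    finally have "t * norm v < r" .
    then have xt: "x + t *\<^sub>R v \<in> ball x r" using t by (simp add: dist_norm)
    then have seg: "closed_segment x (x + t *\<^sub>R v) \<subseteq> ball x r"
      using r by (intro closed_segment_subset) auto
    have "f (x + t *\<^sub>R v) - f x \<le> t * c"
    proof (rule lipschitz_increment_le_gradient_bound[OF f open_ball seg])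
      fix z p assume "z \<in> ball x r" "GDERIV f z :> p"
      then show "p \<bullet> t *\<^sub>R v \<le> t * c" using grad t by simp
    qed
    moreover have "f (x + t *\<^sub>R v) = V (x + t *\<^sub>R v)" "f x = V x" using xt r by (auto intro!: fV)
    ultimately show "(V (x + t *\<^sub>R v) - V x) / t \<le> c" using t by (simp add: field_simps)
  qed
  ultimately have "d \<le> c" by (intro tendsto_upperbound) auto
  then show False using c(2) by simp
qed

text \<open>
  The curve and its tangent differ by \<open>o(s)\<close>, and the Lipschitz property transfers this to \<open>V\<close>.
\<close>

lemma has_dir_deriv_along_curve:
  fixes V :: "'a::euclidean_space \<Rightarrow> real"
  assumes V: "locally_lipschitz V" and \<phi>: "(\<phi> has_vector_derivative v) (at t)"
    and d: "((\<lambda>s. V (\<phi> s)) has_real_derivative d) (at t)"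
  shows "has_dir_deriv V v (\<phi> t) d"
proof -
  obtain r L where r: "r > 0" and VL: "L-lipschitz_on (ball (\<phi> t) r) V"
    using V unfolding locally_lipschitz_def by blast
  have L: "0 \<le> L" using VL by (rule lipschitz_on_nonneg)
  have q: "((\<lambda>s. norm (\<phi> (t + s) - \<phi> t - s *\<^sub>R v) / norm s) \<longlongrightarrow> 0) (at 0)"
    using \<phi> unfolding has_vector_derivative_def has_derivative_at by simp
  have "isCont \<phi> t" using \<phi> by (rule has_vector_derivative_continuous)
  then have "((\<lambda>s. \<phi> (t + s)) \<longlongrightarrow> \<phi> t) (at 0)" by (simp add: isCont_iff)
  then have e1: "\<forall>\<^sub>F s in at 0. \<phi> (t + s) \<in> ball (\<phi> t) r"
    using topological_tendstoD[OF _ open_ball, of _ "\<phi> t"] r by fastforce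
  have "((\<lambda>s. \<phi> t + s *\<^sub>R v) \<longlongrightarrow> \<phi> t + 0 *\<^sub>R v) (at 0)" by (intro tendsto_intros)
  then have e2: "\<forall>\<^sub>F s in at 0. \<phi> t + s *\<^sub>R v \<in> ball (\<phi> t) r"
    using topological_tendstoD[OF _ open_ball, of _ "\<phi> t"] r by fastforce
  have "((\<lambda>s. L * (norm (\<phi> (t + s) - \<phi> t - s *\<^sub>R v) / norm s)) \<longlongrightarrow> L * 0) (at 0)"
    by (intro tendsto_intros q)
  then have q0: "((\<lambda>s. L * (norm (\<phi> (t + s) - \<phi> t - s *\<^sub>R v) / norm s)) \<longlongrightarrow> 0) (at 0)" by simp
  have lim0: "((\<lambda>s. (V (\<phi> t + s *\<^sub>R v) - V (\<phi> (t + s))) / s) \<longlongrightarrow> 0) (at 0)"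
  proof (rule Lim_null_comparison[OF _ q0])
    show "\<forall>\<^sub>F s in at 0. norm ((V (\<phi> t + s *\<^sub>R v) - V (\<phi> (t + s))) / s) \<le> L * (norm (\<phi> (t + s) - \<phi> t - s *\<^sub>R v) / norm s)"
      using e1 e2
    proof eventually_elim
      case (elim s)
      have "dist (V (\<phi> t + s *\<^sub>R v)) (V (\<phi> (t + s))) \<le> L * dist (\<phi> t + s *\<^sub>R v) (\<phi> (t + s))"
        using elim by (intro lipschitz_onD[OF VL])
      then have "\<bar>V (\<phi> t + s *\<^sub>R v) - V (\<phi> (t + s))\<bar> \<le> L * norm (\<phi> (t + s) - \<phi> t - s *\<^sub>R v)"
        by (simp add: dist_real_def dist_norm norm_minus_commute algebra_simps)
      from divide_right_mono[OF this, of "\<bar>s\<bar>"] show ?case by (simp add: abs_divide)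
    qed
  qed
  have "((\<lambda>s. (V (\<phi> (t + s)) - V (\<phi> t)) / s) \<longlongrightarrow> d) (at 0)"
    using d by (simp add: DERIV_def)
  from tendsto_add[OF lim0 this]
  have "((\<lambda>s. (V (\<phi> t + s *\<^sub>R v) - V (\<phi> t)) / s) \<longlongrightarrow> d) (at 0)"
    by (simp add: add_divide_distrib[symmetric])
  then show ?thesis by (simp add: has_dir_deriv_iff)
qed

text \<open>
  The velocity lies in the reduced map because each \<open>U\<close> in the collection is regular. It therefore
  competes in every inner supremum of the generalized derivative.
\<close>

lemma deriv_along_curve_le_gen_derivative:
  fixes V :: "'a::euclidean_space \<Rightarrow> real"
  assumes U: "admissible_collection \<U>" and V: "locally_lipschitz V"
    and \<phi>: "(\<phi> has_vector_derivative v) (at t)" and v: "v \<in> F (\<phi> t)"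
    and dU: "\<And>U. U \<in> \<U> \<Longrightarrow> \<exists>e. ((\<lambda>s. U (\<phi> s)) has_real_derivative e) (at t)"
    and d: "((\<lambda>s. V (\<phi> s)) has_real_derivative d) (at t)"
  shows "ereal d \<le> gen_derivative \<U> F V (\<phi> t)"
proof -
  have vU: "v \<in> constancy_set U F (\<phi> t)" if UU: "U \<in> \<U>" for U
  proof -
    have reg: "regular_fun U" using U UU by (auto simp: admissible_collection_def)
    obtain e where e: "((\<lambda>s. U (\<phi> s)) has_real_derivative e) (at t)" using dU[OF UU] by blast
    have "has_dir_deriv U v (\<phi> t) e"
      using reg by (intro has_dir_deriv_along_curve[OF _ \<phi> e]) (auto simp: regular_fun_def)
    then show ?thesis
      using regular_clarke_gradient_inner[OF reg] v by (auto simp: constancy_set_def)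
  qed
  then have vr: "v \<in> reduced_map \<U> F (\<phi> t)" using v by (auto simp: reduced_map_def)
  have dd: "has_dir_deriv V v (\<phi> t) d" by (rule has_dir_deriv_along_curve[OF V \<phi> d])
  have up: "ereal (p \<bullet> v) \<le> (SUP q\<in>reduced_map \<U> F (\<phi> t). ereal (p \<bullet> q))" for p
    using vr by (rule SUP_upper)
  show ?thesis
  proof (cases "regular_fun V")
    case True
    have "ereal d \<le> (INF p\<in>clarke_gradient V (\<phi> t). SUP q\<in>reduced_map \<U> F (\<phi> t). ereal (p \<bullet> q))"
      using up regular_clarke_gradient_inner[OF True dd] by (intro INF_greatest) metis
    then show ?thesis using vr True by (auto simp: gen_derivative_def)
  next
    case False
    have "ereal d \<le> (SUP p\<in>clarke_gradient V (\<phi> t). ereal (p \<bullet> v))"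
      by (rule has_dir_deriv_le_SUP_clarke_gradient[OF V dd])
    also have "\<dots> \<le> (SUP p\<in>clarke_gradient V (\<phi> t). SUP q\<in>reduced_map \<U> F (\<phi> t). ereal (p \<bullet> q))"
      using up by (rule SUP_mono')
    finally show ?thesis using vr False by (auto simp: gen_derivative_def)
  qed
qed

section \<open>Complete trajectories of the differential inclusion\<close>

lemma lipschitz_curve_differentiable_AE:
  fixes \<phi> :: "real \<Rightarrow> 'a::euclidean_space"
  assumes \<phi>: "C-lipschitz_on UNIV \<phi>"
  shows "negligible {t. \<not> (\<exists>v. (\<phi> has_vector_derivative v) (at t))}"
proof -
  have lip: "C-lipschitz_on UNIV (\<lambda>t. \<phi> t \<bullet> b)" if "b \<in> Basis" for b
  proof (rule lipschitz_onI)
    fix s t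
    have "dist (\<phi> s \<bullet> b) (\<phi> t \<bullet> b) \<le> dist (\<phi> s) (\<phi> t)"
      using that by (simp add: dist_norm inner_diff_left[symmetric] Basis_le_norm)
    then show "dist (\<phi> s \<bullet> b) (\<phi> t \<bullet> b) \<le> C * dist s t"
      using lipschitz_onD[OF \<phi>, of s t] by simp
  qed (rule lipschitz_on_nonneg[OF \<phi>])
  have "negligible (\<Union>b\<in>Basis. {t. \<not> (\<exists>D. ((\<lambda>t. \<phi> t \<bullet> b) has_real_derivative D) (at t))})"
    by (intro negligible_countable_Union countable_image countable_finite finite_Basis)
       (use lipschitz_real_differentiable_AE[OF lip] in blast)
  moreover have "{t. \<not> (\<exists>v. (\<phi> has_vector_derivative v) (at t))}
      \<subseteq> (\<Union>b\<in>Basis. {t. \<not> (\<exists>D. ((\<lambda>t. \<phi> t \<bullet> b) has_real_derivative D) (at t))})"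
  proof (rule subsetI, rule ccontr)
    fix t assume t: "t \<in> {t. \<not> (\<exists>v. (\<phi> has_vector_derivative v) (at t))}"
      and "t \<notin> (\<Union>b\<in>Basis. {t. \<not> (\<exists>D. ((\<lambda>t. \<phi> t \<bullet> b) has_real_derivative D) (at t))})"
    then obtain D where D: "\<And>b. b \<in> Basis \<Longrightarrow> ((\<lambda>t. \<phi> t \<bullet> b) has_real_derivative D b) (at t)"
      by (auto simp: Ball_def) metis
    have "((\<lambda>t. \<Sum>b\<in>Basis. (\<phi> t \<bullet> b) *\<^sub>R b) has_vector_derivative (\<Sum>b\<in>Basis. D b *\<^sub>R b)) (at t)"
      by (rule has_vector_derivative_sum)
         (auto intro!: derivative_eq_intros D)
    then show False using t by (auto simp: euclidean_representation)
  qed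
  ultimately show ?thesis by (rule negligible_subset)
qed

lemma locally_lipschitz_on_compact:
  assumes V: "locally_lipschitz V" and K: "compact K"
  obtains L where "L-lipschitz_on K V"
proof -
  have ll: "local_lipschitz {0::real} K (\<lambda>_. V)"
    unfolding local_lipschitz_def
  proof (intro ballI)
    fix t x
    obtain r L where r: "r > 0" "L-lipschitz_on (ball x r) V" using V unfolding locally_lipschitz_def by blast
    have "L-lipschitz_on (cball x (r/2) \<inter> K) V"
      by (rule lipschitz_on_subset[OF r(2)]) (use r(1) in auto)
    then show "\<exists>u>0. \<exists>L. \<forall>t\<in>cball t u \<inter> {0::real}. L-lipschitz_on (cball x u \<inter> K) V"
      using r(1) by (intro exI[of _ "r/2"] conjI exI[of _ L]) auto
  qed
  obtain L where "\<And>t::real. t \<in> {0} \<Longrightarrow> L-lipschitz_on K V"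
    by (rule local_lipschitz_compact_implies_lipschitz[OF ll K]) auto
  then show ?thesis using that by auto
qed

text \<open>
  Since \<open>V (\<phi> t)\<close> is nonincreasing, at negative times it is at least \<open>V (\<phi> 0)\<close>. If that is positive,
  the curve keeps a distance \<open>\<rho>\<close> from the origin there, so that \<open>V (\<phi> t)\<close> decreases at a rate of at least
  some \<open>c > 0\<close>. Followed backwards it would exceed every bound, but \<open>\<phi>\<close> is bounded.
\<close>

theorem complete_bounded_trajectory_at_equilibrium:
  fixes \<phi> :: "real \<Rightarrow> 'a::euclidean_space"
  assumes \<phi>: "C-lipschitz_on UNIV \<phi>" and bd: "bounded (range \<phi>)"
    and incl: "\<And>t v. (\<phi> has_vector_derivative v) (at t) \<Longrightarrow> v \<in> F (\<phi> t)"
    and U: "admissible_collection \<U>" and V: "gen_lyapunov \<U> F V" and V0: "pos_definite V0"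
    and dec: "\<And>x. x \<noteq> 0 \<Longrightarrow> gen_derivative \<U> F V x \<le> ereal (- V0 x)"
  shows "\<phi> 0 = 0"
proof (rule ccontr)
  assume nz: "\<phi> 0 \<noteq> 0"
  have Vl: "locally_lipschitz V" and Vp: "pos_definite V" and V1: "\<And>x. gen_derivative \<U> F V x \<le> 0"
    using V by (auto simp: gen_lyapunov_def)
  have V0val: "0 < V (\<phi> 0)"
  proof -
    obtain \<alpha> where \<alpha>: "strict_mono_on {0..} \<alpha>" "\<alpha> 0 = 0" "\<And>x. \<alpha> (norm x) \<le> V x"
      using Vp unfolding pos_definite_def by blast
    have "\<alpha> 0 < \<alpha> (norm (\<phi> 0))" using nz by (intro strict_mono_onD[OF \<alpha>(1)]) auto
    then show ?thesis using \<alpha>(2) \<alpha>(3)[of "\<phi> 0"] by simp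
  qed
  have Vc: "continuous_on UNIV V" and V00: "V 0 = 0" using Vp by (auto simp: pos_definite_def)
  obtain \<rho> where \<rho>: "\<rho> > 0" "\<And>x. norm x < \<rho> \<Longrightarrow> V x < V (\<phi> 0)"
  proof -
    have "isCont V 0" using Vc by (simp add: continuous_on_eq_continuous_at)
    then have "(V \<longlongrightarrow> V 0) (nhds 0)" unfolding isCont_def tendsto_at_iff_tendsto_nhds .
    then have "\<forall>\<^sub>F x in nhds 0. V x < V (\<phi> 0)"
      using V0val V00 by (intro order_tendstoD(2)[of V "V 0"]) auto
    then show ?thesis using that unfolding eventually_nhds_metric by auto
  qed
  obtain \<alpha> where \<alpha>: "strict_mono_on {0..} \<alpha>" "\<alpha> 0 = 0" "\<And>x. \<alpha> (norm x) \<le> V0 x"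
    using V0 unfolding pos_definite_def by blast
  define c where "c = \<alpha> \<rho>"
  have c: "0 < c" unfolding c_def using \<alpha>(2) \<rho>(1) strict_mono_onD[OF \<alpha>(1), of 0 \<rho>] by auto
  have V0c: "c \<le> V0 x" if "\<rho> \<le> norm x" for x
  proof -
    have "\<alpha> \<rho> \<le> \<alpha> (norm x)" using \<alpha>(1) \<rho>(1) that by (auto intro: strict_mono_on_leD)
    then show ?thesis using \<alpha>(3)[of x] by (simp add: c_def)
  qed
  have Kc: "compact (closure (range \<phi>))" using bd by simp
  obtain L where L: "L-lipschitz_on (closure (range \<phi>)) V" using locally_lipschitz_on_compact[OF Vl Kc] by blast
  have comp: "(K * C)-lipschitz_on UNIV (\<lambda>t. W (\<phi> t))" if W: "K-lipschitz_on (closure (range \<phi>)) W" for W K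
  proof -
    have "K-lipschitz_on (range \<phi>) W" using W by (rule lipschitz_on_subset) (rule closure_subset)
    from lipschitz_on_compose[OF \<phi> this] show ?thesis by (simp add: o_def)
  qed
  \<comment> \<open>countably many null sets, as the collection \<open>\<U>\<close> is countable\<close>
  define N where "N = {t. \<not> (\<exists>v. (\<phi> has_vector_derivative v) (at t))}
    \<union> (\<Union>W\<in>insert V \<U>. {t. \<not> (\<exists>D. ((\<lambda>t. W (\<phi> t)) has_real_derivative D) (at t))})"
  have neg: "negligible {t. \<not> (\<exists>D. ((\<lambda>t. W (\<phi> t)) has_real_derivative D) (at t))}" if W: "W \<in> insert V \<U>" for W
  proof -
    have "\<exists>K. K-lipschitz_on (closure (range \<phi>)) W"
      using W L U unfolding admissible_collection_def by (blast intro: lipschitz_on_subset)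
    then obtain K where "K-lipschitz_on (closure (range \<phi>)) W" by blast
    from lipschitz_real_differentiable_AE[OF comp[OF this]] show ?thesis .
  qed
  have N: "negligible N"
    unfolding N_def
  proof (intro negligible_Un lipschitz_curve_differentiable_AE[OF \<phi>])
    show "negligible (\<Union>W\<in>insert V \<U>. {t. \<not> (\<exists>D. ((\<lambda>t. W (\<phi> t)) has_real_derivative D) (at t))})"
      using U neg by (intro negligible_countable_Union countable_image) (auto simp: admissible_collection_def)
  qed
  have der: "\<exists>d. ((\<lambda>t. V (\<phi> t)) has_real_derivative d) (at t) \<and> ereal d \<le> gen_derivative \<U> F V (\<phi> t)"
    if t: "t \<notin> N" for t
  proof -
    obtain v where v: "(\<phi> has_vector_derivative v) (at t)" using t by (auto simp: N_def)
    obtain d where d: "((\<lambda>t. V (\<phi> t)) has_real_derivative d) (at t)" using t by (auto simp: N_def)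
    have "ereal d \<le> gen_derivative \<U> F V (\<phi> t)"
      using t by (intro deriv_along_curve_le_gen_derivative[OF U Vl v _ _ d] incl[OF v]) (auto simp: N_def)
    then show ?thesis using d by blast
  qed
  have mono: "V (\<phi> t) \<le> V (\<phi> s)" if "s < t" for s t
  proof (rule lipschitz_nonincreasing_if_AE_deriv_nonpos[OF comp[OF L] N _ that])
    fix u assume "u \<notin> N"
    from der[OF this] obtain d where d: "((\<lambda>t. V (\<phi> t)) has_real_derivative d) (at u)" "ereal d \<le> gen_derivative \<U> F V (\<phi> u)" by blast
    then have "ereal d \<le> 0" using V1 order_trans by blast
    then show "\<exists>D\<le>0. ((\<lambda>t. V (\<phi> t)) has_real_derivative D) (at u)" using d(1) by auto
  qed
  have far: "\<rho> \<le> norm (\<phi> t)" if "t \<le> 0" for t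
  proof -
    have "V (\<phi> 0) \<le> V (\<phi> t)" using mono[of t 0] that by (cases "t = 0") auto
    then show ?thesis using \<rho>(2)[of "\<phi> t"] by linarith
  qed
  have grow: "V (\<phi> 0) + c * T \<le> V (\<phi> (- T))" if T: "0 < T" for T
  proof -
    have lip: "(L * C + \<bar>c\<bar>)-lipschitz_on UNIV (\<lambda>t. V (\<phi> t) + c * t)"
    proof (rule lipschitz_on_add[OF comp[OF L]])
      show "\<bar>c\<bar>-lipschitz_on UNIV ((*) c)"
        by (rule lipschitz_onI) (auto simp: dist_real_def abs_mult right_diff_distrib[symmetric])
    qed
    have "V (\<phi> 0) + c * 0 \<le> V (\<phi> (- T)) + c * (- T)"
    proof (rule lipschitz_nonincreasing_if_AE_deriv_nonpos[OF lip N])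
      fix u assume u: "u < 0" "u \<notin> N"
      from der[OF u(2)] obtain d where d: "((\<lambda>t. V (\<phi> t)) has_real_derivative d) (at u)" "ereal d \<le> gen_derivative \<U> F V (\<phi> u)" by blast
      have "\<rho> \<le> norm (\<phi> u)" using far u by simp
      moreover from this have "\<phi> u \<noteq> 0" using \<rho>(1) by auto
      ultimately have "ereal d \<le> ereal (- V0 (\<phi> u))" "c \<le> V0 (\<phi> u)"
        using d(2) dec V0c order_trans by blast+
      then have "d + c \<le> 0" by simp
      moreover have "((\<lambda>t. V (\<phi> t) + c * t) has_real_derivative d + c) (at u)"
        using d(1) by (auto intro!: derivative_eq_intros)
      ultimately show "\<exists>D\<le>0. ((\<lambda>t. V (\<phi> t) + c * t) has_real_derivative D) (at u)" by blast
    qed (use T in simp)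
    then show ?thesis by simp
  qed
  have "compact (V ` closure (range \<phi>))"
    using continuous_on_subset[OF Vc] Kc by (intro compact_continuous_image) auto
  then obtain B where B: "\<And>x. x \<in> closure (range \<phi>) \<Longrightarrow> \<bar>V x\<bar> \<le> B"
    by (metis bounded_iff compact_imp_bounded image_eqI real_norm_def)
  have B2: "V (\<phi> t) \<le> B" for t
  proof -
    have "\<phi> t \<in> closure (range \<phi>)" using closure_subset[of "range \<phi>"] by auto
    from B[OF this] show ?thesis by simp
  qed
  have "0 < (\<bar>B\<bar> + 1) / c" using c by (simp add: add_nonneg_pos)
  from grow[OF this] have "V (\<phi> 0) + \<bar>B\<bar> + 1 \<le> V (\<phi> (- ((\<bar>B\<bar> + 1) / c)))" using c by simp
  then show False using B2[of "- ((\<bar>B\<bar> + 1) / c)"] V0val by linarith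
qed

section \<open>Sums over time windows\<close>

lemma step_time_diff: "n \<le> k \<Longrightarrow> step_time a k - step_time a n = (\<Sum>i\<in>{n..<k}. a i)"
  unfolding step_time_def by (metis add_diff_cancel_left' atLeast0LessThan sum.atLeastLessThan_concat zero_le)

definition step_sequence :: "(nat \<Rightarrow> real) \<Rightarrow> bool" where
  "step_sequence a \<longleftrightarrow> (\<forall>n. 0 < a n) \<and> a \<longlonglongrightarrow> 0 \<and> \<not> summable a"

lemma step_time_strict_mono: "step_sequence a \<Longrightarrow> strict_mono (step_time a)"
  by (rule strict_monoI_Suc) (simp add: step_time_def step_sequence_def)

lemma step_time_at_top:
  assumes a: "step_sequence a"
  shows "filterlim (step_time a) at_top sequentially"
proof -
  have "\<exists>n. B < step_time a n" for B
  proof (rule ccontr)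
    assume "\<nexists>n. B < step_time a n"
    then have "summable a"
      using a unfolding step_time_def step_sequence_def
      by (intro summableI_nonneg_bounded[of a B]) (auto simp: not_less less_imp_le)
    then show False using a by (simp add: step_sequence_def)
  qed
  then show ?thesis
    unfolding filterlim_at_top eventually_sequentially
    by (meson less_imp_le order_trans step_time_strict_mono[OF a] strict_mono_less_eq)
qed

lemma step_index_bounds:
  assumes a: "step_sequence a" and s: "0 \<le> s"
  shows "step_time a (step_index a s) \<le> s" "s < step_time a (Suc (step_index a s))"
proof -
  let ?A = "{n. step_time a n \<le> s}"
  obtain N where "\<forall>n\<ge>N. s + 1 \<le> step_time a n"
    using step_time_at_top[OF a] unfolding filterlim_at_top eventually_sequentially by blast
  then have "?A \<subseteq> {..<N}" by (force simp: not_less[symmetric])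
  then have fin: "finite ?A" by (rule finite_subset) simp
  have "0 \<in> ?A" using s by (simp add: step_time_def)
  then have ne: "?A \<noteq> {}" by blast
  have eq: "step_index a s = Max ?A" using s by (simp add: step_index_def)
  show "step_time a (step_index a s) \<le> s" using Max_in[OF fin ne] by (simp add: eq)
  have "Suc (Max ?A) \<notin> ?A" using Max_ge[OF fin] by fastforce
  then show "s < step_time a (Suc (step_index a s))" by (simp add: eq)
qed

text \<open>
  The discrete time scale \<open>step_time\<close> and its inverse \<open>step_index\<close> form a Galois connection.
\<close>

lemma step_index_le_iff:
  assumes a: "step_sequence a" and s: "0 \<le> s"
  shows "n \<le> step_index a s \<longleftrightarrow> step_time a n \<le> s"
  using step_index_bounds[OF a s] step_time_strict_mono[OF a]
  by (metis not_less_eq_eq order.strict_trans2 order_trans linorder_not_le strict_mono_less_eq)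

lemma step_index_step_time:
  assumes a: "step_sequence a"
  shows "step_index a (step_time a n) = n"
proof -
  have "0 \<le> step_time a n"
    unfolding step_time_def using a by (intro sum_nonneg) (simp add: step_sequence_def less_imp_le)
  then show ?thesis
    using step_index_le_iff[OF a, of "step_time a n"] strict_mono_less_eq[OF step_time_strict_mono[OF a]]
    by (metis eq_iff)
qed

abbreviation step_sum :: "(nat \<Rightarrow> real) \<Rightarrow> (nat \<Rightarrow> 'v::real_normed_vector) \<Rightarrow> nat \<Rightarrow> nat \<Rightarrow> 'v" where
  "step_sum a e n k \<equiv> \<Sum>i\<in>{n..<k}. a i *\<^sub>R e i"

text \<open>
  The asymptotic rate of change being zero for a deterministic sequence, expressed by
  indices instead of times, and for windows of every length and position.
\<close>

definition vanishing :: "(nat \<Rightarrow> real) \<Rightarrow> (nat \<Rightarrow> 'v::real_normed_vector) \<Rightarrow> bool" where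
  "vanishing a e \<longleftrightarrow> (\<forall>T. \<forall>\<epsilon>>0. \<exists>N. \<forall>n\<ge>N. \<forall>k\<ge>n. step_time a k - step_time a n \<le> T \<longrightarrow>
     norm (step_sum a e n k) \<le> \<epsilon>)"

lemma vanishingD:
  assumes "vanishing a e" "\<epsilon> > 0"
  obtains N where "\<And>n k. N \<le> n \<Longrightarrow> n \<le> k \<Longrightarrow> step_time a k - step_time a n \<le> T \<Longrightarrow> norm (step_sum a e n k) \<le> \<epsilon>"
  using assms unfolding vanishing_def by metis

lemma vanishing_add:
  assumes e: "vanishing a e" and f: "vanishing a f"
  shows "vanishing a (\<lambda>i. e i + f i)"
  unfolding vanishing_def
proof (intro allI impI)
  fix T \<epsilon> :: real assume "0 < \<epsilon>"
  then have h: "0 < \<epsilon> / 2" by simp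
  obtain N1 where N1: "\<And>n k. N1 \<le> n \<Longrightarrow> n \<le> k \<Longrightarrow> step_time a k - step_time a n \<le> T \<Longrightarrow> norm (step_sum a e n k) \<le> \<epsilon> / 2"
    using vanishingD[OF e h] by blast
  obtain N2 where N2: "\<And>n k. N2 \<le> n \<Longrightarrow> n \<le> k \<Longrightarrow> step_time a k - step_time a n \<le> T \<Longrightarrow> norm (step_sum a f n k) \<le> \<epsilon> / 2"
    using vanishingD[OF f h] by blast
  show "\<exists>N. \<forall>n\<ge>N. \<forall>k\<ge>n. step_time a k - step_time a n \<le> T \<longrightarrow> norm (\<Sum>i\<in>{n..<k}. a i *\<^sub>R (e i + f i)) \<le> \<epsilon>"
  proof (intro exI[of _ "max N1 N2"] allI impI)
    fix n k assume "max N1 N2 \<le> n" "n \<le> k" "step_time a k - step_time a n \<le> T"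
    then have "norm (step_sum a e n k) \<le> \<epsilon> / 2" "norm (step_sum a f n k) \<le> \<epsilon> / 2"
      using N1[of n k] N2[of n k] by auto
    moreover have "norm (\<Sum>i\<in>{n..<k}. a i *\<^sub>R (e i + f i)) \<le> norm (step_sum a e n k) + norm (step_sum a f n k)"
      by (simp add: scaleR_add_right sum.distrib norm_triangle_ineq)
    ultimately show "norm (\<Sum>i\<in>{n..<k}. a i *\<^sub>R (e i + f i)) \<le> \<epsilon>" by linarith
  qed
qed

lemma vanishing_0: "vanishing a (\<lambda>_. 0)"
  by (auto simp: vanishing_def)

lemma vanishing_sum:
  assumes "finite D" "\<And>d. d \<in> D \<Longrightarrow> vanishing a (e d)"
  shows "vanishing a (\<lambda>i. \<Sum>d\<in>D. e d i)"
  using assms by (induction D) (auto intro: vanishing_0 vanishing_add)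

text \<open>
  A window of bounded length has bounded total weight, so an additional constant \<open>\<delta>\<close> in the bound
  contributes a small multiple of that length.
\<close>

lemma vanishing_dominated:
  fixes e :: "nat \<Rightarrow> 'v::real_normed_vector"
  assumes a: "step_sequence a"
    and dom: "\<And>\<delta>. \<delta> > 0 \<Longrightarrow> \<exists>c::nat \<Rightarrow> real. vanishing a c \<and> (\<forall>\<^sub>F i in sequentially. norm (e i) \<le> c i + \<delta>)"
  shows "vanishing a e"
  unfolding vanishing_def
proof (intro allI impI)
  fix T \<epsilon> :: real assume \<epsilon>: "0 < \<epsilon>"
  define \<delta> where "\<delta> = \<epsilon> / (2 * (\<bar>T\<bar> + 1))"
  have \<delta>: "0 < \<delta>" "\<delta> * \<bar>T\<bar> \<le> \<epsilon> / 2"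
    using \<epsilon> by (auto simp: \<delta>_def field_simps)
  obtain c where c: "vanishing a c" "\<forall>\<^sub>F i in sequentially. norm (e i) \<le> c i + \<delta>"
    using dom[OF \<delta>(1)] by blast
  obtain N1 where N1: "\<And>i. i \<ge> N1 \<Longrightarrow> norm (e i) \<le> c i + \<delta>"
    using c(2) by (auto simp: eventually_sequentially)
  have h: "0 < \<epsilon> / 2" using \<epsilon> by simp
  obtain N2 where N2: "\<And>n k. N2 \<le> n \<Longrightarrow> n \<le> k \<Longrightarrow> step_time a k - step_time a n \<le> T \<Longrightarrow> norm (step_sum a c n k) \<le> \<epsilon> / 2"
    using vanishingD[OF c(1) h] by blast
  show "\<exists>N. \<forall>n\<ge>N. \<forall>k\<ge>n. step_time a k - step_time a n \<le> T \<longrightarrow> norm (step_sum a e n k) \<le> \<epsilon>"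
  proof (intro exI[of _ "max N1 N2"] allI impI)
    fix n k assume n: "max N1 N2 \<le> n" "n \<le> k" "step_time a k - step_time a n \<le> T"
    have "norm (step_sum a e n k) \<le> (\<Sum>i\<in>{n..<k}. a i * (c i + \<delta>))"
      using n N1 a by (intro sum_norm_le) (auto simp: step_sequence_def less_imp_le intro!: mult_left_mono)
    also have "\<dots> = (step_sum a c n k) + \<delta> * (step_time a k - step_time a n)"
      using n by (simp add: step_time_diff distrib_left sum.distrib sum_distrib_left mult.commute)
    also have "\<dots> \<le> \<epsilon> / 2 + \<delta> * \<bar>T\<bar>"
    proof (rule add_mono)
      show "(step_sum a c n k) \<le> \<epsilon> / 2" using N2[of n k] n by (auto simp: abs_le_iff)
      show "\<delta> * (step_time a k - step_time a n) \<le> \<delta> * \<bar>T\<bar>" using n \<delta>(1) by (intro mult_left_mono) auto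
    qed
    finally show "norm (step_sum a e n k) \<le> \<epsilon>" using \<delta>(2) by linarith
  qed
qed

lemma vanishing_tendsto_0:
  assumes a: "step_sequence a" and e: "(\<lambda>i. norm (e i)) \<longlonglongrightarrow> 0"
  shows "vanishing a e"
proof (rule vanishing_dominated[OF a])
  fix \<delta> :: real assume "\<delta> > 0"
  then show "\<exists>c::nat \<Rightarrow> real. vanishing a c \<and> (\<forall>\<^sub>F i in sequentially. norm (e i) \<le> c i + \<delta>)"
    using order_tendstoD(2)[OF e, of \<delta>]
    by (intro exI[of _ "\<lambda>_. 0"] conjI vanishing_0) (auto elim!: eventually_mono)
qed

text \<open>
  A long window is cut greedily into pieces of length at most \<open>\<Delta>\<close>. As the steps are at most
  \<open>\<Delta> / 2\<close>, every piece but the last has length at least \<open>\<Delta> / 2\<close>, which bounds the number of pieces and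
  hence the number of times that \<open>\<gamma>\<close> is paid.
\<close>

lemma window_chop:
  fixes e :: "nat \<Rightarrow> 'v::real_normed_vector"
  assumes a: "step_sequence a" and \<gamma>: "0 \<le> \<gamma>" and \<Delta>: "0 < \<Delta>"
    and small: "\<And>i. N \<le> i \<Longrightarrow> a i \<le> \<Delta> / 2"
    and short: "\<And>n k. N \<le> n \<Longrightarrow> n \<le> k \<Longrightarrow> step_time a k - step_time a n \<le> \<Delta> \<Longrightarrow>
      norm (step_sum a e n k) \<le> c * (step_time a k - step_time a n) + \<gamma>"
    and nk: "N \<le> n" "n \<le> k"
  shows "norm (step_sum a e n k)
    \<le> c * (step_time a k - step_time a n) + \<gamma> * (2 * (step_time a k - step_time a n) / \<Delta> + 1)"
  using nk
proof (induction "k - n" arbitrary: n rule: less_induct)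
  case less
  let ?\<tau> = "step_time a"
  have mono: "?\<tau> i \<le> ?\<tau> j \<longleftrightarrow> i \<le> j" for i j
    using strict_mono_less_eq[OF step_time_strict_mono[OF a]] .
  show ?case
  proof (cases "?\<tau> k - ?\<tau> n \<le> \<Delta>")
    case True
    have "0 \<le> 2 * (?\<tau> k - ?\<tau> n) / \<Delta>" using less.prems mono \<Delta> by simp
    then have "\<gamma> \<le> \<gamma> * (2 * (?\<tau> k - ?\<tau> n) / \<Delta> + 1)"
      using mult_left_mono[of 1 "2 * (?\<tau> k - ?\<tau> n) / \<Delta> + 1" \<gamma>] \<gamma> by simp
    then show ?thesis using short[OF less.prems True] by linarith
  next
    case False
    \<comment> \<open>the first piece ends at the last index \<open>l\<close> within distance \<open>\<Delta>\<close> of \<open>n\<close>\<close>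
    define A where "A = {j. n \<le> j \<and> j \<le> k \<and> ?\<tau> j - ?\<tau> n \<le> \<Delta>}"
    have A: "finite A" "n \<in> A" using less.prems \<Delta> by (auto simp: A_def)
    define l where "l = Max A"
    have "l \<in> A" unfolding l_def using A by (intro Max_in) auto
    then have l: "n \<le> l" "l \<le> k" "?\<tau> l - ?\<tau> n \<le> \<Delta>" by (auto simp: A_def)
    have "l \<noteq> k" using l(3) False by auto
    have "Suc l \<notin> A" using Max_ge[OF A(1), of "Suc l"] by (auto simp: l_def)
    then have "\<Delta> < ?\<tau> (Suc l) - ?\<tau> n" using l \<open>l \<noteq> k\<close> by (auto simp: A_def)
    moreover have "?\<tau> (Suc l) = ?\<tau> l + a l" by (simp add: step_time_def)
    moreover have "a l \<le> \<Delta> / 2" using small l less.prems by simp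
    ultimately have half: "\<Delta> / 2 \<le> ?\<tau> l - ?\<tau> n" by simp
    then have "l \<noteq> n" using \<Delta> by auto
    have IH: "norm (step_sum a e l k) \<le> c * (?\<tau> k - ?\<tau> l) + \<gamma> * (2 * (?\<tau> k - ?\<tau> l) / \<Delta> + 1)"
      using less.prems l \<open>l \<noteq> n\<close> by (intro less.hyps) auto
    have S1: "norm (step_sum a e n l) \<le> c * (?\<tau> l - ?\<tau> n) + \<gamma>"
      using less.prems l by (intro short)
    have "1 \<le> 2 * (?\<tau> l - ?\<tau> n) / \<Delta>" using half \<Delta> by (simp add: field_simps)
    then have S2: "\<gamma> \<le> \<gamma> * (2 * (?\<tau> l - ?\<tau> n) / \<Delta>)"
      using mult_left_mono[of 1 "2 * (?\<tau> l - ?\<tau> n) / \<Delta>" \<gamma>] \<gamma> by simp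
    have "(step_sum a e n k) = (step_sum a e n l) + (step_sum a e l k)"
      using l by (simp add: sum.atLeastLessThan_concat)
    then have "norm (step_sum a e n k) \<le> norm (step_sum a e n l) + norm (step_sum a e l k)"
      by (simp add: norm_triangle_ineq)
    also have "\<dots> \<le> (c * (?\<tau> l - ?\<tau> n) + \<gamma> * (2 * (?\<tau> l - ?\<tau> n) / \<Delta>)) + (c * (?\<tau> k - ?\<tau> l) + \<gamma> * (2 * (?\<tau> k - ?\<tau> l) / \<Delta> + 1))"
      using IH S1 S2 by linarith
    also have "\<dots> = c * (?\<tau> k - ?\<tau> n) + \<gamma> * (2 * (?\<tau> k - ?\<tau> n) / \<Delta> + 1)"
      using \<Delta> by (simp add: field_simps)
    finally show ?thesis .
  qed
qed

text \<open>
  The hypothesis concerns windows that start at a multiple of \<open>T\<close> and are no longer than \<open>T\<close>. Any window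
  of length at most \<open>U\<close> is obtained from boundedly many of them: partial sums are compared with the
  partial sums \<open>p j\<close> at the grid points, and neighbouring grid points with each other.
\<close>

lemma vanishing_if_window_sums:
  fixes e :: "nat \<Rightarrow> 'v::real_normed_vector"
  assumes a: "step_sequence a" and T: "0 < T"
    and w: "\<And>\<epsilon>. \<epsilon> > 0 \<Longrightarrow> \<exists>J. \<forall>j\<ge>J. \<forall>t\<in>{0..T}. norm (window_sum a T j t e) \<le> \<epsilon>"
  shows "vanishing a e"
  unfolding vanishing_def
proof (intro allI impI)
  fix U \<epsilon> :: real assume \<epsilon>: "0 < \<epsilon>"
  let ?\<tau> = "step_time a"
  have mono: "?\<tau> i \<le> ?\<tau> j \<longleftrightarrow> i \<le> j" for i j
    using strict_mono_less_eq[OF step_time_strict_mono[OF a]] .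
  define S where "S n = (\<Sum>i<n. a i *\<^sub>R e i)" for n
  define p where "p j = S (step_index a (real j * T))" for j
  \<comment> \<open>the endpoints of a window of length at most \<open>U\<close> lie in grid cells at most \<open>K\<close> apart\<close>
  define K where "K = \<bar>U\<bar> / T + 1"
  have K: "1 \<le> K" using T by (simp add: K_def)
  define \<gamma> where "\<gamma> = \<epsilon> / (K + 2)"
  have \<gamma>: "0 < \<gamma>" "\<gamma> * (K + 2) = \<epsilon>" using \<epsilon> K by (auto simp: \<gamma>_def)
  obtain J where J: "\<And>j t. J \<le> j \<Longrightarrow> 0 \<le> t \<Longrightarrow> t \<le> T \<Longrightarrow> norm (window_sum a T j t e) \<le> \<gamma>"
    using w[OF \<gamma>(1)] by (metis atLeastAtMost_iff)
  have Sdiff: "(step_sum a e n k) = S k - S n" if "n \<le> k" for n k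
    using sum.atLeastLessThan_concat[of 0 n k "\<lambda>i. a i *\<^sub>R e i"] that
    by (simp add: S_def atLeast0LessThan) (metis add_diff_cancel_left')
  have imono: "step_index a s \<le> step_index a t" if "0 \<le> s" "s \<le> t" for s t
    using step_index_le_iff[OF a, of t "step_index a s"] step_index_bounds(1)[OF a that(1)] that by simp
  have win: "window_sum a T j t e = S (step_index a (real j * T + t)) - p j" if "0 \<le> t" for j t
    unfolding window_sum_def p_def using T that by (intro Sdiff imono) auto
  have stepj: "norm (p (Suc j) - p j) \<le> \<gamma>" if "J \<le> j" for j
    using J[OF that, of T] win[of T j] T by (simp add: p_def distrib_right add.commute)
  have chain: "norm (p (j + d) - p j) \<le> real d * \<gamma>" if "J \<le> j" for j d
  proof (induction d)
    case (Suc d)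
    have "norm (p (j + Suc d) - p j) \<le> norm (p (Suc (j + d)) - p (j + d)) + norm (p (j + d) - p j)"
      using norm_triangle_ineq[of "p (Suc (j + d)) - p (j + d)" "p (j + d) - p j"] by simp
    then show ?case using Suc stepj[of "j + d"] that by (simp add: distrib_right)
  qed simp
  \<comment> \<open>the grid cell that contains the time of step \<open>n\<close>\<close>
  define idx where "idx n = nat \<lfloor>?\<tau> n / T\<rfloor>" for n
  have \<tau>0: "0 \<le> ?\<tau> n" for n using mono[of 0 n] by (simp add: step_time_def)
  have idx: "real (idx n) * T \<le> ?\<tau> n" "?\<tau> n < real (idx n) * T + T" for n
  proof -
    have "real (idx n) = of_int \<lfloor>?\<tau> n / T\<rfloor>" using \<tau>0 T by (simp add: idx_def)
    then have "real (idx n) \<le> ?\<tau> n / T" "?\<tau> n / T < real (idx n) + 1" by linarith+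
    then show "real (idx n) * T \<le> ?\<tau> n" "?\<tau> n < real (idx n) * T + T" using T by (auto simp: field_simps)
  qed
  have near: "norm (S n - p (idx n)) \<le> \<gamma>" if "J \<le> idx n" for n
  proof -
    have "window_sum a T (idx n) (?\<tau> n - real (idx n) * T) e = S n - p (idx n)"
      using idx[of n] by (subst win) (auto simp: step_index_step_time[OF a])
    then show ?thesis using J[OF that, of "?\<tau> n - real (idx n) * T"] idx[of n] by simp
  qed
  obtain N where N: "\<forall>n\<ge>N. real (Suc J) * T \<le> ?\<tau> n"
    using step_time_at_top[OF a] unfolding filterlim_at_top eventually_sequentially by blast
  have idxJ: "J \<le> idx n" if "N \<le> n" for n
  proof -
    have "real (Suc J) * T < (real (idx n) + 1) * T" using N that idx(2)[of n] by (force simp: distrib_right)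
    then have "real (Suc J) < real (idx n) + 1" using T by (simp add: mult_less_cancel_right)
    then show ?thesis by linarith
  qed
  show "\<exists>N. \<forall>n\<ge>N. \<forall>k\<ge>n. ?\<tau> k - ?\<tau> n \<le> U \<longrightarrow> norm (step_sum a e n k) \<le> \<epsilon>"
  proof (intro exI[of _ N] allI impI)
    fix n k assume nk: "N \<le> n" "n \<le> k" "?\<tau> k - ?\<tau> n \<le> U"
    have le: "idx n \<le> idx k"
    proof -
      have "?\<tau> n / T \<le> ?\<tau> k / T" using nk(2) mono T by (simp add: divide_right_mono)
      then show ?thesis unfolding idx_def by (intro nat_mono floor_mono)
    qed
    define d where "d = idx k - idx n"
    have d: "idx k = idx n + d" using le by (simp add: d_def)
    have "real d * T < U + T"
      using idx[of k] idx[of n] nk(3) unfolding d by (simp add: distrib_right)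
    also have "\<dots> \<le> K * T" using T by (simp add: K_def field_simps)
    finally have dK: "real d \<le> K" using T by simp
    have "S k - S n = (S k - p (idx k)) + (p (idx n + d) - p (idx n)) - (S n - p (idx n))"
      by (simp add: d)
    then have "norm (S k - S n) \<le> norm (S k - p (idx k)) + norm (p (idx n + d) - p (idx n)) + norm (S n - p (idx n))"
      using norm_triangle_ineq4[of "(S k - p (idx k)) + (p (idx n + d) - p (idx n))" "S n - p (idx n)"]
        norm_triangle_ineq[of "S k - p (idx k)" "p (idx n + d) - p (idx n)"] by simp
    also have "\<dots> \<le> \<gamma> + real d * \<gamma> + \<gamma>"
      using near[of k] near[of n] chain[of "idx n" d] idxJ[of n] idxJ[of k] nk by (intro add_mono) auto
    also have "\<dots> \<le> \<gamma> + K * \<gamma> + \<gamma>" using dK \<gamma>(1) by (intro add_mono mult_right_mono) auto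
    also have "\<dots> = \<epsilon>" using \<gamma>(2) by (simp add: algebra_simps)
    finally show "norm (step_sum a e n k) \<le> \<epsilon>" using Sdiff[OF nk(2)] by simp
  qed
qed

lemma norm_add3: "norm (u + v + w) \<le> norm u + norm v + norm (w :: 'v::real_normed_vector)"
  using norm_triangle_ineq[of "u + v" w] norm_triangle_ineq[of u v] by simp

lemma sum_step_norm_le:
  fixes f :: "nat \<Rightarrow> 'v::real_normed_vector"
  assumes a: "step_sequence a" and nk: "n \<le> k"
    and f: "\<And>i. n \<le> i \<Longrightarrow> i < k \<Longrightarrow> norm (f i) \<le> C"
  shows "norm (step_sum a f n k) \<le> C * (step_time a k - step_time a n)"
proof -
  have "norm (step_sum a f n k) \<le> (\<Sum>i\<in>{n..<k}. a i * C)"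
    using f a by (intro sum_norm_le) (auto simp: step_sequence_def less_imp_le intro!: mult_left_mono)
  also have "\<dots> = C * (step_time a k - step_time a n)"
    using nk by (simp add: step_time_diff sum_distrib_left mult.commute)
  finally show ?thesis .
qed

lemma increments_sum:
  fixes x :: "nat \<Rightarrow> 'v::real_normed_vector"
  assumes "\<And>n. x (Suc n) - x n = a n *\<^sub>R g n" "n \<le> k"
  shows "x k - x n = (step_sum a g n k)"
  using assms(2) by (induction k rule: dec_induct) (use assms(1) in \<open>auto simp: algebra_simps\<close>)

text \<open>
  The point of this lemma is that \<open>h\<close> is averaged along moving states although the hypothesis only averages
  it at frozen ones. On a window of short length \<open>\<Delta>\<close> the state is frozen at a nearby point \<open>d\<close> from a
  finite net. That the state stays near \<open>d\<close> is shown by induction over the window: as long as it does,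
  \<open>H (x i) i\<close> is within \<open>\<epsilon>1\<close> of \<open>H d i\<close>, whose sum is that of \<open>hbar d\<close> up to \<open>\<gamma>\<close>, so that the state
  has moved by at most \<open>K \<Delta> + 2 \<gamma> < \<delta> / 2\<close>.
\<close>

lemma vanishing_averaging_error:
  fixes x :: "nat \<Rightarrow> 'a::euclidean_space" and H :: "'a \<Rightarrow> nat \<Rightarrow> 'a"
  assumes a: "step_sequence a" and x: "\<And>n. norm (x n) \<le> R"
    and step: "\<And>n. x (Suc n) - x n = a n *\<^sub>R (w n + H (x n) n + e n)"
    and w: "\<And>n. norm (w n) \<le> C" and e: "vanishing a e"
    and H: "\<And>\<epsilon>. \<epsilon> > 0 \<Longrightarrow> \<exists>\<delta>>0. \<forall>y\<in>cball 0 (R + 1). \<forall>z\<in>cball 0 (R + 1). dist y z < \<delta> \<longrightarrow> (\<forall>i. dist (H y i) (H z i) < \<epsilon>)"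
    and hbar: "continuous_on UNIV hbar"
    and D: "closure D = UNIV" "\<And>d. d \<in> D \<Longrightarrow> vanishing a (\<lambda>i. H d i - hbar d)"
  shows "vanishing a (\<lambda>i. H (x i) i - hbar (x i))"
  unfolding vanishing_def
proof (intro allI impI)
  fix T \<epsilon> :: real assume \<epsilon>: "0 < \<epsilon>"
  let ?\<tau> = "step_time a" and ?B = "cball (0::'a) (R + 1)"
  have mono: "?\<tau> i \<le> ?\<tau> j \<longleftrightarrow> i \<le> j" for i j
    using strict_mono_less_eq[OF step_time_strict_mono[OF a]] .
  have hc: "continuous_on ?B hbar" using hbar by (rule continuous_on_subset) simp
  obtain Kb where Kb: "\<And>y. y \<in> ?B \<Longrightarrow> norm (hbar y) \<le> Kb"
    using compact_imp_bounded[OF compact_continuous_image[OF hc compact_cball]] unfolding bounded_iff by (metis image_eqI)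
  have R0: "0 \<le> R" using x[of 0] norm_ge_zero order_trans by blast
  have Kb0: "0 \<le> Kb" using order_trans[OF norm_ge_zero Kb[of 0]] R0 by simp
  have C0: "0 \<le> C" using w[of 0] norm_ge_zero order_trans by blast
  \<comment> \<open>a bound on the speed: \<open>w\<close> contributes \<open>C\<close>, \<open>hbar d\<close> contributes \<open>Kb\<close> and freezing at most \<open>\<epsilon>1 \<le> 1\<close>\<close>
  define K where "K = C + Kb + 1"
  have K: "0 < K" using Kb0 C0 by (simp add: K_def)
  define \<epsilon>1 where "\<epsilon>1 = min 1 (\<epsilon> / (4 * (\<bar>T\<bar> + 1)))"
  have \<epsilon>1: "0 < \<epsilon>1" "\<epsilon>1 \<le> 1" "2 * \<epsilon>1 * \<bar>T\<bar> \<le> \<epsilon> / 2"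
  proof -
    show "0 < \<epsilon>1" "\<epsilon>1 \<le> 1" using \<epsilon> by (auto simp: \<epsilon>1_def)
    have "2 * \<epsilon>1 * \<bar>T\<bar> \<le> 2 * (\<epsilon> / (4 * (\<bar>T\<bar> + 1))) * \<bar>T\<bar>"
      by (intro mult_right_mono mult_left_mono) (auto simp: \<epsilon>1_def)
    also have "\<dots> \<le> \<epsilon> / 2" using \<epsilon> by (simp add: field_simps)
    finally show "2 * \<epsilon>1 * \<bar>T\<bar> \<le> \<epsilon> / 2" .
  qed
  obtain \<delta>1 where \<delta>1: "\<delta>1 > 0" "\<And>y z i. y \<in> ?B \<Longrightarrow> z \<in> ?B \<Longrightarrow> dist y z < \<delta>1 \<Longrightarrow> dist (H y i) (H z i) < \<epsilon>1"
    using H[OF \<epsilon>1(1)] by blast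
  have "uniformly_continuous_on ?B hbar" using hc compact_cball by (rule compact_uniformly_continuous)
  then obtain \<delta>2 where \<delta>2: "\<delta>2 > 0" "\<And>y z. y \<in> ?B \<Longrightarrow> z \<in> ?B \<Longrightarrow> dist y z < \<delta>2 \<Longrightarrow> dist (hbar y) (hbar z) < \<epsilon>1"
    using \<epsilon>1(1) unfolding uniformly_continuous_on_def by metis
  define \<delta> where "\<delta> = min (min \<delta>1 \<delta>2) 1"
  have \<delta>: "0 < \<delta>" "\<delta> \<le> \<delta>1" "\<delta> \<le> \<delta>2" "\<delta> \<le> 1" using \<delta>1(1) \<delta>2(1) by (auto simp: \<delta>_def)
  define \<Delta> where "\<Delta> = \<delta> / (8 * K)"
  have \<Delta>: "0 < \<Delta>" "K * \<Delta> = \<delta> / 8" using \<delta>(1) K by (auto simp: \<Delta>_def)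
  have den: "0 < 2 * \<bar>T\<bar> / \<Delta> + 1" using \<Delta>(1) by (simp add: add_nonneg_pos)
  \<comment> \<open>small against \<open>\<delta>\<close> to keep the state near \<open>d\<close>, and against the number of pieces of length \<open>\<Delta>\<close>
    in a window of length \<open>T\<close>\<close>
  define \<gamma> where "\<gamma> = min (\<delta> / 8) (\<epsilon> / (2 * (2 * \<bar>T\<bar> / \<Delta> + 1)))"
  have \<gamma>: "0 < \<gamma>" "\<gamma> \<le> \<delta> / 8" unfolding \<gamma>_def using \<delta>(1) \<epsilon> den by (simp, intro min.cobounded1)
  have \<gamma>T: "\<gamma> * (2 * \<bar>T\<bar> / \<Delta> + 1) \<le> \<epsilon> / 2"
  proof -
    have "\<gamma> * (2 * \<bar>T\<bar> / \<Delta> + 1) \<le> \<epsilon> / (2 * (2 * \<bar>T\<bar> / \<Delta> + 1)) * (2 * \<bar>T\<bar> / \<Delta> + 1)"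
      using den by (intro mult_right_mono) (auto simp: \<gamma>_def)
    also have "\<dots> = \<epsilon> / 2" using den by (metis nonzero_divide_mult_cancel_right divide_divide_eq_left less_irrefl mult.commute times_divide_eq_left nonzero_mult_div_cancel_right)
    finally show ?thesis .
  qed
  have "cball 0 R \<subseteq> (\<Union>d\<in>D \<inter> ?B. ball d (\<delta> / 2))"
  proof
    fix y :: 'a assume y: "y \<in> cball 0 R"
    have "y \<in> closure D" using D(1) by simp
    then obtain d where d: "d \<in> D" "dist d y < \<delta> / 2" using \<delta>(1) by (metis closure_approachable half_gt_zero)
    have "norm d \<le> norm y + dist d y" by (metis dist_norm norm_triangle_sub)
    then have "d \<in> ?B" using d y \<delta> by auto
    then show "y \<in> (\<Union>d\<in>D \<inter> ?B. ball d (\<delta> / 2))" using d by auto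
  qed
  then obtain D0 where D0: "D0 \<subseteq> D \<inter> ?B" "finite D0" "cball 0 R \<subseteq> (\<Union>d\<in>D0. ball d (\<delta> / 2))"
    using compactE_image[OF compact_cball, of "D \<inter> ?B" "\<lambda>d. ball d (\<delta> / 2)" 0 R] by (metis open_ball)
  let ?P = "\<lambda>e n. \<forall>k\<ge>n. ?\<tau> k - ?\<tau> n \<le> \<Delta> \<longrightarrow> norm (step_sum a e n k) \<le> \<gamma>"
  have evP: "eventually (?P u) sequentially" if "vanishing a u" for u :: "nat \<Rightarrow> 'a"
    using that \<gamma>(1) unfolding vanishing_def eventually_sequentially by blast
  have "\<forall>\<^sub>F n in sequentially. \<forall>d\<in>D0. ?P (\<lambda>i. H d i - hbar d) n"
    using D0(1) D(2) by (intro eventually_ball_finite[OF D0(2)] ballI evP) blast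
  moreover have "\<forall>\<^sub>F n in sequentially. a n < \<Delta> / 2"
    using a \<Delta>(1) by (intro order_tendstoD(2)[of a 0]) (auto simp: step_sequence_def)
  ultimately have "\<forall>\<^sub>F n in sequentially. (\<forall>d\<in>D0. ?P (\<lambda>i. H d i - hbar d) n) \<and> ?P e n \<and> a n < \<Delta> / 2"
    using evP[OF e] by (intro eventually_conj)
  then obtain N where N: "\<And>n. N \<le> n \<Longrightarrow> (\<forall>d\<in>D0. ?P (\<lambda>i. H d i - hbar d) n) \<and> ?P e n \<and> a n < \<Delta> / 2"
    unfolding eventually_sequentially by blast
  have
    N1: "\<And>d n k. d \<in> D0 \<Longrightarrow> N \<le> n \<Longrightarrow> n \<le> k \<Longrightarrow> ?\<tau> k - ?\<tau> n \<le> \<Delta> \<Longrightarrow> norm (\<Sum>i\<in>{n..<k}. a i *\<^sub>R (H d i - hbar d)) \<le> \<gamma>" and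
    N2: "\<And>n k. N \<le> n \<Longrightarrow> n \<le> k \<Longrightarrow> ?\<tau> k - ?\<tau> n \<le> \<Delta> \<Longrightarrow> norm (step_sum a e n k) \<le> \<gamma>" and
    N3: "\<And>n. N \<le> n \<Longrightarrow> a n < \<Delta> / 2"
    using N by blast+
  have short: "norm (step_sum a (\<lambda>i. H (x i) i - hbar (x i)) n k) \<le> 2 * \<epsilon>1 * (?\<tau> k - ?\<tau> n) + \<gamma>"
    if nk: "N \<le> n" "n \<le> k" "?\<tau> k - ?\<tau> n \<le> \<Delta>" for n k
  proof -
    have xB: "x i \<in> ?B" for i using x[of i] by simp
    have "x n \<in> cball 0 R" using x by simp
    then obtain d where d: "d \<in> D0" "dist d (x n) < \<delta> / 2" using D0(3) by auto
    have dB: "d \<in> ?B" using d(1) D0(1) by blast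
    have close: "norm (H (x i) i - H d i) \<le> \<epsilon>1 \<and> norm (hbar d - hbar (x i)) \<le> \<epsilon>1" if "dist (x i) (x n) < \<delta> / 2" for i
    proof -
      have "dist d (x i) < \<delta>" using d(2) that dist_triangle_half_l[of d "x n" \<delta> "x i"] by simp
      then show ?thesis
        using \<delta>1(2)[OF xB dB, of i i] \<delta>2(2)[OF dB xB, of i] \<delta> by (simp add: dist_norm norm_minus_commute)
    qed
    have near: "dist (x j) (x n) < \<delta> / 2" if "n \<le> j" "?\<tau> j - ?\<tau> n \<le> \<Delta>" for j
      using that
    proof (induction j rule: less_induct)
      case (less j)
      have IH: "dist (x i) (x n) < \<delta> / 2" if "n \<le> i" "i < j" for i
        using less.IH[OF that(2,1)] less.prems mono[of i j] that by simp
      let ?W = "\<Sum>i\<in>{n..<j}. a i *\<^sub>R (w i + (H (x i) i - H d i) + hbar d)"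
      have "x j - x n = (\<Sum>i\<in>{n..<j}. a i *\<^sub>R (w i + H (x i) i + e i))"
        using step less.prems(1) by (rule increments_sum)
      also have "\<dots> = ?W + (\<Sum>i\<in>{n..<j}. a i *\<^sub>R (H d i - hbar d)) + (step_sum a e n j)"
        by (simp add: sum.distrib[symmetric] scaleR_add_right[symmetric])
      finally have "norm (x j - x n) \<le> norm ?W + norm (\<Sum>i\<in>{n..<j}. a i *\<^sub>R (H d i - hbar d)) + norm (step_sum a e n j)"
        by (simp only: norm_add3)
      also have "\<dots> \<le> K * (?\<tau> j - ?\<tau> n) + \<gamma> + \<gamma>"
      proof (intro add_mono N1[OF d(1)] N2 sum_step_norm_le[OF a less.prems(1)])
        fix i assume i: "n \<le> i" "i < j"
        have "norm (w i + (H (x i) i - H d i) + hbar d) \<le> norm (w i) + norm (H (x i) i - H d i) + norm (hbar d)"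
          by (rule norm_add3)
        also have "\<dots> \<le> C + \<epsilon>1 + Kb" using w[of i] close[OF IH[OF i]] Kb[OF dB] by linarith
        finally show "norm (w i + (H (x i) i - H d i) + hbar d) \<le> K" using \<epsilon>1(2) by (simp add: K_def)
      qed (use nk less.prems in auto)
      also have "\<dots> \<le> K * \<Delta> + \<gamma> + \<gamma>" using less.prems K by simp
      also have "\<dots> < \<delta> / 2" using \<Delta>(2) \<gamma>(2) \<delta>(1) by linarith
      finally show ?case by (simp add: dist_norm)
    qed
    have "(step_sum a (\<lambda>i. H (x i) i - hbar (x i)) n k) =
        (\<Sum>i\<in>{n..<k}. a i *\<^sub>R ((H (x i) i - H d i) + (hbar d - hbar (x i)))) + (\<Sum>i\<in>{n..<k}. a i *\<^sub>R (H d i - hbar d))"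
      by (simp add: sum.distrib[symmetric] scaleR_add_right[symmetric])
    then have "norm (step_sum a (\<lambda>i. H (x i) i - hbar (x i)) n k) \<le>
        norm (\<Sum>i\<in>{n..<k}. a i *\<^sub>R ((H (x i) i - H d i) + (hbar d - hbar (x i)))) + norm (\<Sum>i\<in>{n..<k}. a i *\<^sub>R (H d i - hbar d))"
      by (simp only: norm_triangle_ineq)
    also have "\<dots> \<le> 2 * \<epsilon>1 * (?\<tau> k - ?\<tau> n) + \<gamma>"
    proof (intro add_mono N1[OF d(1)] sum_step_norm_le[OF a nk(2)])
      fix i assume i: "n \<le> i" "i < k"
      have "?\<tau> i - ?\<tau> n \<le> \<Delta>" using nk(3) i mono[of i k] by simp
      from close[OF near[OF i(1) this]]
      show "norm ((H (x i) i - H d i) + (hbar d - hbar (x i))) \<le> 2 * \<epsilon>1"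
        using norm_triangle_ineq[of "H (x i) i - H d i" "hbar d - hbar (x i)"] by linarith
    qed (use nk in auto)
    finally show ?thesis .
  qed
  show "\<exists>N. \<forall>n\<ge>N. \<forall>k\<ge>n. ?\<tau> k - ?\<tau> n \<le> T \<longrightarrow> norm (step_sum a (\<lambda>i. H (x i) i - hbar (x i)) n k) \<le> \<epsilon>"
  proof (intro exI[of _ N] allI impI)
    fix n k assume nk: "N \<le> n" "n \<le> k" "?\<tau> k - ?\<tau> n \<le> T"
    have "norm (step_sum a (\<lambda>i. H (x i) i - hbar (x i)) n k)
        \<le> 2 * \<epsilon>1 * (?\<tau> k - ?\<tau> n) + \<gamma> * (2 * (?\<tau> k - ?\<tau> n) / \<Delta> + 1)"
      using window_chop[OF a less_imp_le[OF \<gamma>(1)] \<Delta>(1) less_imp_le[OF N3] short nk(1,2)] .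
    also have "\<dots> \<le> 2 * \<epsilon>1 * \<bar>T\<bar> + \<gamma> * (2 * \<bar>T\<bar> / \<Delta> + 1)"
      using nk(3) \<epsilon>1(1) \<gamma>(1) \<Delta>(1)
      by (intro add_mono mult_left_mono divide_right_mono) auto
    finally show "norm (step_sum a (\<lambda>i. H (x i) i - hbar (x i)) n k) \<le> \<epsilon>" using \<epsilon>1(3) \<gamma>T by linarith
  qed
qed

section \<open>Limits of the iterates on the time scale\<close>

lemma frequently_conj_eventually:
  assumes "\<exists>\<^sub>F x in F. P x" "\<forall>\<^sub>F x in F. Q x"
  shows "\<exists>\<^sub>F x in F. P x \<and> Q x"
  using assms(1)
proof (rule contrapos_pp)
  assume "\<not> (\<exists>\<^sub>F x in F. P x \<and> Q x)"
  then have "\<forall>\<^sub>F x in F. \<not> (P x \<and> Q x)" by (simp only: not_frequently)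
  with assms(2) have "\<forall>\<^sub>F x in F. \<not> P x" by eventually_elim blast
  then show "\<not> (\<exists>\<^sub>F x in F. P x)" by (simp only: not_frequently not_not)
qed

text \<open>
  By Tychonoff's theorem the functions \<open>f k\<close> have a cluster point in the topology of pointwise
  convergence. Two evaluation points at a time are all that is needed to read off a Lipschitz
  constant and difference quotients of the limit.
\<close>

lemma pointwise_cluster_point:
  fixes f :: "nat \<Rightarrow> 'i \<Rightarrow> 'b::metric_space"
  assumes K: "compact K" and f: "\<And>k t. f k t \<in> K"
  obtains \<phi> where "\<And>t. \<phi> t \<in> K"
    and "\<And>s t \<epsilon>. \<epsilon> > 0 \<Longrightarrow> \<exists>\<^sub>F k in sequentially. dist (f k s) (\<phi> s) < \<epsilon> \<and> dist (f k t) (\<phi> t) < \<epsilon>"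
proof -
  let ?P = "PiE UNIV (\<lambda>_. K) :: ('i \<Rightarrow> 'b) set"
  have "compactin (product_topology (\<lambda>_. euclidean) UNIV) ?P"
    using K by (simp add: compactin_PiE)
  then have cp: "compact ?P" by (simp add: euclidean_product_topology)
  have "\<forall>\<^sub>F g in filtermap f sequentially. g \<in> ?P"
    using f by (auto simp: eventually_filtermap PiE_UNIV_domain)
  then obtain \<phi> where \<phi>: "\<phi> \<in> ?P" "inf (nhds \<phi>) (filtermap f sequentially) \<noteq> bot"
    using cp unfolding compact_filter by (metis filtermap_bot_iff sequentially_bot)
  show thesis
  proof
    show "\<phi> t \<in> K" for t using \<phi>(1) by auto
    fix s t and \<epsilon> :: real assume \<epsilon>: "\<epsilon> > 0"
    let ?W = "{g. g s \<in> ball (\<phi> s) \<epsilon>} \<inter> {g. g t \<in> ball (\<phi> t) \<epsilon>}"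
    have "open {g. g u \<in> ball (\<phi> u) \<epsilon>}" for u
    proof -
      have "open ((\<lambda>g :: 'i \<Rightarrow> 'b. g u) -` ball (\<phi> u) \<epsilon>)"
        by (intro open_vimage open_ball continuous_on_product_coordinates)
      then show ?thesis by (simp add: vimage_def)
    qed
    then have W: "open ?W" by (intro open_Int)
    show "\<exists>\<^sub>F k in sequentially. dist (f k s) (\<phi> s) < \<epsilon> \<and> dist (f k t) (\<phi> t) < \<epsilon>"
    proof (rule ccontr)
      assume "\<not> (\<exists>\<^sub>F k in sequentially. dist (f k s) (\<phi> s) < \<epsilon> \<and> dist (f k t) (\<phi> t) < \<epsilon>)"
      then have "\<forall>\<^sub>F k in sequentially. f k \<notin> ?W"
        unfolding not_frequently by (rule eventually_mono) (auto simp: dist_commute)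
      then have "\<forall>\<^sub>F g in filtermap f sequentially. g \<notin> ?W" by (simp add: eventually_filtermap)
      moreover have "\<forall>\<^sub>F g in nhds \<phi>. g \<in> ?W"
        using W \<epsilon> by (intro eventually_nhds_in_open) auto
      ultimately have "\<forall>\<^sub>F g in inf (nhds \<phi>) (filtermap f sequentially). False"
        unfolding eventually_inf by blast
      then show False using \<phi>(2) by (simp add: trivial_limit_def)
    qed
  qed
qed

lemma step_index_at_top:
  assumes a: "step_sequence a" and r: "strict_mono (r :: nat \<Rightarrow> nat)"
  shows "filterlim (\<lambda>k. step_index a (step_time a (r k) + s)) at_top sequentially"
  unfolding filterlim_at_top
proof
  fix Z :: nat
  have "filterlim (\<lambda>k. step_time a (r k)) at_top sequentially"
    using filterlim_compose[OF step_time_at_top[OF a] filterlim_subseq[OF r]] .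
  then have "\<forall>\<^sub>F k in sequentially. max 0 (step_time a Z) - s \<le> step_time a (r k)"
    unfolding filterlim_at_top by blast
  then show "\<forall>\<^sub>F k in sequentially. Z \<le> step_index a (step_time a (r k) + s)"
  proof eventually_elim
    case (elim k)
    then have "0 \<le> step_time a (r k) + s" "step_time a Z \<le> step_time a (r k) + s" by auto
    then show ?case using step_index_le_iff[OF a] by blast
  qed
qed

lemma step_index_window:
  assumes a: "step_sequence a" and r: "strict_mono (r :: nat \<Rightarrow> nat)" and st: "s \<le> t" and \<delta>: "0 < \<delta>"
  shows "\<forall>\<^sub>F k in sequentially. let n = step_index a (step_time a (r k) + s); l = step_index a (step_time a (r k) + t)
    in N \<le> n \<and> n \<le> l \<and> \<bar>step_time a l - step_time a n - (t - s)\<bar> < \<delta>"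
proof -
  let ?n = "\<lambda>u k. step_index a (step_time a (r k) + u)"
  have small: "\<forall>\<^sub>F k in sequentially. a (?n u k) < \<delta>" for u
  proof -
    have "(\<lambda>k. a (?n u k)) \<longlonglongrightarrow> 0"
      using a by (intro filterlim_compose[OF _ step_index_at_top[OF a r]]) (simp add: step_sequence_def)
    then show ?thesis using \<delta> by (rule order_tendstoD(2))
  qed
  have big: "\<forall>\<^sub>F k in sequentially. - s \<le> step_time a (r k)"
    using filterlim_compose[OF step_time_at_top[OF a] filterlim_subseq[OF r]]
    unfolding filterlim_at_top by blast
  have "\<forall>\<^sub>F k in sequentially. N \<le> ?n s k"
    using step_index_at_top[OF a r] unfolding filterlim_at_top by blast
  with small[of s] small[of t] big show ?thesis
  proof eventually_elim
    case (elim k)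
    have nn: "0 \<le> step_time a (r k) + s" "0 \<le> step_time a (r k) + t" using elim st by auto
    note bs = step_index_bounds[OF a nn(1)] step_index_bounds[OF a nn(2)]
    have "?n s k \<le> ?n t k" using step_index_le_iff[OF a nn(2)] bs(1) st by auto
    moreover have "step_time a (Suc j) = step_time a j + a j" for j by (simp add: step_time_def)
    ultimately show ?case using bs elim unfolding Let_def by (auto simp: abs_less_iff)
  qed
qed

text \<open>
  A closed graph and local boundedness make the support function of \<open>F\<close> in the direction \<open>z\<close> upper
  semicontinuous.
\<close>

lemma upper_semicontinuous_support:
  fixes F :: "'a::euclidean_space \<Rightarrow> 'b::euclidean_space set"
  assumes graph: "closed {(x, y). y \<in> F x}" and bd: "\<And>x. x \<in> cball x0 1 \<Longrightarrow> F x \<subseteq> cball 0 C"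
    and lt: "\<And>y. y \<in> F x0 \<Longrightarrow> z \<bullet> y < c"
  shows "\<exists>\<rho>>0. \<forall>x\<in>ball x0 \<rho>. \<forall>y\<in>F x. z \<bullet> y \<le> c"
proof (rule ccontr)
  assume neg: "\<not> (\<exists>\<rho>>0. \<forall>x\<in>ball x0 \<rho>. \<forall>y\<in>F x. z \<bullet> y \<le> c)"
  have "\<exists>x y. dist x0 x < 1 / real (Suc n) \<and> y \<in> F x \<and> c < z \<bullet> y" for n
  proof -
    have "0 < 1 / real (Suc n)" by simp
    then show ?thesis using neg unfolding ball_def by (metis linorder_not_le mem_Collect_eq)
  qed
  then obtain x y where xy: "\<And>n. dist x0 (x n) < 1 / real (Suc n)" "\<And>n. y n \<in> F (x n)" "\<And>n. c < z \<bullet> y n"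
    by metis
  have inv0: "(\<lambda>n. 1 / real (Suc n)) \<longlonglongrightarrow> 0" using LIMSEQ_inverse_real_of_nat by (simp add: inverse_eq_divide)
  have xl: "x \<longlonglongrightarrow> x0"
    by (rule metric_tendsto_imp_tendsto[OF inv0])
       (use xy(1) in \<open>auto intro!: always_eventually less_imp_le simp: dist_commute simp del: of_nat_Suc\<close>)
  have "y n \<in> cball 0 C" for n
  proof -
    have "1 / real (Suc n) \<le> 1" by simp
    then have "dist x0 (x n) \<le> 1" using xy(1)[of n] by linarith
    then have "x n \<in> cball x0 1" by simp
    then show ?thesis using bd xy(2) by blast
  qed
  then have "bounded (range y)" by (auto simp: bounded_iff)
  then obtain p s where s: "strict_mono (s :: nat \<Rightarrow> nat)" "(y \<circ> s) \<longlonglongrightarrow> p"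
    using bounded_imp_convergent_subsequence by blast
  have "(\<lambda>n. (x (s n), y (s n))) \<longlonglongrightarrow> (x0, p)"
    using LIMSEQ_subseq_LIMSEQ[OF xl s(1)] s(2) by (intro tendsto_Pair) (auto simp: o_def)
  then have "(x0, p) \<in> {(x, y). y \<in> F x}"
    using closed_sequentially[OF graph, of "\<lambda>n. (x (s n), y (s n))"] xy(2) by auto
  then have "z \<bullet> p < c" using lt by auto
  moreover have "(\<lambda>n. z \<bullet> (y \<circ> s) n) \<longlonglongrightarrow> z \<bullet> p" by (intro tendsto_intros s)
  then have "c \<le> z \<bullet> p" by (rule tendsto_lowerbound) (use xy(3) in \<open>auto intro!: always_eventually less_imp_le\<close>)
  ultimately show False by simp
qed

text \<open>
  The curve \<open>\<phi>\<close> is a cluster point of the functions \<open>t \<mapsto> x (step_index (step_time (r k) + t))\<close>, which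
  are defined for negative \<open>t\<close> as well. Over a window the iterates drift by at most \<open>C\<close> times its
  length up to the vanishing error, hence \<open>\<phi>\<close> is Lipschitz. For the inclusion, let \<open>z \<bullet> y < c\<close> on
  \<open>F (\<phi> t)\<close>. By semicontinuity \<open>z \<bullet> y \<le> c\<close> on \<open>F (x i)\<close> for all iterates in a short window, so the
  increments of \<open>\<phi>\<close> satisfy the same bound relative to the length of the window, and so does the
  derivative. As \<open>F (\<phi> t)\<close> is closed and convex, separating hyperplanes give the claim.
\<close>

lemma limit_trajectory:
  fixes x :: "nat \<Rightarrow> 'a::euclidean_space"
  assumes a: "step_sequence a" and x: "\<And>n. norm (x n) \<le> R"
    and step: "\<And>n. x (Suc n) - x n = a n *\<^sub>R (y n + e n)"
    and y: "\<And>n. y n \<in> F (x n)" and e: "vanishing a e"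
    and F: "\<And>x. convex (F x)" "\<And>x. closed (F x)" "closed {(x, y). y \<in> F x}"
      "\<And>x. norm x \<le> R + 1 \<Longrightarrow> F x \<subseteq> cball 0 C"
    and r: "strict_mono r" "(x \<circ> r) \<longlonglongrightarrow> p"
  obtains \<phi> :: "real \<Rightarrow> 'a" where "C-lipschitz_on UNIV \<phi>" "\<phi> 0 = p" "\<And>t. norm (\<phi> t) \<le> R"
    "\<And>t v. (\<phi> has_vector_derivative v) (at t) \<Longrightarrow> v \<in> F (\<phi> t)"
proof -
  let ?\<tau> = "step_time a"
  define m where "m t k = step_index a (?\<tau> (r k) + t)" for t k
  have mono: "?\<tau> i \<le> ?\<tau> j \<longleftrightarrow> i \<le> j" for i j
    using strict_mono_less_eq[OF step_time_strict_mono[OF a]] .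
  have yC: "norm (y n) \<le> C" for n
    using F(4)[of "x n"] x[of n] y[of n] by auto
  have C: "0 \<le> C" using order_trans[OF norm_ge_zero yC[of 0]] .
  obtain \<phi> where \<phi>K: "\<And>t. \<phi> t \<in> cball 0 R"
    and cl: "\<And>s t \<epsilon>. \<epsilon> > 0 \<Longrightarrow> \<exists>\<^sub>F k in sequentially. dist (x (m s k)) (\<phi> s) < \<epsilon> \<and> dist (x (m t k)) (\<phi> t) < \<epsilon>"
    by (rule pointwise_cluster_point[of "cball 0 R" "\<lambda>k t. x (m t k)"]) (use x in auto)
  \<comment> \<open>up to \<open>\<epsilon>\<close>, two values of \<open>\<phi>\<close> are two values of \<open>x\<close> along a window of the right length on
    which the noise contributes at most \<open>\<epsilon>\<close>\<close>
  have window: "\<exists>n l. n \<le> l \<and> \<bar>?\<tau> l - ?\<tau> n - (t - s)\<bar> < \<epsilon> \<and> dist (x n) (\<phi> s) < \<epsilon> \<and> dist (x l) (\<phi> t) < \<epsilon>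
      \<and> (\<forall>i. n \<le> i \<longrightarrow> i \<le> l \<longrightarrow> norm (step_sum a e n i) \<le> \<epsilon>)"
    if st: "s \<le> t" and \<epsilon>: "0 < \<epsilon>" for s t \<epsilon>
  proof -
    obtain N where N: "\<And>n k. N \<le> n \<Longrightarrow> n \<le> k \<Longrightarrow> ?\<tau> k - ?\<tau> n \<le> t - s + \<epsilon> \<Longrightarrow> norm (step_sum a e n k) \<le> \<epsilon>"
      using vanishingD[OF e \<epsilon>] by blast
    have "\<exists>\<^sub>F k in sequentially. (dist (x (m s k)) (\<phi> s) < \<epsilon> \<and> dist (x (m t k)) (\<phi> t) < \<epsilon>) \<and>
        (N \<le> m s k \<and> m s k \<le> m t k \<and> \<bar>?\<tau> (m t k) - ?\<tau> (m s k) - (t - s)\<bar> < \<epsilon>)"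
      using cl[OF \<epsilon>, of s t] step_index_window[OF a r(1) st \<epsilon>, of N]
      unfolding m_def Let_def by (rule frequently_conj_eventually)
    then obtain k where k: "dist (x (m s k)) (\<phi> s) < \<epsilon>" "dist (x (m t k)) (\<phi> t) < \<epsilon>"
        "N \<le> m s k" "m s k \<le> m t k" "\<bar>?\<tau> (m t k) - ?\<tau> (m s k) - (t - s)\<bar> < \<epsilon>"
      using frequently_ex by blast
    have "norm (\<Sum>j\<in>{m s k..<i}. a j *\<^sub>R e j) \<le> \<epsilon>" if "m s k \<le> i" "i \<le> m t k" for i
      using that k mono[of i "m t k"] by (intro N) auto
    then show ?thesis using k by blast
  qed
  have incr: "x l - x n = (step_sum a y n l) + (step_sum a e n l)" if "n \<le> l" for n l
    using increments_sum[of x a "\<lambda>i. y i + e i", OF step that] by (simp add: scaleR_add_right sum.distrib)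
  have drift: "norm (x l - x n) \<le> C * (?\<tau> l - ?\<tau> n) + norm (step_sum a e n l)" if "n \<le> l" for n l
    using norm_triangle_ineq[of "\<Sum>i\<in>{n..<l}. a i *\<^sub>R y i" "\<Sum>i\<in>{n..<l}. a i *\<^sub>R e i"]
      sum_step_norm_le[OF a that, of y C] yC unfolding incr[OF that] by (auto intro: order_trans)
  have lip1: "dist (\<phi> s) (\<phi> t) \<le> C * (t - s)" if st: "s \<le> t" for s t
  proof (rule field_le_epsilon)
    fix \<epsilon>' :: real assume \<epsilon>': "0 < \<epsilon>'"
    define \<epsilon> where "\<epsilon> = \<epsilon>' / (C + 3)"
    have \<epsilon>: "0 < \<epsilon>" "\<epsilon> * (C + 3) = \<epsilon>'" using \<epsilon>' C by (auto simp: \<epsilon>_def)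
    obtain n l where nl: "n \<le> l" "\<bar>?\<tau> l - ?\<tau> n - (t - s)\<bar> < \<epsilon>" "dist (x n) (\<phi> s) < \<epsilon>" "dist (x l) (\<phi> t) < \<epsilon>"
      "norm (step_sum a e n l) \<le> \<epsilon>"
      using window[OF st \<epsilon>(1)] by blast
    have "dist (\<phi> s) (\<phi> t) \<le> dist (x n) (\<phi> s) + dist (x l) (x n) + dist (x l) (\<phi> t)"
      by (smt (verit) dist_commute dist_triangle)
    also have "dist (x l) (x n) \<le> C * (?\<tau> l - ?\<tau> n) + \<epsilon>" using drift[OF nl(1)] nl(5) by (simp add: dist_norm)
    also have "C * (?\<tau> l - ?\<tau> n) \<le> C * (t - s + \<epsilon>)" using nl(2) C by (intro mult_left_mono) auto
    finally have "dist (\<phi> s) (\<phi> t) \<le> \<epsilon> + (C * (t - s + \<epsilon>) + \<epsilon>) + \<epsilon>" using nl(3,4) by linarith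
    then show "dist (\<phi> s) (\<phi> t) \<le> C * (t - s) + \<epsilon>'" using \<epsilon>(2) by (simp add: algebra_simps)
  qed
  have lip: "C-lipschitz_on UNIV \<phi>"
  proof (rule lipschitz_onI[OF _ C])
    fix s t show "dist (\<phi> s) (\<phi> t) \<le> C * dist s t"
      using lip1[of s t] lip1[of t s] by (cases "s \<le> t") (auto simp: dist_real_def dist_commute)
  qed
  have \<phi>0: "\<phi> 0 = p"
  proof -
    have m0: "m 0 k = r k" for k by (simp add: m_def step_index_step_time[OF a])
    have "dist (\<phi> 0) p \<le> 0 + \<epsilon>" if "0 < \<epsilon>" for \<epsilon>
    proof -
      have "0 < \<epsilon> / 2" using that by simp
      from cl[OF this, of 0 0] tendstoD[OF r(2) this]
      have "\<exists>\<^sub>F k in sequentially. dist (x (r k)) (\<phi> 0) < \<epsilon> / 2 \<and> dist (x (r k)) p < \<epsilon> / 2"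
        unfolding m0 o_def conj_absorb by (rule frequently_conj_eventually)
      then obtain k where "dist (x (r k)) (\<phi> 0) < \<epsilon> / 2" "dist (x (r k)) p < \<epsilon> / 2"
        using frequently_ex by blast
      then show ?thesis using dist_triangle_half_r[of "x (r k)" "\<phi> 0" \<epsilon> p] by simp
    qed
    then have "dist (\<phi> 0) p \<le> 0" by (rule field_le_epsilon)
    then show ?thesis by simp
  qed
  have half: "z \<bullet> v \<le> c" if v: "(\<phi> has_vector_derivative v) (at t)"
    and c: "\<And>y. y \<in> F (\<phi> t) \<Longrightarrow> z \<bullet> y < c" for z v t c
  proof -
    have "norm w \<le> R + 1" if "w \<in> cball (\<phi> t) 1" for w
    proof -
      have "norm w \<le> norm (\<phi> t) + dist (\<phi> t) w" by (metis dist_commute dist_norm norm_triangle_sub)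
      then show ?thesis using \<phi>K[of t] that by simp
    qed
    then have "\<exists>\<rho>>0. \<forall>x\<in>ball (\<phi> t) \<rho>. \<forall>y\<in>F x. z \<bullet> y \<le> c"
      using F(4) c by (intro upper_semicontinuous_support[OF F(3), of _ C]) auto
    then obtain \<rho> where \<rho>: "\<rho> > 0" "\<And>w y. dist (\<phi> t) w < \<rho> \<Longrightarrow> y \<in> F w \<Longrightarrow> z \<bullet> y \<le> c" by auto
    have incrementbound: "z \<bullet> (\<phi> (t + h) - \<phi> t) \<le> c * h" if h: "0 < h" "h < \<rho> / (2 * (C + 1))" for h
    proof (rule field_le_epsilon)
      fix \<epsilon>' :: real assume \<epsilon>': "0 < \<epsilon>'"
      \<comment> \<open>the first bound keeps the iterates of the window within \<open>\<rho>\<close> of \<open>\<phi> t\<close>; the second absorbs an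
        error \<open>norm z \<epsilon>\<close> at each end point and in the noise, and \<open>\<bar>c\<bar> \<epsilon>\<close> in the window length\<close>
      define \<epsilon> where "\<epsilon> = min (\<rho> / (4 * (C + 1))) (\<epsilon>' / (\<bar>c\<bar> + 3 * norm z + 1))"
      have d1: "0 < \<bar>c\<bar> + 3 * norm z + 1" by (simp add: add_nonneg_pos)
      have \<epsilon>: "0 < \<epsilon>" using \<rho>(1) C \<epsilon>' d1 by (simp add: \<epsilon>_def)
      have "\<epsilon> \<le> \<epsilon>' / (\<bar>c\<bar> + 3 * norm z + 1)" by (simp add: \<epsilon>_def)
      then have \<epsilon>2: "\<epsilon> * (\<bar>c\<bar> + 3 * norm z + 1) \<le> \<epsilon>'" using d1 by (simp add: pos_le_divide_eq)
      have "\<epsilon> \<le> \<rho> / (4 * (C + 1))" by (simp add: \<epsilon>_def)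
      then have \<epsilon>3: "4 * ((C + 1) * \<epsilon>) \<le> \<rho>" using C by (simp add: pos_le_divide_eq mult_ac)
      have h2: "2 * ((C + 1) * h) < \<rho>" using h(2) C by (simp add: pos_less_divide_eq mult_ac)
      have th: "t \<le> t + h" using h by simp
      obtain n l where nl: "n \<le> l" "\<bar>?\<tau> l - ?\<tau> n - (t + h - t)\<bar> < \<epsilon>" "dist (x n) (\<phi> t) < \<epsilon>" "dist (x l) (\<phi> (t + h)) < \<epsilon>"
        "\<And>i. n \<le> i \<Longrightarrow> i \<le> l \<Longrightarrow> norm (step_sum a e n i) \<le> \<epsilon>"
        using window[OF th \<epsilon>] by blast
      have zy: "z \<bullet> y i \<le> c" if i: "n \<le> i" "i < l" for i
      proof (rule \<rho>(2)[OF _ y])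
        have "?\<tau> i - ?\<tau> n \<le> h + \<epsilon>" using mono[of i l] i nl(2) by simp
        then have "C * (?\<tau> i - ?\<tau> n) \<le> C * (h + \<epsilon>)" using C by (intro mult_left_mono) auto
        then have "dist (x i) (x n) \<le> C * (h + \<epsilon>) + \<epsilon>"
          using drift[OF i(1)] nl(5)[of i] i by (simp add: dist_norm)
        then have "dist (\<phi> t) (x i) < C * (h + \<epsilon>) + \<epsilon> + \<epsilon>"
          using nl(3) dist_triangle[of "\<phi> t" "x i" "x n"] by (simp add: dist_commute)
        also have "\<dots> = C * h + (C + 1) * \<epsilon> + \<epsilon>" by (simp add: algebra_simps)
        also have "\<dots> \<le> (C + 1) * h + 2 * ((C + 1) * \<epsilon>)"
          using C \<epsilon> h mult_nonneg_nonneg[of C \<epsilon>] by (simp add: algebra_simps)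
        also have "\<dots> < \<rho>" using \<epsilon>3 h2 by linarith
        finally show "dist (\<phi> t) (x i) < \<rho>" .
      qed
      have "z \<bullet> (step_sum a y n l) = (\<Sum>i\<in>{n..<l}. a i * (z \<bullet> y i))"
        by (simp add: inner_sum_right)
      also have "\<dots> \<le> (\<Sum>i\<in>{n..<l}. a i * c)"
        using zy a by (intro sum_mono mult_left_mono) (auto simp: step_sequence_def less_imp_le)
      also have "\<dots> = c * (?\<tau> l - ?\<tau> n)" using nl(1) by (simp add: step_time_diff sum_distrib_left mult.commute)
      also have "\<dots> \<le> c * h + \<bar>c\<bar> * \<epsilon>"
      proof -
        have "c * (?\<tau> l - ?\<tau> n - h) \<le> \<bar>c\<bar> * \<bar>?\<tau> l - ?\<tau> n - h\<bar>" by (metis abs_ge_self abs_mult)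
        also have "\<dots> \<le> \<bar>c\<bar> * \<epsilon>" using nl(2) by (intro mult_left_mono) auto
        finally show ?thesis by (simp add: algebra_simps)
      qed
      finally have 1: "z \<bullet> (step_sum a y n l) \<le> c * h + \<bar>c\<bar> * \<epsilon>" .
      have zb: "z \<bullet> w \<le> norm z * \<epsilon>" if "norm w \<le> \<epsilon>" for w
        using norm_cauchy_schwarz[of z w] mult_left_mono[OF that norm_ge_zero[of z]] by linarith
      have "\<phi> (t + h) - \<phi> t = (\<phi> (t + h) - x l) + (x n - \<phi> t) + ((step_sum a y n l) + (step_sum a e n l))"
        unfolding incr[OF nl(1), symmetric] by simp
      then have "z \<bullet> (\<phi> (t + h) - \<phi> t) = z \<bullet> (\<phi> (t + h) - x l) + z \<bullet> (x n - \<phi> t) + (z \<bullet> (step_sum a y n l) + z \<bullet> (step_sum a e n l))"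
        by (simp only: inner_add_right)
      also have "\<dots> \<le> norm z * \<epsilon> + norm z * \<epsilon> + ((c * h + \<bar>c\<bar> * \<epsilon>) + norm z * \<epsilon>)"
        using nl(3,4) nl(5)[of l] nl(1) by (intro add_mono zb 1) (auto simp: dist_norm norm_minus_commute)
      also have "\<dots> \<le> c * h + \<epsilon>'" using \<epsilon>2 \<epsilon> by (simp add: algebra_simps)
      finally show "z \<bullet> (\<phi> (t + h) - \<phi> t) \<le> c * h + \<epsilon>'" .
    qed
    have "((\<lambda>s. z \<bullet> \<phi> s) has_real_derivative z \<bullet> v) (at t)"
      using bounded_linear.has_vector_derivative[OF bounded_linear_inner_right v, of z]
      by (simp add: has_real_derivative_iff_has_vector_derivative)
    then have "((\<lambda>h. (z \<bullet> \<phi> (t + h) - z \<bullet> \<phi> t) / h) \<longlongrightarrow> z \<bullet> v) (at_right 0)"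
      unfolding DERIV_def by (rule filterlim_mono) (auto intro: at_le)
    moreover have "\<forall>\<^sub>F h in at_right 0. (z \<bullet> \<phi> (t + h) - z \<bullet> \<phi> t) / h \<le> c"
      unfolding eventually_at_right_field
    proof (intro exI[of _ "\<rho> / (2 * (C + 1))"] conjI allI impI)
      show "0 < \<rho> / (2 * (C + 1))" using \<rho>(1) C by simp
      fix h assume "0 < h" "h < \<rho> / (2 * (C + 1))"
      then show "(z \<bullet> \<phi> (t + h) - z \<bullet> \<phi> t) / h \<le> c"
        using incrementbound[of h] by (simp add: inner_diff_right field_simps)
    qed
    ultimately show "z \<bullet> v \<le> c" by (intro tendsto_upperbound) auto
  qed
  have "v \<in> F (\<phi> t)" if v: "(\<phi> has_vector_derivative v) (at t)" for t v
  proof (rule ccontr)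
    assume "v \<notin> F (\<phi> t)"
    then obtain z c where z: "z \<bullet> v < c" "\<And>y. y \<in> F (\<phi> t) \<Longrightarrow> c < z \<bullet> y"
      using separating_hyperplane_closed_point[OF F(1) F(2), of v "\<phi> t"] by blast
    have "(- z) \<bullet> v \<le> - c" by (rule half[OF v]) (use z(2) in auto)
    then show False using z(1) by simp
  qed
  then show thesis using that[OF lip \<phi>0] \<phi>K by auto
qed

theorem perturbed_inclusion_converges:
  fixes x :: "nat \<Rightarrow> 'a::euclidean_space"
  assumes a: "step_sequence a" and x: "\<And>n. norm (x n) \<le> R"
    and step: "\<And>n. x (Suc n) - x n = a n *\<^sub>R (y n + e n)"
    and y: "\<And>n. y n \<in> F (x n)" and e: "vanishing a e"
    and F: "\<And>x. convex (F x)" "\<And>x. closed (F x)" "closed {(x, y). y \<in> F x}"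
      "\<And>x. norm x \<le> R + 1 \<Longrightarrow> F x \<subseteq> cball 0 C"
    and U: "admissible_collection \<U>" and V: "gen_lyapunov \<U> F V" and V0: "pos_definite V0"
    and dec: "\<And>x. x \<noteq> 0 \<Longrightarrow> gen_derivative \<U> F V x \<le> ereal (- V0 x)"
  shows "x \<longlonglongrightarrow> 0"
proof (rule ccontr)
  assume "\<not> x \<longlonglongrightarrow> 0"
  then obtain \<epsilon> where \<epsilon>: "\<epsilon> > 0" "\<And>N. \<exists>n\<ge>N. \<epsilon> \<le> norm (x n)"
    unfolding lim_sequentially by (auto simp: not_less)
  define A where "A = {n. \<epsilon> \<le> norm (x n)}"
  have "infinite A" unfolding infinite_nat_iff_unbounded_le using \<epsilon>(2) by (auto simp: A_def)
  then have q: "strict_mono (enumerate A)" "\<And>k. enumerate A k \<in> A"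
    by (auto simp: strict_mono_enumerate enumerate_in_set)
  have "bounded (range (x \<circ> enumerate A))" using x by (auto simp: bounded_iff)
  then obtain p s where s: "strict_mono (s :: nat \<Rightarrow> nat)" "((x \<circ> enumerate A) \<circ> s) \<longlonglongrightarrow> p"
    using bounded_imp_convergent_subsequence by blast
  define r where "r = enumerate A \<circ> s"
  have r: "strict_mono r" "(x \<circ> r) \<longlonglongrightarrow> p"
    using q(1) s by (auto simp: r_def strict_mono_o o_assoc)
  obtain \<phi> :: "real \<Rightarrow> 'a" where \<phi>: "C-lipschitz_on UNIV \<phi>" "\<phi> 0 = p" "\<And>t. norm (\<phi> t) \<le> R"
    "\<And>t v. (\<phi> has_vector_derivative v) (at t) \<Longrightarrow> v \<in> F (\<phi> t)"
    using limit_trajectory[OF a x step y e F r] by blast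
  have "bounded (range \<phi>)" using \<phi>(3) by (auto simp: bounded_iff)
  from complete_bounded_trajectory_at_equilibrium[OF \<phi>(1) this \<phi>(4) U V V0 dec]
  have "p = 0" using \<phi>(2) by simp
  moreover have "(\<lambda>k. norm ((x \<circ> r) k)) \<longlonglongrightarrow> norm p" using r(2) by (rule tendsto_norm)
  then have "\<epsilon> \<le> norm p"
    by (rule tendsto_lowerbound) (use q(2) in \<open>auto simp: r_def A_def intro!: always_eventually\<close>)
  ultimately show False using \<epsilon>(1) by simp
qed

section \<open>Almost sure behaviour of the noise\<close>

text \<open>
  The events in the definition decrease with \<open>n\<close>, so their probabilities converge to that of their
  intersection, the event that windows arbitrarily late exceed \<open>\<epsilon>\<close>. They are measurable because a
  window sum takes only countably many forms as \<open>t\<close> varies.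
\<close>

lemma AE_vanishing_if_asymptotically_negligible:
  fixes f :: "nat \<Rightarrow> 'w \<Rightarrow> 'v::{real_normed_vector, second_countable_topology}"
  assumes M: "prob_space M" and a: "step_sequence a" and T: "0 < T"
    and f: "\<And>i. f i \<in> borel_measurable M" and neg: "asymptotically_negligible M a T f"
  shows "AE \<omega> in M. vanishing a (\<lambda>i. f i \<omega>)"
proof -
  interpret prob_space M by (rule M)
  define g where "g j \<omega> = (SUP t\<in>{0..T}. ereal (norm (window_sum a T j t (\<lambda>i. f i \<omega>))))" for j \<omega>
  have g [measurable]: "g j \<in> borel_measurable M" for j
  proof -
    have "g j \<omega> = (SUP k\<in>(\<lambda>t. step_index a (real j * T + t)) ` {0..T}.
        ereal (norm (\<Sum>i\<in>{step_index a (real j * T)..<k}. a i *\<^sub>R f i \<omega>)))" for \<omega>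
      by (simp add: g_def window_sum_def image_image)
    moreover have "(\<lambda>\<omega>. SUP k\<in>(\<lambda>t. step_index a (real j * T + t)) ` {0..T}.
        ereal (norm (\<Sum>i\<in>{step_index a (real j * T)..<k}. a i *\<^sub>R f i \<omega>))) \<in> borel_measurable M"
      using f by (intro borel_measurable_SUP) auto
    ultimately show ?thesis by (simp cong: measurable_cong)
  qed
  have ev: "AE \<omega> in M. \<exists>J. \<forall>j\<ge>J. \<forall>t\<in>{0..T}. norm (window_sum a T j t (\<lambda>i. f i \<omega>)) \<le> \<epsilon>" if \<epsilon>: "\<epsilon> > 0" for \<epsilon>
  proof -
    define E where "E n = {\<omega> \<in> space M. ereal \<epsilon> \<le> (SUP j\<in>{n..}. g j \<omega>)}" for n :: nat
    have E [measurable]: "E n \<in> sets M" for n unfolding E_def by measurable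
    have "decseq E"
    proof (rule decseq_SucI, rule subsetI)
      fix n \<omega> assume "\<omega> \<in> E (Suc n)"
      moreover have "(SUP j\<in>{Suc n..}. g j \<omega>) \<le> (SUP j\<in>{n..}. g j \<omega>)" by (rule SUP_subset_mono) auto
      ultimately show "\<omega> \<in> E n" by (auto simp: E_def intro: order_trans)
    qed
    then have "(\<lambda>n. measure M (E n)) \<longlonglongrightarrow> measure M (\<Inter>n. E n)"
      by (intro finite_Lim_measure_decseq) auto
    moreover have "(\<lambda>n. measure M (E n)) \<longlonglongrightarrow> 0"
      using neg \<epsilon> unfolding asymptotically_negligible_def E_def g_def by blast
    ultimately have "measure M (\<Inter>n. E n) = 0" by (rule LIMSEQ_unique)
    then have "(\<Inter>n. E n) \<in> null_sets M" by (simp add: null_sets_def emeasure_eq_measure)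
    then have "AE \<omega> in M. \<omega> \<notin> (\<Inter>n. E n)" by (rule AE_not_in)
    then show ?thesis
      using AE_space
    proof eventually_elim
      case (elim \<omega>)
      then obtain n where "(SUP j\<in>{n..}. g j \<omega>) < ereal \<epsilon>" by (auto simp: E_def not_le)
      then have *: "g j \<omega> < ereal \<epsilon>" if "n \<le> j" for j
        using that SUP_upper[of j "{n..}" "\<lambda>j. g j \<omega>"] by (auto intro: le_less_trans)
      have "norm (window_sum a T j t (\<lambda>i. f i \<omega>)) \<le> \<epsilon>" if "n \<le> j" "t \<in> {0..T}" for j t
      proof -
        have "ereal (norm (window_sum a T j t (\<lambda>i. f i \<omega>))) \<le> g j \<omega>"
          unfolding g_def using that(2) by (rule SUP_upper)
        then have "ereal (norm (window_sum a T j t (\<lambda>i. f i \<omega>))) < ereal \<epsilon>" using *[OF that(1)] by (rule le_less_trans)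
        then show ?thesis by simp
      qed
      then show ?case by blast
    qed
  qed
  have "AE \<omega> in M. \<forall>k::nat. \<exists>J. \<forall>j\<ge>J. \<forall>t\<in>{0..T}. norm (window_sum a T j t (\<lambda>i. f i \<omega>)) \<le> 1 / Suc k"
    by (subst AE_all_countable) (auto intro!: ev)
  then show ?thesis
  proof eventually_elim
    case (elim \<omega>)
    show ?case
    proof (rule vanishing_if_window_sums[OF a T])
      fix \<epsilon> :: real assume "\<epsilon> > 0"
      then obtain k :: nat where k: "1 / Suc k < \<epsilon>" using nat_approx_posE by blast
      obtain J where "\<forall>j\<ge>J. \<forall>t\<in>{0..T}. norm (window_sum a T j t (\<lambda>i. f i \<omega>)) \<le> 1 / Suc k" using elim by blast
      then show "\<exists>J. \<forall>j\<ge>J. \<forall>t\<in>{0..T}. norm (window_sum a T j t (\<lambda>i. f i \<omega>)) \<le> \<epsilon>"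
        using k by (intro exI[of _ J]) (meson less_imp_le order_trans)
    qed
  qed
qed

text \<open>
  On the bounded set of states, \<open>c (x i) i\<close> is at most \<open>c d i + \<epsilon>\<close> for one of finitely many points \<open>d\<close>,
  and thus at most the sum over all of these points plus \<open>\<epsilon>\<close>, because \<open>c\<close> is nonnegative.
\<close>

lemma vanishing_state_dependent:
  fixes x :: "nat \<Rightarrow> 'a::euclidean_space" and c :: "'a \<Rightarrow> nat \<Rightarrow> real" and e :: "nat \<Rightarrow> 'v::real_normed_vector"
  assumes a: "step_sequence a" and x: "\<And>n. norm (x n) \<le> R" and c0: "\<And>y i. 0 \<le> c y i"
    and cont: "\<And>y \<epsilon>. \<epsilon> > 0 \<Longrightarrow> \<exists>\<delta>>0. \<forall>z. dist z y < \<delta> \<longrightarrow> (\<forall>i. dist (c z i) (c y i) < \<epsilon>)"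
    and D: "closure D = UNIV" "\<And>d. d \<in> D \<Longrightarrow> vanishing a (c d)"
    and e: "\<And>i. norm (e i) \<le> c (x i) i"
  shows "vanishing a e"
proof (rule vanishing_dominated[OF a])
  fix \<epsilon> :: real assume \<epsilon>: "0 < \<epsilon>"
  have "\<exists>\<delta>>0. \<forall>z. dist z y < \<delta> \<longrightarrow> (\<forall>i. dist (c z i) (c y i) < \<epsilon> / 2)" for y
    using cont[of "\<epsilon> / 2" y] \<epsilon> by auto
  then obtain \<delta> where \<delta>: "\<And>y. 0 < \<delta> y" "\<And>y z i. dist z y < \<delta> y \<Longrightarrow> dist (c z i) (c y i) < \<epsilon> / 2"
    by metis
  have "\<exists>d\<in>D. dist d y < \<delta> y" for y
    using D(1) \<delta>(1)[of y] closure_approachable[of y D] by auto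
  then obtain p where p: "\<And>y. p y \<in> D" "\<And>y. dist (p y) y < \<delta> y" by metis
  have "cball 0 R \<subseteq> (\<Union>y\<in>cball 0 R. ball y (\<delta> y))" using \<delta>(1) by auto
  then obtain Y where Y: "Y \<subseteq> cball 0 R" "finite Y" "cball 0 R \<subseteq> (\<Union>y\<in>Y. ball y (\<delta> y))"
    using compactE_image[OF compact_cball, of "cball 0 R" "\<lambda>y. ball y (\<delta> y)" 0 R] by (metis open_ball)
  have "norm (e i) \<le> (\<Sum>y\<in>Y. c (p y) i) + \<epsilon>" for i
  proof -
    have "x i \<in> cball 0 R" using x by simp
    then obtain y where y: "y \<in> Y" "dist (x i) y < \<delta> y" using Y(3) by (force simp: dist_commute)
    have "c (x i) i \<le> c (p y) i + \<epsilon>"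
      using \<delta>(2)[OF y(2), of i] \<delta>(2)[OF p(2)[of y], of i] unfolding dist_real_def abs_diff_less_iff by linarith
    also have "c (p y) i \<le> (\<Sum>y\<in>Y. c (p y) i)"
      using y(1) Y(2) c0 by (intro member_le_sum) auto
    finally show ?thesis using e[of i] by linarith
  qed
  then show "\<exists>c::nat \<Rightarrow> real. vanishing a c \<and> (\<forall>\<^sub>F i in sequentially. norm (e i) \<le> c i + \<epsilon>)"
    using p(1) D(2) Y(2) by (intro exI[of _ "\<lambda>i. \<Sum>y\<in>Y. c (p y) i"] conjI vanishing_sum always_eventually) auto
qed

section \<open>Convergence of the algorithm\<close>

theorem theorem2p4:
  fixes M :: "'w measure"
    and S :: "'s measure" and Z :: "'z measure" and Y :: "'y measure"
    and a :: "nat \<Rightarrow> real"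
    and \<xi> :: "nat \<Rightarrow> 'w \<Rightarrow> 's" and \<zeta> :: "nat \<Rightarrow> 'w \<Rightarrow> 'z" and \<eta> :: "nat \<Rightarrow> 'w \<Rightarrow> 'y"
    and X \<beta> :: "nat \<Rightarrow> 'w \<Rightarrow> real ^ 'd"
    and b :: "nat \<Rightarrow> real ^ 'd \<Rightarrow> 's \<Rightarrow> real ^ 'd"
    and h :: "real ^ 'd \<Rightarrow> 'z \<Rightarrow> real ^ 'd" and h0 :: "'y \<Rightarrow> real ^ 'd"
    and hbar :: "real ^ 'd \<Rightarrow> real ^ 'd"
    and G :: "real ^ 'd \<Rightarrow> (real ^ 'd) set"
    and m :: "nat \<Rightarrow> real ^ 'd \<Rightarrow> 's \<Rightarrow> real"
    and xstar :: "real ^ 'd"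
    and \<U> :: "(real ^ 'd \<Rightarrow> real) set"
    and V V0hat :: "real ^ 'd \<Rightarrow> real"
  assumes space: "prob_space M" "complete_measure M"
    and steps: "\<And>n. a n > 0" "a \<longlonglongrightarrow> 0" "\<not> summable a"
    and noises: "\<And>n. \<xi> n \<in> measurable M S" "\<And>n. \<zeta> n \<in> measurable M Z"
      "\<And>n. \<eta> n \<in> measurable M Y"
    and X_rv: "\<And>n. X n \<in> borel_measurable M"
    and h_meas: "case_prod h \<in> borel_measurable (borel \<Otimes>\<^sub>M Z)"
    and algorithm: "\<And>n \<omega>. \<omega> \<in> space M \<Longrightarrow>
      X (Suc n) \<omega> = X n \<omega> + a n *\<^sub>R b n (X n \<omega>) (\<xi> n \<omega>) + a n *\<^sub>R h (X n \<omega>) (\<zeta> n \<omega>)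
                   + a n *\<^sub>R h0 (\<eta> n \<omega>) + a n *\<^sub>R \<beta> n \<omega>"
    and X_bounded: "AE \<omega> in M. bounded (range (\<lambda>n. X n \<omega>))"
    and A_i: "\<And>B \<epsilon>. bounded B \<Longrightarrow> \<epsilon> > 0 \<Longrightarrow>
      \<exists>\<delta>>0. \<forall>x\<in>B. \<forall>y\<in>B. dist x y < \<delta> \<longrightarrow> (\<forall>z\<in>space Z. dist (h x z) (h y z) < \<epsilon>)"
    and A_ii:
      "(\<exists>C. \<forall>x. \<forall>z\<in>space Z. norm (h x z) \<le> C) \<or>
       (\<exists>g1 \<in> borel_measurable borel. \<exists>g2 \<in> borel_measurable Z. \<exists>g3 \<in> borel_measurable Z.
          (\<forall>x. g1 x \<ge> 0) \<and> (\<forall>z\<in>space Z. g2 z \<ge> 0 \<and> g3 z \<ge> 0) \<and>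
          (\<forall>B. bounded B \<longrightarrow> bounded (g1 ` B)) \<and>
          (\<forall>x. \<forall>z\<in>space Z. norm (h x z) \<le> g1 x * g2 z + g3 z) \<and>
          (\<forall>\<epsilon>>0. ((\<lambda>\<Delta>. lim (\<lambda>n. measure M {\<omega> \<in> space M.
               ereal \<epsilon> \<le> (SUP j\<in>{n..}. SUP t\<in>{0..\<Delta>}.
                 ereal (window_sum a \<Delta> j t (\<lambda>i. g2 (\<zeta> i \<omega>) + g3 (\<zeta> i \<omega>))))}))
             \<longlongrightarrow> 0) (at_right 0)))"
    and A_iii: "continuous_on UNIV hbar"
      "\<exists>T>0. \<forall>x. asymptotically_negligible M a T (\<lambda>i \<omega>. h x (\<zeta> i \<omega>) - hbar x)"
    and A_iv: "independent_processes M S \<xi> Z \<zeta> Y \<eta>"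
      "exogenous M S \<xi> X" "exogenous M Z \<zeta> X" "exogenous M Y \<eta> X"
      "h0 \<in> borel_measurable Y"
      "\<exists>T>0. asymptotically_negligible M a T (\<lambda>i \<omega>. h0 (\<eta> i \<omega>))"
    and A_v: "\<And>n. \<beta> n \<in> borel_measurable M" "\<And>n. \<exists>C. AE \<omega> in M. norm (\<beta> n \<omega>) \<le> C"
      "AE \<omega> in M. (\<lambda>n. norm (\<beta> n \<omega>)) \<longlonglongrightarrow> 0"
    and G_i: "\<And>x. G x \<noteq> {} \<and> compact (G x) \<and> convex (G x)" "\<exists>c r. \<forall>x. G x \<subseteq> cball c r"
    and G_ii: "closed {(x, y). y \<in> G x}"
    and G_iii: "\<And>n x s. s \<in> space S \<Longrightarrow> m n x s > 0"
      "\<And>n x. m n x \<in> borel_measurable S"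
      "\<And>x \<epsilon>. \<epsilon> > 0 \<Longrightarrow>
         \<exists>\<delta>>0. \<forall>y. dist y x < \<delta> \<longrightarrow> (\<forall>n. \<forall>s\<in>space S. dist (m n y s) (m n x s) < \<epsilon>)"
      "\<And>n x s. s \<in> space S \<Longrightarrow> b n x s \<in> {y + m n x s *\<^sub>R u | y u. y \<in> G x \<and> u \<in> cball 0 1}"
      "\<exists>T>0. \<forall>x. asymptotically_negligible M a T (\<lambda>i \<omega>. m i x (\<xi> i \<omega>))"
    and GS_equilibrium: "0 \<in> {hbar xstar + y | y. y \<in> G xstar}"
      "\<And>x. 0 \<in> {hbar x + y | y. y \<in> G x} \<Longrightarrow> x = xstar"
    and GS_lyapunov: "admissible_collection \<U>" "\<And>x. V x \<ge> 0"
      "gen_lyapunov \<U> (\<lambda>x. {hbar (x + xstar) + y | y. y \<in> G (x + xstar)}) V"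
      "\<And>l. l > 0 \<Longrightarrow> compact {x. V x \<le> l}"
      "pos_definite V0hat"
      "\<And>x. x \<noteq> 0 \<Longrightarrow>
         gen_derivative \<U> (\<lambda>x. {hbar (x + xstar) + y | y. y \<in> G (x + xstar)}) V x
           \<le> ereal (- V0hat x)"
  shows "\<exists>\<Omega>0\<in>null_sets M. \<forall>\<omega>\<in>space M - \<Omega>0. (\<lambda>n. X n \<omega>) \<longlonglongrightarrow> xstar"
  proof -
  interpret prob_space M by (rule space(1))
  have a: "step_sequence a" using steps by (auto simp: step_sequence_def)
  \<comment> \<open>the frozen states at which the noise conditions are used\<close>
  obtain D :: "(real ^ 'd) set" where D: "countable D" "closure D = UNIV"
    by (metis separable top.extremum_uniqueI)
  have h_sec: "(\<lambda>\<omega>. h x (\<zeta> i \<omega>)) \<in> borel_measurable M" for x i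
  proof -
    have "(\<lambda>\<omega>. (x, \<zeta> i \<omega>)) \<in> measurable M (borel \<Otimes>\<^sub>M Z)"
      using noises(2) by (intro measurable_Pair) auto
    from measurable_compose[OF this h_meas] show ?thesis by simp
  qed
  have AE_h: "AE \<omega> in M. \<forall>d\<in>D. vanishing a (\<lambda>i. h d (\<zeta> i \<omega>) - hbar d)"
  proof (rule AE_ball_countable'[OF _ D(1)])
    obtain T where "T > 0" "\<And>x. asymptotically_negligible M a T (\<lambda>i \<omega>. h x (\<zeta> i \<omega>) - hbar x)"
      using A_iii(2) by blast
    then show "AE \<omega> in M. vanishing a (\<lambda>i. h d (\<zeta> i \<omega>) - hbar d)" for d
      by (intro AE_vanishing_if_asymptotically_negligible[OF space(1) a]) (auto intro: borel_measurable_diff h_sec)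
  qed
  have AE_m: "AE \<omega> in M. \<forall>d\<in>D. vanishing a (\<lambda>i. m i d (\<xi> i \<omega>))"
  proof (rule AE_ball_countable'[OF _ D(1)])
    obtain T where "T > 0" "\<And>x. asymptotically_negligible M a T (\<lambda>i \<omega>. m i x (\<xi> i \<omega>))"
      using G_iii(5) by blast
    then show "AE \<omega> in M. vanishing a (\<lambda>i. m i d (\<xi> i \<omega>))" for d
      by (intro AE_vanishing_if_asymptotically_negligible[OF space(1) a])
         (auto intro: measurable_compose[OF noises(1) G_iii(2)])
  qed
  have AE_h0: "AE \<omega> in M. vanishing a (\<lambda>i. h0 (\<eta> i \<omega>))"
  proof -
    obtain T where "T > 0" "asymptotically_negligible M a T (\<lambda>i \<omega>. h0 (\<eta> i \<omega>))"
      using A_iv(6) by blast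
    then show ?thesis
      by (intro AE_vanishing_if_asymptotically_negligible[OF space(1) a])
         (auto intro: measurable_compose[OF noises(3) A_iv(5)])
  qed
  define F where "F = (\<lambda>x. {hbar (x + xstar) + y | y. y \<in> G (x + xstar)})"
  have F_iff: "w \<in> F x \<longleftrightarrow> w - hbar (x + xstar) \<in> G (x + xstar)" for w x
    by (auto simp: F_def) (metis add.commute diff_add_cancel)
  have F_image: "F x = (+) (hbar (x + xstar)) ` G (x + xstar)" for x
    by (auto simp: F_def)
  have F_convex: "convex (F x)" and F_closed: "closed (F x)" for x
    unfolding F_image using G_i(1) by (auto intro: convex_translation closed_translation compact_imp_closed)
  have F_graph: "closed {(x, y). y \<in> F x}"
  proof -
    have "continuous_on UNIV (\<lambda>p. (fst p + xstar, snd p - hbar (fst p + xstar)))"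
      by (intro continuous_intros continuous_on_compose2[OF A_iii(1)]) auto
    from closed_vimage[OF G_ii this] show ?thesis
      by (simp add: vimage_def F_iff case_prod_unfold)
  qed
  \<comment> \<open>the deterministic statement for one outcome outside the exceptional null sets\<close>
  have conv: "(\<lambda>n. X n \<omega>) \<longlonglongrightarrow> xstar"
    if \<omega>: "\<omega> \<in> space M" and bd: "bounded (range (\<lambda>n. X n \<omega>))"
      and vh: "\<forall>d\<in>D. vanishing a (\<lambda>i. h d (\<zeta> i \<omega>) - hbar d)"
      and vm: "\<forall>d\<in>D. vanishing a (\<lambda>i. m i d (\<xi> i \<omega>))"
      and vh0: "vanishing a (\<lambda>i. h0 (\<eta> i \<omega>))"
      and v\<beta>: "(\<lambda>n. norm (\<beta> n \<omega>)) \<longlonglongrightarrow> 0" for \<omega>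
  proof -
    have in_S: "\<xi> i \<omega> \<in> space S" and in_Z: "\<zeta> i \<omega> \<in> space Z" for i
      using noises(1,2) \<omega> by (auto dest: measurable_space)
    obtain R where R: "\<And>n. norm (X n \<omega>) \<le> R" using bd by (auto simp: bounded_iff)
    have "\<exists>g u. b n (X n \<omega>) (\<xi> n \<omega>) = g + m n (X n \<omega>) (\<xi> n \<omega>) *\<^sub>R u \<and> g \<in> G (X n \<omega>) \<and> norm u \<le> 1" for n
      using G_iii(4)[OF in_S, of n "X n \<omega>"] by auto
    then obtain g u where b: "\<And>n. b n (X n \<omega>) (\<xi> n \<omega>) = g n + m n (X n \<omega>) (\<xi> n \<omega>) *\<^sub>R u n"
      and g: "\<And>n. g n \<in> G (X n \<omega>)" and u: "\<And>n. norm (u n) \<le> 1" by metis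
    define e where "e n = m n (X n \<omega>) (\<xi> n \<omega>) *\<^sub>R u n + h0 (\<eta> n \<omega>) + \<beta> n \<omega>" for n
    have "vanishing a (\<lambda>n. m n (X n \<omega>) (\<xi> n \<omega>) *\<^sub>R u n)"
    proof (rule vanishing_state_dependent[OF a R, of "\<lambda>y i. m i y (\<xi> i \<omega>)" D])
      show "\<exists>\<delta>>0. \<forall>z. dist z y < \<delta> \<longrightarrow> (\<forall>i. dist (m i z (\<xi> i \<omega>)) (m i y (\<xi> i \<omega>)) < \<epsilon>)" if "\<epsilon> > 0" for y \<epsilon>
        using G_iii(3)[OF that, of y] in_S by meson
      show pos: "0 \<le> m i y (\<xi> i \<omega>)" for y i using G_iii(1)[OF in_S] by (rule less_imp_le)
      show "norm (m i (X i \<omega>) (\<xi> i \<omega>) *\<^sub>R u i) \<le> m i (X i \<omega>) (\<xi> i \<omega>)" for i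
        using mult_left_mono[OF u[of i] pos, of i "X i \<omega>"] pos[of i "X i \<omega>"] by simp
    qed (use D(2) vm in auto)
    then have ve: "vanishing a e"
      unfolding e_def by (intro vanishing_add vh0 vanishing_tendsto_0[OF a v\<beta>])
    have step: "X (Suc n) \<omega> - X n \<omega> = a n *\<^sub>R (g n + h (X n \<omega>) (\<zeta> n \<omega>) + e n)" for n
      unfolding algorithm[OF \<omega>] b e_def by (simp add: scaleR_add_right)
    obtain c r where cr: "\<And>x. G x \<subseteq> cball c r" using G_i(2) by blast
    define C where "C = norm c + r"
    have GC: "norm y \<le> C" if "y \<in> G x" for x y
    proof -
      have "dist c y \<le> r" using cr[of x] that by auto
      then show ?thesis unfolding C_def using norm_triangle_sub[of y c] by (simp add: dist_norm norm_minus_commute)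
    qed
    have vhX: "vanishing a (\<lambda>i. h (X i \<omega>) (\<zeta> i \<omega>) - hbar (X i \<omega>))"
    proof (rule vanishing_averaging_error[where x = "\<lambda>n. X n \<omega>" and H = "\<lambda>y i. h y (\<zeta> i \<omega>)" and w = g and e = e,
          OF a R step GC[OF g] ve _ A_iii(1) D(2)])
      show "\<exists>\<delta>>0. \<forall>y\<in>cball 0 (R + 1). \<forall>z\<in>cball 0 (R + 1). dist y z < \<delta> \<longrightarrow>
          (\<forall>i. dist (h y (\<zeta> i \<omega>)) (h z (\<zeta> i \<omega>)) < \<epsilon>)" if "\<epsilon> > 0" for \<epsilon>
        using A_i[OF bounded_cball that, of 0 "R + 1"] in_Z by meson
    qed (use vh in auto)
    define R' where "R' = R + norm xstar"
    have "compact (hbar ` cball 0 (R' + 1 + norm xstar))"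
      using A_iii(1) by (intro compact_continuous_image continuous_on_subset[OF A_iii(1)]) auto
    then have "bounded (hbar ` cball 0 (R' + 1 + norm xstar))" by (rule compact_imp_bounded)
    then obtain B where B: "\<And>x. x \<in> cball 0 (R' + 1 + norm xstar) \<Longrightarrow> norm (hbar x) \<le> B"
      unfolding bounded_iff by (metis image_eqI)
    have "(\<lambda>n. X n \<omega> - xstar) \<longlonglongrightarrow> 0"
    proof (rule perturbed_inclusion_converges[OF a, where F = F and V = V and ?V0.0 = V0hat and \<U> = \<U>
          and y = "\<lambda>n. hbar (X n \<omega>) + g n" and e = "\<lambda>n. (h (X n \<omega>) (\<zeta> n \<omega>) - hbar (X n \<omega>)) + e n" and R = R' and C = "B + C"])
      show "norm (X n \<omega> - xstar) \<le> R'" for n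
        using norm_triangle_ineq4[of "X n \<omega>" xstar] R[of n] by (simp add: R'_def)
      show "(X (Suc n) \<omega> - xstar) - (X n \<omega> - xstar)
          = a n *\<^sub>R (hbar (X n \<omega>) + g n + ((h (X n \<omega>) (\<zeta> n \<omega>) - hbar (X n \<omega>)) + e n))" for n
        using step[of n] by (simp add: algebra_simps)
      show "hbar (X n \<omega>) + g n \<in> F (X n \<omega> - xstar)" for n
        using g by (simp add: F_iff)
      show "vanishing a (\<lambda>n. (h (X n \<omega>) (\<zeta> n \<omega>) - hbar (X n \<omega>)) + e n)"
        by (intro vanishing_add vhX ve)
      show "F x \<subseteq> cball 0 (B + C)" if "norm x \<le> R' + 1" for x
      proof
        fix w assume "w \<in> F x"
        then have "norm (w - hbar (x + xstar)) \<le> C" using GC by (auto simp: F_iff)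
        moreover have "norm (hbar (x + xstar)) \<le> B"
          using norm_triangle_ineq[of x xstar] that by (intro B) simp
        ultimately show "w \<in> cball 0 (B + C)"
          using norm_triangle_sub[of w "hbar (x + xstar)"] by simp
      qed
    qed (use F_convex F_closed F_graph GS_lyapunov(1,5) GS_lyapunov(3,6)[folded F_def] in auto)
    then show ?thesis by (simp add: LIM_zero_iff)
  qed
  have "AE \<omega> in M. (\<lambda>n. X n \<omega>) \<longlonglongrightarrow> xstar"
    using AE_space X_bounded AE_h AE_m AE_h0 A_v(3) by eventually_elim (rule conv)
  then obtain N where "{\<omega> \<in> space M. \<not> (\<lambda>n. X n \<omega>) \<longlonglongrightarrow> xstar} \<subseteq> N" "N \<in> null_sets M"
    by (auto elim!: AE_E simp: null_sets_def)
  then show ?thesis by (intro bexI[of _ N]) auto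
qed

end
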